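(* The following five identities hold. (1) $$\mathrm{m}\left((1+x)+(1-x)(y+z)\right)=\frac{28}{5\pi^2}\zeta(3).$$ (2) $$\mathrm{m}\left(x+(1+x)^2+(1+x+y)^2z\right)=\frac{28}{5\pi^2}\zeta(3)+\log\left(\frac{1+\sqrt5}{2}\right).$$ (3) $$\mathrm{m}\left((1+x+z)(1+x^{-1}+z^{-1})+y(1+x-z)(1+x^{-1}-z^{-1})\right)=\frac{56}{5\pi^2}\zeta(3).$$ (4) $$\mathrm{m}\left((z-z^{-1})+(x+x^{-1})(y+y^{-1})\right)=\frac{28}{5\pi^2}\zeta(3).$$ (5) $$\mathrm{m}\left(\left(4z(1+y)^2-(1+z)^2\right)(1+3x+x^2)^2+(1-z)^2(1+y)^2(1+x+x^2)^2\right)=\frac{56}{5\pi^2}\zeta(3)+\frac{16}{3\pi}G+\log(2).$$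
   Context: For a nonzero Laurent polynomial $P$ in $n$ variables, its (logarithmic) Mahler measure is $\mathrm{m}(P)=\int_0^1\cdots\int_0^1\log|P(e^{2\pi i\theta_1},\dots,e^{2\pi i\theta_n})|\,d\theta_1\cdots d\theta_n$. Here $\zeta$ is the Riemann zeta function and $G=\sum_{n=0}^\infty\frac{(-1)^n}{(2n+1)^2}=1-\frac1{3^2}+\frac1{5^2}-\cdots$ is Catalan's constant. *)

theory Defs
  imports "HOL-Analysis.Analysis" "HOL-Library.Poly_Mapping"
begin

text \<open>A Laurent polynomial is a finitely supported family of complex coefficients indexed by
  exponent vectors; an exponent vector is itself a finitely supported map from variable indices
  to integers. Ring operations are those of \<^type>\<open>poly_mapping\<close> (convolution product).\<close>

type_synonym laurent = "(nat \<Rightarrow>\<^sub>0 int) \<Rightarrow>\<^sub>0 complex"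

definition laurent_monom :: "nat \<Rightarrow> int \<Rightarrow> laurent" where
  "laurent_monom i k = Poly_Mapping.single (Poly_Mapping.single i k) 1"

definition laurent_eval :: "laurent \<Rightarrow> (nat \<Rightarrow> complex) \<Rightarrow> complex" where
  "laurent_eval P w =
     (\<Sum>m\<in>Poly_Mapping.keys P. Poly_Mapping.lookup P m *
        (\<Prod>i\<in>Poly_Mapping.keys m. w i powi Poly_Mapping.lookup m i))"

text \<open>Meaningful for nonzero Laurent polynomials in the variables with indices below \<open>n\<close>; the
  convention \<open>ln 0 = 0\<close> then only affects a null set. The multiple integral is the Lebesgue
  integral over the unit cube.\<close>

definition mahler_measure :: "nat \<Rightarrow> laurent \<Rightarrow> real" where
  "mahler_measure n P =
     (LINT \<theta> : ({..<n} \<rightarrow>\<^sub>E {0..1}) | PiM {..<n} (\<lambda>_. lborel).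
        ln (cmod (laurent_eval P (\<lambda>i. exp (2 * of_real pi * \<i> * of_real (\<theta> i))))))"

abbreviation X :: laurent where "X \<equiv> laurent_monom 0 1"
abbreviation Y :: laurent where "Y \<equiv> laurent_monom 1 1"
abbreviation Z :: laurent where "Z \<equiv> laurent_monom 2 1"
abbreviation X_inv :: laurent where "X_inv \<equiv> laurent_monom 0 (-1)"
abbreviation Y_inv :: laurent where "Y_inv \<equiv> laurent_monom 1 (-1)"
abbreviation Z_inv :: laurent where "Z_inv \<equiv> laurent_monom 2 (-1)"

text \<open>The Dirichlet series represents the Riemann zeta function for \<open>s > 1\<close> only.\<close>

definition zeta :: "real \<Rightarrow> real" where
  "zeta s = suminf (\<lambda>n. 1 / real (Suc n) powr s)"

definition catalan_const :: real where
  "catalan_const = suminf (\<lambda>n. (-1) ^ n / real (2 * n + 1) ^ 2)"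

end

theory Submission
  imports Defs "HOL-Real_Asymp.Real_Asymp"
begin

text \<open>
  Write \<open>Ti r\<close> for the inverse tangent integral \<open>\<integral> arctan s / s\<close> over \<open>[0, r]\<close> and \<open>r = \<bar>1 + x\<bar>\<close>.
  Jensen's formula in one well-chosen variable removes that variable from each of the five measures,
  and the average over the second variable is then, up to elementary terms, a multiple of \<open>Ti r\<close>:
  in each case the integrand vanishes at \<open>r = 0\<close>, or has mean zero there, and the mean of its
  derivative in \<open>r\<close> is an elementary integral with value a multiple of \<open>arctan r / r\<close>. All five
  identities therefore reduce to the single mean of \<open>Ti \<bar>1 + x\<bar>\<close> over the circle.

  Exchanging integrals turns this mean into a one-variable integral of the Legendre function
  \<open>\<chi>\<^sub>2\<close>, which has a primitive in terms of dilogarithms and trilogarithms. Its upper limit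
  is the inverse \<open>p\<close> of the golden ratio, and since \<open>p\<^sup>2 = 1 - p\<close>, Landen's three-term
  relation and the duplication formula leave only a rational multiple of \<open>\<zeta>(3)\<close>.

  The additional terms are the Mahler measure of \<open>1 + 3x + x\<^sup>2\<close> in (2) and the mean of
  \<open>ln (1 + \<bar>1 + x\<bar>)\<close> in (5), which gives Catalan's constant because
  \<open>1 + 2 cos u = sin (3u/2) / sin (u/2)\<close>.
\<close>

section \<open>Exchange of integrals and periodic functions\<close>

text \<open>The obstacle is the exchange of integrals of logarithms that have zeros on the torus.
  Both exchange theorems therefore work with nonnegative integrands: the parameter derivatives are
  nonnegative on a quarter period, and on the cube the logarithm is subtracted from an upper bound.
  Integrability then results from the evaluation instead of preceding it; the values come from
  explicit primitives.

  The variable for Jensen's formula is \<open>x\<close> in (1), \<open>z\<close> in (2) and (4),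
  \<open>y\<close> in (3) and (5). In (1) the second average becomes accessible only after a
  rotation and an exchange of the two outer integrals.

  The golden ratio comes from the range of \<open>r\<close>: it reaches 2, and the substitution
  \<open>t = sinh a\<close>, \<open>y = tanh (a/2)\<close>, which removes
  \<open>sqrt (1 + t^2)\<close>, sends \<open>t = 2\<close> to \<open>(sqrt 5 - 1) / 2\<close>. The
  primitive has the value \<open>7/10 * zeta 3\<close> there, so the mean of \<open>Ti r\<close> is
  \<open>14 / (5 * pi) * zeta 3\<close>; the measures take \<open>2 / pi\<close> or
  \<open>4 / pi\<close> times this.\<close>

lemma has_integral_swap_nonneg:
  fixes g :: "real \<Rightarrow> real \<Rightarrow> real"
  assumes meas: "(\<lambda>(s,u). g s u) \<in> borel_measurable (borel \<Otimes>\<^sub>M borel)"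
    and nonneg: "\<And>s u. s \<in> S \<Longrightarrow> u \<in> U \<Longrightarrow> 0 \<le> g s u"
    and S: "S \<in> sets borel" and U: "U \<in> sets borel"
    and fin: "finite M" "finite N"
    and G: "\<And>u. u \<in> U - N \<Longrightarrow> ((\<lambda>s. g s u) has_integral G u) S"
    and H: "\<And>s. s \<in> S - M \<Longrightarrow> (g s has_integral H s) U"
    and I: "(H has_integral I) S"
  shows "(G has_integral I) U"
proof -
  have [measurable]: "(\<lambda>(s,u). g s u) \<in> borel_measurable (lborel \<Otimes>\<^sub>M lborel)"
    using meas by simp
  have [measurable]: "S \<in> sets borel" "U \<in> sets borel" using S U by auto
  define k where "k s u = ennreal (g s u) * indicator S s * indicator U u" for s u
  have k_meas [measurable]: "case_prod k \<in> borel_measurable (lborel \<Otimes>\<^sub>M lborel)"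
    unfolding k_def by (simp add: case_prod_unfold) measurable
  define P where "P u = (\<integral>\<^sup>+s. k s u \<partial>lborel)" for u
  have P_meas [measurable]: "P \<in> borel_measurable borel"
    unfolding P_def by measurable
  have nonnegG: "0 \<le> G u" if "u \<in> U - N" for u
    using has_integral_nonneg[OF G[OF that]] nonneg that by auto
  have nonnegH: "0 \<le> H s" if "s \<in> S - M" for s
    using has_integral_nonneg[OF H[OF that]] nonneg that by auto
  have PG: "P u = ennreal (G u) * indicator U u" if "u \<notin> N" for u
  proof (cases "u \<in> U")
    case True
    then show ?thesis
      using nn_integral_has_integral_lebesgue'[OF _ G[of u]] nonneg that
      by (auto simp: P_def k_def)
  qed (auto simp: P_def k_def)
  have AEM: "AE s in lborel. s \<notin> M"
    using fin(1) by (intro AE_not_in) (auto simp: finite_imp_null_set_lborel)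
  have AEN: "AE s in lborel. s \<notin> N"
    using fin(2) by (intro AE_not_in) (auto simp: finite_imp_null_set_lborel)
  \<comment> \<open>On the exceptional set \<open>M\<close> nothing is known about
    \<open>H s\<close>, which may be negative there; it is replaced by 0 before the passage to a
    nonnegative Lebesgue integral.\<close>
  define H' where "H' s = (if s \<in> M then 0 else H s)" for s
  have I': "(H' has_integral I) S"
    using I by (rule has_integral_spike_finite[OF fin(1), rotated]) (auto simp: H'_def)
  have "I \<ge> 0"
    using has_integral_nonneg[OF I'] nonnegH by (auto simp: H'_def)
  have "(\<integral>\<^sup>+u. P u \<partial>lborel) = (\<integral>\<^sup>+s. \<integral>\<^sup>+u. k s u \<partial>lborel \<partial>lborel)"
    unfolding P_def by (rule lborel_pair.Fubini') measurable
  also have "\<dots> = (\<integral>\<^sup>+s. ennreal (H' s) * indicator S s \<partial>lborel)"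
  proof (rule nn_integral_cong_AE)
    show "AE s in lborel. (\<integral>\<^sup>+u. k s u \<partial>lborel) = ennreal (H' s) * indicator S s"
      using AEM
    proof eventually_elim
      case (elim s)
      show ?case
      proof (cases "s \<in> S")
        case True
        have "(\<integral>\<^sup>+u. ennreal (g s u) * indicator U u \<partial>lborel) = ennreal (H s)"
          using nn_integral_has_integral_lebesgue'[OF _ H[of s]] nonneg elim True by auto
        then show ?thesis using True elim by (auto simp: k_def H'_def)
      qed (auto simp: k_def)
    qed
  qed
  also have "\<dots> = ennreal I"
    using nonnegH by (intro nn_integral_has_integral_lebesgue' I') (auto simp: H'_def)
  finally have PI: "(\<integral>\<^sup>+u. P u \<partial>lborel) = ennreal I" .
  \<comment> \<open>A finite-valued version of \<open>P\<close>. As the total mass is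
    \<open>I\<close>, it has a gauge integral, and on \<open>U\<close> it agrees with
    \<open>G\<close> outside the finite set \<open>N\<close>; this yields the existence of the
    integral of \<open>G\<close> as well as its value.\<close>
  define Q where "Q u = enn2real (P u)" for u
  have QP: "AE u in lborel. ennreal (Q u) = P u"
    using AEN by eventually_elim (auto simp: Q_def PG indicator_def)
  have "(Q has_integral I) UNIV"
  proof (rule nn_integral_has_integral)
    show "(\<integral>\<^sup>+u. ennreal (Q u) \<partial>lborel) = ennreal I"
      using PI nn_integral_cong_AE[OF QP] by simp
    show "Q \<in> borel_measurable borel" unfolding Q_def by measurable
  qed (auto simp: Q_def \<open>I \<ge> 0\<close>)
  then have "((\<lambda>u. if u \<in> U then G u else 0) has_integral I) UNIV"
    by (rule has_integral_spike_finite[OF fin(2), rotated])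
       (auto simp: Q_def PG nonnegG)
  then show ?thesis by (simp only: has_integral_restrict_UNIV)
qed

lemma periodic_of_int:
  fixes f :: "real \<Rightarrow> 'a"
  assumes "\<And>x. f (x + 1) = f x"
  shows "f (x + of_int n) = f x"
proof -
  have *: "f (x + of_nat n) = f x" for x and n :: nat
    by (induction n) (use assms[of "x + of_nat _"] in \<open>auto simp: algebra_simps\<close>)
  show ?thesis
  proof (cases "n \<ge> 0")
    case True
    then show ?thesis using *[of x "nat n"] by simp
  next
    case False
    then show ?thesis using *[of "x + of_int n" "nat (- n)"] by simp
  qed
qed

lemma has_integral_periodic_shift:
  fixes f :: "real \<Rightarrow> real"
  assumes per: "\<And>x. f (x + 1) = f x" and I: "(f has_integral I) {0..1}"
  shows "((\<lambda>x. f (x + c)) has_integral I) {0..1}"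
proof -
  define d where "d = frac c"
  have d: "0 \<le> d" "d < 1" by (auto simp: d_def frac_lt_1)
  have eq: "f (x + c) = f (x + d)" for x
    using periodic_of_int[of f "x + d" "\<lfloor>c\<rfloor>"] per by (simp add: d_def frac_def)
  have int: "f integrable_on {0..d}" "f integrable_on {d..1}"
    using d by (auto intro!: integrable_on_subinterval[OF has_integral_integrable[OF I]])
  then obtain A B where AB: "(f has_integral A) {0..d}" "(f has_integral B) {d..1}"
    unfolding integrable_on_def by blast
  have "(f has_integral A + B) {0..1}"
    using AB d by (intro has_integral_combine[of 0 d 1]) auto
  then have I_eq: "I = A + B" using I has_integral_unique by blast
  have 1: "((\<lambda>x. f (x + d)) has_integral B) {0..1-d}"
    using has_integral_affinity'[of f B d 1 1 d] AB by simp
  have "((\<lambda>x. f (x + (d - 1))) has_integral A) {1-d..1}"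
    using has_integral_affinity'[of f A 0 d 1 "d-1"] AB by simp
  moreover have "f (x + (d - 1)) = f (x + d)" for x
    using per[of "x + (d-1)"] by simp
  ultimately have 2: "((\<lambda>x. f (x + d)) has_integral A) {1-d..1}" by simp
  have "((\<lambda>x. f (x + d)) has_integral B + A) {0..1}"
    using 1 2 d by (intro has_integral_combine[of 0 "1-d" 1]) auto
  then show ?thesis by (simp add: eq I_eq add.commute)
qed

lemma has_integral_periodic_double:
  fixes f :: "real \<Rightarrow> real"
  assumes per: "\<And>x. f (x + 1) = f x" and I: "(f has_integral I) {0..1}"
  shows "((\<lambda>x. f (2 * x)) has_integral I) {0..1}"
proof -
  have 1: "((\<lambda>x. f (2 * x)) has_integral I/2) {0..1/2}"
    using has_integral_affinity'[of f I 0 1 2 0] I by (simp add: field_simps)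
  have "((\<lambda>x. f (2 * x + (-1))) has_integral I/2) {1/2..1}"
    using has_integral_affinity'[of f I 0 1 2 "-1"] I by (simp add: field_simps)
  moreover have "f (2 * x + (-1)) = f (2 * x)" for x
    using per[of "2 * x - 1"] by simp
  ultimately have 2: "((\<lambda>x. f (2 * x)) has_integral I/2) {1/2..1}" by simp
  show ?thesis
    using has_integral_combine[OF _ _ 1 2] by simp
qed

text \<open>The reflected end points enter through equations, so that the rule also matches
  intervals not literally written as \<open>c - b\<close> and \<open>c - a\<close>.\<close>

lemma has_integral_reflect_interval:
  fixes f :: "real \<Rightarrow> real"
  assumes "(f has_integral I) {a..b}" "a' = c - b" "b' = c - a"
  shows "((\<lambda>x. f (c - x)) has_integral I) {a'..b'}"
proof -
  have "((\<lambda>x. f (- x)) has_integral I) {-b..-a}"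
    using assms by simp
  from has_integral_affinity'[of "\<lambda>x. f (- x)" I "-b" "-a" 1 "-c"] this
  show ?thesis by (simp add: assms)
qed

section \<open>Jensen's formula for linear polynomials\<close>

definition unit_circ :: "real \<Rightarrow> complex" where "unit_circ t = cis (2 * pi * t)"

lemma unit_circ_simps [simp]:
  "cmod (unit_circ t) = 1" "unit_circ t \<noteq> 0" "unit_circ 0 = 1"
  "unit_circ (t + 1) = unit_circ t" "unit_circ (t + 1/2) = - unit_circ t"
  by (simp_all add: unit_circ_def ring_distribs cis_mult[symmetric] del: cis_mult)

lemma unit_circ_add: "unit_circ (s + t) = unit_circ s * unit_circ t"
  by (simp add: unit_circ_def cis_mult ring_distribs)

lemma unit_circ_three_halves: "unit_circ (3/2 + t) = - unit_circ t"
  using unit_circ_simps(4)[of "t + 1/2"] unit_circ_simps(5)[of t] by (simp add: add_ac)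

lemma unit_circ_minus: "unit_circ (- t) = cnj (unit_circ t)"
  by (simp add: unit_circ_def cis_cnj)

lemma unit_circ_polar: "\<exists>\<phi>. w = of_real (cmod w) * unit_circ \<phi>"
proof
  show "w = of_real (cmod w) * unit_circ (Arg w / (2*pi))"
    using rcis_cmod_Arg[of w] by (simp add: unit_circ_def rcis_def)
qed

lemma continuous_unit_circ [continuous_intros]:
  "continuous_on A f \<Longrightarrow> continuous_on A (\<lambda>x. unit_circ (f x))"
  unfolding unit_circ_def by (intro continuous_intros)

lemma borel_measurable_unit_circ [measurable]: "unit_circ \<in> borel_measurable borel"
  by (intro borel_measurable_continuous_onI continuous_intros)

text \<open>Concavity: on \<open>[0, pi/2]\<close> the sine lies above its chord. This keeps
  \<open>ln (2 * sin (pi * x))\<close> above an integrable logarithm.\<close>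

lemma sin_ge_linear: "2 * x \<le> sin (pi * x)" if "0 \<le> x" "x \<le> 1/2" for x :: real
proof -
  have "convex_on {0..pi/2} (\<lambda>x. - sin x)"
  proof (rule f''_ge0_imp_convex)
    show "((\<lambda>x. - sin x) has_real_derivative - cos x) (at x)" for x :: real
      by (auto intro!: derivative_eq_intros)
    show "((\<lambda>x. - cos x) has_real_derivative sin x) (at x)" for x :: real
      by (auto intro!: derivative_eq_intros)
    show "0 \<le> sin x" if "x \<in> {0..pi/2}" for x :: real
      using that by (intro sin_ge_zero) auto
  qed simp
  from convex_onD[OF this, of "2*x" 0 "pi/2"] that show ?thesis
    by (simp add: mult.commute)
qed

lemma cmod_one_plus_unit_circ: "cmod (1 + unit_circ t) = 2 * \<bar>cos (pi * t)\<bar>"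
proof -
  have "1 + unit_circ t = cis (pi * t) * (2 * of_real (cos (pi * t)))"
    using cos_double_cos[of "pi * t"] sin_double[of "pi * t"]
    by (simp add: unit_circ_def complex_eq_iff power2_eq_square mult.assoc)
  then show ?thesis by (simp add: norm_mult)
qed

text \<open>A shift by 1/2 moves the zero of \<open>1 + unit_circ t\<close> to the end points, where
  the modulus is \<open>2 * sin (pi * x)\<close>; on \<open>[0, 1/2]\<close> its logarithm lies
  between \<open>ln (4 * x)\<close> and \<open>ln 2\<close>. Only integrability is extracted, since
  the value follows from the doubling argument for Jensen's formula.\<close>

lemma integrable_ln_one_plus_unit_circ:
  "(\<lambda>t. ln (cmod (1 + unit_circ t))) integrable_on {0..1}"
proof -
  define k where "k = (\<lambda>x. ln (2 * sin (pi * x)))"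
  have ln_int: "((\<lambda>x. ln (2 * x)) has_integral -1/2) {0..1/2::real}"
  proof -
    have "((\<lambda>x. ln (2 * x)) has_integral (1/2 * ln (2 * (1/2)) - 1/2) - (0 * ln (2 * 0) - 0)) {0..1/2::real}"
    proof (rule fundamental_theorem_of_calculus_interior)
      show "continuous_on {0..1/2::real} (\<lambda>x. x * ln (2 * x) - x)"
        unfolding continuous_on_eq_continuous_within
      proof
        fix x :: real assume x: "x \<in> {0..1/2}"
        show "continuous (at x within {0..1/2}) (\<lambda>x. x * ln (2 * x) - x)"
        proof (cases "x = 0")
          case True
          have "((\<lambda>x::real. x * ln (2 * x) - x) \<longlongrightarrow> 0) (at_right 0)"
            by real_asymp
          then show ?thesis
            unfolding True continuous_within
            by (simp add: at_within_Icc_at_right)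
        next
          case False
          then show ?thesis using x by (intro continuous_intros) auto
        qed
      qed
    next
      show "((\<lambda>x. x * ln (2 * x) - x) has_vector_derivative ln (2 * x)) (at x)"
        if "x \<in> {0<..<1/2}" for x :: real
        unfolding has_real_derivative_iff_has_vector_derivative[symmetric]
        using that by (auto intro!: derivative_eq_intros)
    qed simp
    then show ?thesis by simp
  qed
  have k1: "k integrable_on {0..1/2}"
  proof (rule measurable_bounded_by_integrable_imp_integrable)
    show "(\<lambda>x. ln 2 - ln (2 * x)) integrable_on {0..1/2::real}"
      using ln_int by (intro integrable_diff integrable_const_ivl) (auto simp: integrable_on_def)
    have "k \<in> borel_measurable lebesgue"
      unfolding k_def by (intro measurable_completion) measurable
    then show "k \<in> borel_measurable (lebesgue_on {0..1/2})"
      by (rule measurable_restrict_space1)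
    show "norm (k x) \<le> ln 2 - ln (2 * x)" if "x \<in> {0..1/2}" for x
    proof (cases "x = 0")
      case False
      then have x: "0 < x" "x \<le> 1/2" using that by auto
      have "ln (2 * (2 * x)) \<le> k x" "k x \<le> ln 2"
        using sin_ge_linear[of x] x unfolding k_def by (subst ln_le_cancel_iff; simp)+
      moreover have "ln (2 * (2 * x)) = ln 2 + ln (2 * x)" using x by (subst ln_mult) auto
      moreover have "ln (2 * x) \<le> 0" using x by simp
      moreover have "0 \<le> ln (2::real)" by simp
      ultimately show ?thesis unfolding real_norm_def by linarith
    qed (auto simp: k_def)
  qed auto
  then obtain I where I: "(k has_integral I) {0..1/2}"
    unfolding integrable_on_def by blast
  have "((\<lambda>x. k (1 - x)) has_integral I) {1/2..1}"
    by (rule has_integral_reflect_interval[OF I]) auto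
  moreover have "k (1 - x) = k x" for x
    by (simp add: k_def ring_distribs sin_diff)
  ultimately have "(k has_integral I) {1/2..1}" by simp
  from has_integral_combine[OF _ _ I this]
  have k01: "(k has_integral I + I) {0..1}" by simp
  have "((\<lambda>t. ln (cmod (1 + unit_circ (t + 1/2)))) has_integral I + I) {0..1}"
  proof (rule has_integral_eq[OF _ k01])
    fix x :: real assume x: "x \<in> {0..1}"
    have "0 \<le> sin (pi * x)" using x by (intro sin_ge_zero) (auto simp: mult_le_cancel_left1)
    then show "k x = ln (cmod (1 + unit_circ (x + 1/2)))"
      unfolding cmod_one_plus_unit_circ by (simp add: k_def ring_distribs cos_add)
  qed
  then have "((\<lambda>t. ln (cmod (1 + unit_circ (t + -1/2 + 1/2)))) has_integral I + I) {0..1}"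
    by (rule has_integral_periodic_shift[rotated])
       (simp add: unit_circ_three_halves)
  then have "((\<lambda>t. ln (cmod (1 + unit_circ t))) has_integral I + I) {0..1}"
    by simp
  then show ?thesis unfolding integrable_on_def by blast
qed

lemma unit_circ_eq_neg1_iff:
  assumes "t \<in> {0..1}"
  shows "1 + unit_circ t = 0 \<longleftrightarrow> t = 1/2"
proof
  assume "1 + unit_circ t = 0"
  then have "cos (pi * t) = cos (pi / 2)"
    using cmod_one_plus_unit_circ[of t] by simp
  then have "pi * t = pi / 2"
    using assms by (intro cos_inj_pi[of "pi * t" "pi / 2"]) (simp_all add: mult_left_le)
  then show "t = 1/2" by simp
next
  assume t: "t = 1/2"
  show "1 + unit_circ t = 0"
    unfolding t using unit_circ_simps(5)[of 0] by simp
qed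

lemma unit_circ_eq_1_iff:
  assumes "t \<in> {0..1}"
  shows "1 - unit_circ t = 0 \<longleftrightarrow> t = 0 \<or> t = 1"
proof
  assume "1 - unit_circ t = 0"
  then have "sin (pi * t) = 0"
    using cmod_one_plus_unit_circ[of "t + 1/2"] by (simp add: ring_distribs cos_add)
  then show "t = 0 \<or> t = 1"
    using assms sin_gt_zero[of "pi * t"] by (cases "t = 0 \<or> t = 1") auto
qed (use unit_circ_simps(4)[of 0] in auto)

text \<open>Since \<open>(1 + a z) (1 - a z) = 1 - a\<^sup>2 z\<^sup>2\<close>, the integral \<open>I a\<close> satisfies
  \<open>I (a\<^sup>2) = 2 I a\<close>. This forces \<open>I 1 = 0\<close>, and also \<open>I a = 0\<close> for \<open>a < 1\<close>, where
  \<open>I\<close> is bounded along the orbit of \<open>a\<close> under squaring.\<close>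

lemma jensen_unit_radius:
  assumes "0 \<le> a" "a \<le> 1"
  shows "((\<lambda>t. ln (cmod (1 + of_real a * unit_circ t))) has_integral 0) {0..1}"
proof -
  define h where "h = (\<lambda>a t. ln (cmod (1 + of_real a * unit_circ t)))"
  define I where "I a = integral {0..1} (h a)" for a
  have per: "h a (t + 1) = h a t" for a t by (simp add: h_def)
  have lower: "1 - a \<le> cmod (1 + of_real a * unit_circ t)"
    and upper: "cmod (1 + of_real a * unit_circ t) \<le> 1 + a" if "0 \<le> a" for a t
    using that norm_diff_ineq[of 1 "of_real a * unit_circ t"] norm_triangle_ineq[of 1 "of_real a * unit_circ t"]
    by (auto simp: norm_mult)
  have int: "(h a has_integral I a) {0..1}" if "0 \<le> a" "a \<le> 1" for a
  proof -
    have "h a integrable_on {0..1}"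
    proof (cases "a = 1")
      case True
      then show ?thesis using integrable_ln_one_plus_unit_circ by (simp add: h_def)
    next
      case False
      have "1 + of_real a * unit_circ t \<noteq> 0" for t
        using lower[of a t] False that by auto
      then show ?thesis unfolding h_def
        by (intro integrable_continuous_interval continuous_intros) auto
    qed
    then show ?thesis by (simp add: I_def integrable_integral)
  qed
  have double: "I (a\<^sup>2) = 2 * I a" if a: "0 \<le> a" "a \<le> 1" for a
  proof -
    have a2: "0 \<le> a\<^sup>2" "a\<^sup>2 \<le> 1" using a by (auto simp: power_le_one)
    have "((\<lambda>t. h (a\<^sup>2) (t + 1/2)) has_integral I (a\<^sup>2)) {0..1}"
      using int[OF a2] per by (intro has_integral_periodic_shift[where f="h (a\<^sup>2)"]) auto
    then have 1: "((\<lambda>t. h (a\<^sup>2) (2 * t + 1/2)) has_integral I (a\<^sup>2)) {0..1}"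
      by (intro has_integral_periodic_double[where f="\<lambda>t. h (a\<^sup>2) (t + 1/2)"])
         (simp_all add: h_def unit_circ_three_halves)
    have 2: "((\<lambda>t. h a t + h a (t + 1/2)) has_integral I a + I a) {0..1}"
      using int[OF a] per
      by (intro has_integral_add has_integral_periodic_shift[where f="h a"]) auto
    have "((\<lambda>t. h (a\<^sup>2) (2 * t + 1/2)) has_integral I a + I a) {0..1}"
    proof (rule has_integral_spike_finite[OF _ _ 2])
      show "finite {0, 1/2, 1::real}" by simp
      fix t :: real assume t: "t \<in> {0..1} - {0, 1/2, 1}"
      define z where "z = unit_circ t"
      \<comment> \<open>The factors vanish only for \<open>a = 1\<close>, the first at
        \<open>t = 1/2\<close>, the second at \<open>t = 0\<close> and \<open>t = 1\<close>; these
        are the removed points.\<close>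
      have nz: "1 + of_real a * z \<noteq> 0" "1 - of_real a * z \<noteq> 0"
        using t lower[of a t] lower[of a "t + 1/2"] a unit_circ_eq_neg1_iff[of t] unit_circ_eq_1_iff[of t]
        unfolding unit_circ_simps(5)
        by (cases "a = 1"; auto simp: z_def)+
      have "unit_circ (2 * t + 1/2) = - z\<^sup>2"
        using unit_circ_add[of t t] by (simp add: z_def power2_eq_square)
      moreover have "1 + of_real (a\<^sup>2) * (- z\<^sup>2) = (1 + of_real a * z) * (1 - of_real a * z)"
        by (simp add: algebra_simps power2_eq_square)
      ultimately have "h (a\<^sup>2) (2 * t + 1/2) = ln (cmod ((1 + of_real a * z) * (1 - of_real a * z)))"
        unfolding h_def by (simp only:)
      also have "\<dots> = h a t + h a (t + 1/2)"
        using nz unfolding h_def norm_mult unit_circ_simps(5)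
        by (subst ln_mult) (auto simp: z_def)
      finally show "h (a\<^sup>2) (2 * t + 1/2) = h a t + h a (t + 1/2)" .
    qed
    from has_integral_unique[OF 1 this] show ?thesis by simp
  qed
  have "I a = 0"
  proof (cases "a = 1")
    case True
    then show ?thesis using double[of 1] by simp
  next
    case False
    have a: "0 \<le> a" "a < 1" using assms False by auto
    have bound: "\<bar>I b\<bar> \<le> - ln (1 - a)" if b: "0 \<le> b" "b \<le> a" for b
    proof -
      have "norm (I b) \<le> - ln (1 - a) * measure lborel {0..1::real}"
      proof (rule has_integral_bound_real)
        show "norm (h b t) \<le> - ln (1 - a)" for t
        proof -
          let ?m = "cmod (1 + of_real b * unit_circ t)"
          have m: "1 - a \<le> ?m" "?m \<le> 1 + b" using lower[of b t] upper[of b t] b by auto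
          \<comment> \<open>The same constant must bound the logarithm from above, where
            \<open>ln (1 + b)\<close> is the natural bound; the two are compared through
            \<open>1 - a^2 \<le> 1\<close>.\<close>
          have "(1 + b) * (1 - a) \<le> (1 + a) * (1 - a)"
            using a b by (intro mult_right_mono) auto
          also have "\<dots> \<le> 1" by (simp add: algebra_simps)
          finally have "1 + b \<le> inverse (1 - a)"
            using a by (simp add: inverse_eq_divide pos_le_divide_eq)
          then have "?m \<le> inverse (1 - a)" using m by linarith
          then have "ln ?m \<le> ln (inverse (1 - a))" using m a by (subst ln_le_cancel_iff) auto
          moreover have "ln (1 - a) \<le> ln ?m" using m a by (subst ln_le_cancel_iff) auto
          ultimately show ?thesis using a by (simp add: h_def ln_inverse)
        qed
      qed (use int[of b] b a in auto)
      then show ?thesis by simp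
    qed
    have pow: "I (a ^ (2 ^ n)) = 2 ^ n * I a" for n
    proof (induction n)
      case (Suc n)
      have "I (a ^ (2 ^ Suc n)) = I ((a ^ (2 ^ n))\<^sup>2)" by (simp add: power_mult[symmetric] mult.commute)
      also have "\<dots> = 2 * I (a ^ (2 ^ n))" using a by (intro double) (auto simp: power_le_one)
      finally show ?case using Suc by simp
    qed simp
    show ?thesis
    proof (rule ccontr)
      assume "I a \<noteq> 0"
      obtain n where n: "- ln (1 - a) / \<bar>I a\<bar> < 2 ^ n"
        using real_arch_pow[of 2] by auto
      have "\<bar>I (a ^ (2 ^ n))\<bar> \<le> - ln (1 - a)"
        using a power_decreasing[of 1 "2 ^ n" a] by (intro bound) auto
      then have "2 ^ n * \<bar>I a\<bar> \<le> - ln (1 - a)" by (simp add: pow abs_mult)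
      with n \<open>I a \<noteq> 0\<close> show False by (simp add: field_simps)
    qed
  qed
  with int[OF assms] show ?thesis by (simp add: h_def)
qed

text \<open>At a zero the convention \<open>ln 0 = 0\<close> breaks the additivity of the logarithm,
  so the zeros of linear factors are removed as finite exceptional sets. Injectivity is used on the
  open interval only, because 0 and 1 give the same point of the circle.\<close>

lemma finite_zeros_unit_circ:
  assumes "c \<noteq> 0 \<or> d \<noteq> 0"
  shows "finite {t\<in>{0..1}. c + d * unit_circ t = 0}"
proof (cases "d = 0")
  case True
  then show ?thesis using assms by simp
next
  case False
  have "inj_on unit_circ {0<..<1}"
  proof (rule inj_onI)
    fix x y :: real assume xy: "x \<in> {0<..<1}" "y \<in> {0<..<1}" "unit_circ x = unit_circ y"
    have "unit_circ \<bar>x - y\<bar> = 1"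
      using xy unit_circ_add[of "x - y" y] unit_circ_minus[of "x - y"] by (auto simp: abs_if)
    then have "\<bar>x - y\<bar> = 0 \<or> \<bar>x - y\<bar> = 1"
      using unit_circ_eq_1_iff[of "\<bar>x - y\<bar>"] xy by auto
    then show "x = y" using xy by auto
  qed
  then have "finite {t\<in>{0<..<1}. unit_circ t = - c / d}"
    using finite_vimage_IntI[of "{- c / d}" unit_circ "{0<..<1}"]
    by (auto simp: vimage_def Int_def conj_commute)
  then have "finite ({t\<in>{0<..<1}. unit_circ t = - c / d} \<union> {0, 1})" by simp
  moreover have "{t\<in>{0..1}. c + d * unit_circ t = 0} \<subseteq> {t\<in>{0<..<1}. unit_circ t = - c / d} \<union> {0, 1}"
  proof
    fix t assume t: "t \<in> {t\<in>{0..1}. c + d * unit_circ t = 0}"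
    then have "d * unit_circ t = - c" by (auto simp: add_eq_0_iff)
    then have "unit_circ t = - c / d" by (metis False nonzero_mult_div_cancel_left)
    then show "t \<in> {t\<in>{0<..<1}. unit_circ t = - c / d} \<union> {0, 1}" using t by auto
  qed
  ultimately show ?thesis using finite_subset by blast
qed

text \<open>If \<open>cmod d \<le> cmod c\<close>, factoring out \<open>c\<close> and rotating
  leaves a radius in \<open>[0, 1]\<close>. The form with \<open>max\<close> suits coefficients
  whose order changes with the other variables.\<close>

theorem jensen_linear:
  fixes c d :: complex
  assumes "c \<noteq> 0 \<or> d \<noteq> 0"
  shows "((\<lambda>t. ln (cmod (c + d * unit_circ t))) has_integral ln (max (cmod c) (cmod d))) {0..1}"
proof -
  have *: "((\<lambda>t. ln (cmod (c + d * unit_circ t))) has_integral ln (cmod c)) {0..1}"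
    if cd: "c \<noteq> 0" "cmod d \<le> cmod c" for c d
  proof -
    obtain \<phi> where phi: "d / c = of_real (cmod (d / c)) * unit_circ \<phi>"
      using unit_circ_polar by blast
    define a where "a = cmod (d / c)"
    have a: "0 \<le> a" "a \<le> 1" using cd by (auto simp: a_def norm_divide)
    have "((\<lambda>t. ln (cmod (1 + of_real a * unit_circ (t + \<phi>)))) has_integral 0) {0..1}"
      by (rule has_integral_periodic_shift[where f="\<lambda>t. ln (cmod (1 + of_real a * unit_circ t))"])
         (use jensen_unit_radius[OF a] in simp_all)
    then have s: "((\<lambda>t. ln (cmod c) + ln (cmod (1 + of_real a * unit_circ (t + \<phi>)))) has_integral ln (cmod c)) {0..1}"
      using has_integral_add[OF has_integral_const_real[of "ln (cmod c)" 0 1]] by fastforce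
    have dc: "d = c * (of_real a * unit_circ \<phi>)" using phi cd by (simp add: a_def field_simps)
    have eq: "cmod (c + d * unit_circ t) = cmod c * cmod (1 + of_real a * unit_circ (t + \<phi>))" for t
      unfolding norm_mult[symmetric] unit_circ_add by (subst dc) (simp add: algebra_simps)
    show ?thesis
    proof (rule has_integral_spike_finite[OF _ _ s])
      show "finite {t\<in>{0..1}. c + d * unit_circ t = 0}"
        using cd by (intro finite_zeros_unit_circ) auto
      fix t assume t: "t \<in> {0..1} - {t\<in>{0..1}. c + d * unit_circ t = 0}"
      then have "1 + of_real a * unit_circ (t + \<phi>) \<noteq> 0" using eq[of t] by auto
      then show "ln (cmod (c + d * unit_circ t)) = ln (cmod c) + ln (cmod (1 + of_real a * unit_circ (t + \<phi>)))"
        unfolding eq using cd by (subst ln_mult) auto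
    qed
  qed
  show ?thesis
  proof (cases "cmod d \<le> cmod c")
    case True
    moreover have "c \<noteq> 0" using True assms by auto
    ultimately show ?thesis using *[of c d] by (simp add: max_def)
  next
    case False
    \<comment> \<open>On the circle \<open>u * cnj u = 1\<close>, so \<open>c + d * u\<close> and
      \<open>cnj d + cnj c * u\<close> have the same modulus: the coefficients exchange
      places.\<close>
    then have "((\<lambda>t. ln (cmod (cnj d + cnj c * unit_circ t))) has_integral ln (cmod (cnj d))) {0..1}"
      by (intro *[of "cnj d" "cnj c"]) auto
    moreover have "cmod (cnj d + cnj c * unit_circ t) = cmod (c + d * unit_circ t)" for t
    proof -
      have 1: "unit_circ t * cnj (unit_circ t) = 1"
        by (simp add: complex_norm_square[symmetric])
      have "c + d * unit_circ t = unit_circ t * (d + c * cnj (unit_circ t))"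
        by (simp only: distrib_left mult.left_commute[of "unit_circ t" c] 1) simp
      then have "cmod (c + d * unit_circ t) = cmod (cnj (d + c * cnj (unit_circ t)))"
        by (simp only: norm_mult unit_circ_simps complex_mod_cnj mult_1)
      then show ?thesis by simp
    qed
    ultimately show ?thesis using False by (simp add: max_def)
  qed
qed

lemma jensen_two_factors:
  fixes c d c' d' :: complex
  assumes "c \<noteq> 0 \<or> d \<noteq> 0" "c' \<noteq> 0 \<or> d' \<noteq> 0"
  shows "((\<lambda>t. ln (cmod ((c + d * unit_circ t) * (c' + d' * unit_circ t)))) has_integral
    ln (max (cmod c) (cmod d)) + ln (max (cmod c') (cmod d'))) {0..1}"
proof (rule has_integral_spike_finite[OF _ _ has_integral_add[OF jensen_linear jensen_linear]])
  let ?N = "{t\<in>{0..1}. c + d * unit_circ t = 0} \<union> {t\<in>{0..1}. c' + d' * unit_circ t = 0}"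
  show "finite ?N" using assms by (intro finite_UnI finite_zeros_unit_circ)
  fix t assume "t \<in> {0..1} - ?N"
  then show "ln (cmod ((c + d * unit_circ t) * (c' + d' * unit_circ t))) =
      ln (cmod (c + d * unit_circ t)) + ln (cmod (c' + d' * unit_circ t))"
    unfolding norm_mult by (intro ln_mult_pos) auto
qed (use assms in auto)

section \<open>Dilogarithms and trilogarithms\<close>

text \<open>Absolute summability makes the convergence uniform up to the end points;
  \<open>zeta 3\<close> and Catalan's constant are both reached as boundary values at 1.\<close>

lemma continuous_on_power_series_unit:
  fixes a :: "nat \<Rightarrow> real"
  assumes "summable (\<lambda>n. \<bar>a n\<bar>)"
  shows "continuous_on {-1..1} (\<lambda>x. suminf (\<lambda>n. a n * x ^ n))"
proof (rule uniform_limit_theorem)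
  show "uniform_limit {-1..1} (\<lambda>N x. \<Sum>n<N. a n * x ^ n) (\<lambda>x. suminf (\<lambda>n. a n * x ^ n)) sequentially"
    using assms
    by (rule Weierstrass_m_test[rotated])
       (auto simp: abs_mult power_abs abs_le_iff intro!: mult_left_le power_le_one)
qed (auto intro!: always_eventually continuous_intros)

text \<open>Phrased through \<open>x\<close> times the derivative, which multiplies the coefficient
  of \<open>x ^ n\<close> by \<open>n\<close>: this lowers the order of a polylogarithm by one and
  turns the series for Catalan's constant into that of the arctangent.\<close>

lemma DERIV_power_series_unit:
  fixes a :: "nat \<Rightarrow> real"
  assumes a: "summable (\<lambda>n. \<bar>a n\<bar>)" and x: "\<bar>x\<bar> < 1" "x \<noteq> 0"
    and s: "(\<lambda>n. real n * a n * x ^ n) sums s"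
  shows "((\<lambda>x. suminf (\<lambda>n. a n * x ^ n)) has_real_derivative s / x) (at x)"
proof -
  have sum1: "summable (\<lambda>n. a n * 1 ^ n)" using summable_rabs_cancel[OF a] by simp
  have D: "((\<lambda>x. suminf (\<lambda>n. a n * x ^ n)) has_real_derivative suminf (\<lambda>n. diffs a n * x ^ n)) (at x)"
    using x by (intro termdiffs_strong[OF sum1]) auto
  have "summable (\<lambda>n. diffs a n * x ^ n)"
    using x by (intro termdiff_converges[where K=1] ) (auto intro!: summable_mult powser_inside[OF sum1])
  from diffs_equiv[OF this]
  have "(\<lambda>n. x * (real n * a n * x ^ (n - Suc 0))) sums (x * suminf (\<lambda>n. diffs a n * x ^ n))"
    by (rule sums_mult)
  moreover have "x * (real n * a n * x ^ (n - Suc 0)) = real n * a n * x ^ n" for n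
    by (cases n) auto
  ultimately have "s = x * suminf (\<lambda>n. diffs a n * x ^ n)"
    using s sums_unique2 by force
  with D x show ?thesis by simp
qed

text \<open>The term with index \<open>0\<close> vanishes for \<open>k > 0\<close>, since \<open>1 / 0 = 0\<close>.\<close>

definition polylog :: "nat \<Rightarrow> real \<Rightarrow> real" where
  "polylog k x = suminf (\<lambda>n. (1 / real n ^ k) * x ^ n)"

lemma summable_inverse_powers: "2 \<le> k \<Longrightarrow> summable (\<lambda>n. 1 / real n ^ k)"
  using inverse_power_summable[of k, where 'a=real] by (simp add: inverse_eq_divide)

lemma polylog_sums:
  assumes "2 \<le> k" "\<bar>x\<bar> \<le> 1"
  shows "(\<lambda>n. (1 / real n ^ k) * x ^ n) sums polylog k x"
  unfolding polylog_def
proof (rule summable_sums, rule summable_rabs_cancel, rule summable_comparison_test')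
  show "norm \<bar>1 / real n ^ k * x ^ n\<bar> \<le> 1 / real n ^ k" if "n \<ge> 0" for n
    using assms by (auto simp: abs_mult power_abs intro!: mult_left_le power_le_one divide_right_mono)
qed (rule summable_inverse_powers[OF assms(1)])

lemma continuous_on_polylog: "2 \<le> k \<Longrightarrow> continuous_on {-1..1} (polylog k)"
  unfolding polylog_def using continuous_on_power_series_unit[of "\<lambda>n. 1 / real n ^ k"]
  by (simp add: summable_inverse_powers)

lemma polylog_0: "0 < k \<Longrightarrow> polylog k 0 = 0"
  using powser_zero[of "\<lambda>n. 1 / real n ^ k"] by (simp add: polylog_def)

text \<open>The linear decay at 0 outweighs the logarithm in products such as
  \<open>ln x * polylog 2 x\<close>.\<close>

lemma abs_polylog_le:
  assumes "2 \<le> k" "\<bar>x\<bar> \<le> 1"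
  shows "\<bar>polylog k x\<bar> \<le> \<bar>x\<bar> * polylog k 1"
proof -
  have 1: "(\<lambda>n. \<bar>x\<bar> * (1 / real n ^ k * 1 ^ n)) sums (\<bar>x\<bar> * polylog k 1)"
    using assms by (intro sums_mult polylog_sums) auto
  have "norm (polylog k x) \<le> suminf (\<lambda>n. \<bar>x\<bar> * (1 / real n ^ k * 1 ^ n))"
    unfolding polylog_def
  proof (rule norm_suminf_le)
    show "norm (1 / real n ^ k * x ^ n) \<le> \<bar>x\<bar> * (1 / real n ^ k * 1 ^ n)" for n
    proof (cases n)
      case 0
      then show ?thesis using assms by (simp add: power_0_left)
    next
      case (Suc m)
      have "\<bar>x\<bar> ^ Suc m \<le> \<bar>x\<bar>" using assms by (simp add: mult_left_le power_le_one)
      then show ?thesis by (simp add: Suc abs_mult power_abs divide_right_mono)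
    qed
  qed (use 1 in \<open>simp add: sums_iff\<close>)
  then show ?thesis using 1 by (simp add: sums_iff)
qed

text \<open>Odd powers cancel in the sum; in the surviving terms the index \<open>2 * n\<close>
  gives the factor \<open>2 ^ k\<close> and the argument \<open>x\<^sup>2\<close>.\<close>

lemma polylog_duplication:
  assumes "2 \<le> k" "\<bar>x\<bar> \<le> 1"
  shows "2 ^ k * (polylog k x + polylog k (- x)) = 2 * polylog k (x\<^sup>2)"
proof -
  have "(\<lambda>n. (1 / real n ^ k) * x ^ n + (1 / real n ^ k) * (- x) ^ n) sums (polylog k x + polylog k (- x))"
    using assms by (intro sums_add polylog_sums) auto
  then have "(\<lambda>n. (1 / real (2 * n) ^ k) * x ^ (2 * n) + (1 / real (2 * n) ^ k) * (- x) ^ (2 * n))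
      sums (polylog k x + polylog k (- x))"
  proof (subst sums_mono_reindex[where g = "\<lambda>n. 2 * n"])
    show "strict_mono (\<lambda>n::nat. 2 * n)" by (simp add: strict_mono_def)
    show "1 / real n ^ k * x ^ n + 1 / real n ^ k * (- x) ^ n = 0" if "n \<notin> range (\<lambda>n. 2 * n)" for n
    proof -
      have "odd n" using that by (auto elim!: evenE)
      then show ?thesis by simp
    qed
  qed
  then have "(\<lambda>n. 2 ^ k * ((1 / real (2 * n) ^ k) * x ^ (2 * n) + (1 / real (2 * n) ^ k) * (- x) ^ (2 * n)))
      sums (2 ^ k * (polylog k x + polylog k (- x)))"
    by (rule sums_mult)
  moreover have "2 ^ k * ((1 / real (2 * n) ^ k) * x ^ (2 * n) + (1 / real (2 * n) ^ k) * (- x) ^ (2 * n))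
      = 2 * ((1 / real n ^ k) * (x\<^sup>2) ^ n)" for n
  proof -
    have "(- x) ^ (2 * n) = x ^ (2 * n)" by simp
    then show ?thesis by (simp only: power_mult[of x 2 n]) (simp add: power_mult_distrib field_simps)
  qed
  ultimately have 1: "(\<lambda>n. 2 * ((1 / real n ^ k) * (x\<^sup>2) ^ n)) sums (2 ^ k * (polylog k x + polylog k (- x)))"
    by (simp only:)
  have 2: "(\<lambda>n. 2 * ((1 / real n ^ k) * (x\<^sup>2) ^ n)) sums (2 * polylog k (x\<^sup>2))"
    using assms by (intro sums_mult polylog_sums) (auto simp: abs_square_le_1)
  show ?thesis by (rule sums_unique2[OF 1 2])
qed

lemma DERIV_polylog_Suc:
  assumes "2 \<le> k" "\<bar>x\<bar> < 1" "x \<noteq> 0"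
  shows "(polylog (Suc k) has_real_derivative polylog k x / x) (at x)"
  unfolding polylog_def[of "Suc k", abs_def]
proof (rule DERIV_power_series_unit)
  have "real n * (1 / real n ^ Suc k) = 1 / real n ^ k" for n
    using assms by (cases "n = 0") auto
  then show "(\<lambda>n. real n * (1 / real n ^ Suc k) * x ^ n) sums polylog k x"
    using polylog_sums[of k x] assms by simp
qed (use assms summable_inverse_powers[of "Suc k"] in auto)

lemma DERIV_polylog_2:
  assumes "\<bar>x\<bar> < 1" "x \<noteq> 0"
  shows "(polylog 2 has_real_derivative - ln (1 - x) / x) (at x)"
  unfolding polylog_def[of 2, abs_def]
proof (rule DERIV_power_series_unit)
  have "(\<lambda>n. - (- (x ^ n / real n))) sums (- ln (1 - x))"
    using sums_minus[OF ln_series'[of "- x"]] assms by simp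
  moreover have "real n * (1 / (real n)\<^sup>2) * x ^ n = x ^ n / real n" for n
    by (cases "n = 0") (auto simp: power2_eq_square)
  ultimately show "(\<lambda>n. real n * (1 / (real n)\<^sup>2) * x ^ n) sums (- ln (1 - x))"
    by simp
qed (use assms summable_inverse_powers[of 2] in auto)

lemma polylog_3_1: "polylog 3 1 = zeta 3"
proof -
  have "(\<lambda>n. 1 / real n ^ 3) sums polylog 3 1" using polylog_sums[of 3 1] by simp
  then have "(\<lambda>n. 1 / real (Suc n) ^ 3) sums polylog 3 1" by (subst sums_Suc_iff) simp
  then show ?thesis using powr_numeral[of "real (Suc _)" "num.Bit1 num.One"]
    by (simp add: zeta_def sums_iff powr_numeral)
qed

section \<open>Trilogarithms corrected by dilogarithms, and Landen's relation\<close>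

definition rogers :: "real \<Rightarrow> real" where
  "rogers u = polylog 3 u - ln u * polylog 2 u"

definition rogers_neg :: "real \<Rightarrow> real" where
  "rogers_neg u = polylog 3 (- u) - ln u * polylog 2 (- u)"

lemma DERIV_polylog_3:
  assumes "\<bar>x\<bar> < 1" "x \<noteq> 0"
  shows "(polylog 3 has_real_derivative polylog 2 x / x) (at x)"
  using DERIV_polylog_Suc[of 2 x] assms by simp

lemmas DERIV_polylog_intros [derivative_intros] =
  DERIV_chain2[OF DERIV_polylog_2] DERIV_chain2[OF DERIV_polylog_3]

text \<open>The correction \<open>ln u * polylog 2 u\<close> cancels the dilogarithm in the
  derivative of \<open>polylog 3 u\<close>. What remains is elementary, so that sums of such terms
  can be compared by differentiation.\<close>

lemma DERIV_rogers:
  assumes "0 < u" "u < 1"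
  shows "(rogers has_real_derivative ln u * ln (1 - u) / u) (at u)"
  unfolding rogers_def[abs_def] using assms
  by (auto intro!: derivative_eq_intros)

lemma DERIV_rogers_neg:
  assumes "0 < u" "u < 1"
  shows "(rogers_neg has_real_derivative ln u * ln (1 + u) / u) (at u)"
  unfolding rogers_neg_def[abs_def] using assms
  by (auto intro!: derivative_eq_intros)

lemma tendsto_polylog:
  assumes "2 \<le> k" "(f \<longlongrightarrow> a) F" "\<forall>\<^sub>F x in F. f x \<in> {-1..1}" "a \<in> {-1..1}"
  shows "((\<lambda>x. polylog k (f x)) \<longlongrightarrow> polylog k a) F"
  using continuous_on_tendsto_compose[OF continuous_on_polylog assms(2,4,3)] assms(1) by simp

lemma tendsto_ln_polylog_0:
  assumes "2 \<le> k" "\<And>x. 0 < x \<Longrightarrow> \<bar>f x\<bar> = x"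
  shows "((\<lambda>x. ln x * polylog k (f x)) \<longlongrightarrow> 0) (at_right 0)"
proof (rule Lim_null_comparison)
  show "((\<lambda>x::real. \<bar>x * ln x\<bar> * polylog k 1) \<longlongrightarrow> 0) (at_right 0)"
    by real_asymp
  have "\<forall>\<^sub>F x in at_right (0::real). x \<in> {0<..<1}"
    by (rule eventually_at_right_real) simp
  then show "\<forall>\<^sub>F x in at_right 0. norm (ln x * polylog k (f x)) \<le> \<bar>x * ln x\<bar> * polylog k 1"
  proof eventually_elim
    case (elim x)
    have "\<bar>polylog k (f x)\<bar> \<le> x * polylog k 1"
      using abs_polylog_le[of k "f x"] assms elim by auto
    then have "\<bar>ln x\<bar> * \<bar>polylog k (f x)\<bar> \<le> \<bar>ln x\<bar> * (x * polylog k 1)"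
      by (intro mult_left_mono) auto
    then show ?case using elim by (simp add: abs_mult mult_ac)
  qed
qed

lemma tendsto_rogers_0: "(rogers \<longlongrightarrow> 0) (at_right 0)"
proof -
  have "((\<lambda>u. polylog 3 u - ln u * polylog 2 u) \<longlongrightarrow> polylog 3 0 - 0) (at_right 0)"
    using eventually_at_right_real[of 0 1]
    by (intro tendsto_diff tendsto_ln_polylog_0 tendsto_polylog) (auto elim!: eventually_mono)
  then show ?thesis by (simp add: rogers_def[abs_def] polylog_0)
qed

lemma tendsto_rogers_neg_0: "(rogers_neg \<longlongrightarrow> 0) (at_right 0)"
proof -
  have "((\<lambda>u. polylog 3 (- u) - ln u * polylog 2 (- u)) \<longlongrightarrow> polylog 3 (- 0) - 0) (at_right 0)"
    using eventually_at_right_real[of 0 1]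
    by (intro tendsto_diff tendsto_ln_polylog_0 tendsto_polylog tendsto_minus tendsto_ident_at) (auto elim!: eventually_mono)
  then show ?thesis by (simp add: rogers_neg_def[abs_def] polylog_0)
qed

lemma tendsto_rogers_1: "((\<lambda>y. rogers (1 - y)) \<longlongrightarrow> zeta 3) (at_right 0)"
proof -
  have lim: "((\<lambda>y::real. 1 - y) \<longlongrightarrow> 1) (at_right 0)" by real_asymp
  have "((\<lambda>y. polylog 3 (1 - y) - ln (1 - y) * polylog 2 (1 - y))
      \<longlongrightarrow> polylog 3 1 - 0 * polylog 2 1) (at_right 0)"
  proof (intro tendsto_diff tendsto_mult tendsto_polylog lim)
    show "((\<lambda>y::real. ln (1 - y)) \<longlongrightarrow> 0) (at_right 0)" by real_asymp
    show "\<forall>\<^sub>F x in at_right 0. 1 - x \<in> {- 1..1::real}"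
      using eventually_at_right_real[of 0 "1::real"] by (auto elim!: eventually_mono)
    then show "\<forall>\<^sub>F x in at_right 0. 1 - x \<in> {- 1..1::real}" .
  qed auto
  then show ?thesis by (simp add: rogers_def[abs_def] polylog_3_1)
qed

text \<open>The two sides have equal elementary derivatives, and the constant is found at 0, where
  only \<open>rogers (1 - y)\<close> survives. The bound \<open>y < 1/2\<close> keeps
  \<open>y / (1 - y)\<close> below 1. The intended argument is \<open>y = p^2\<close> for the
  inverse golden ratio \<open>p\<close>, where \<open>1 - y\<close> and \<open>y / (1 - y)\<close>
  both equal \<open>p\<close>.\<close>

lemma rogers_landen:
  assumes "0 < y" "y < 1/2"
  shows "rogers y + rogers (1 - y) + rogers_neg (y / (1 - y)) =
    zeta 3 + (ln (1 - y))\<^sup>2 * ln y - (ln (1 - y)) ^ 3 / 3"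
proof -
  define h where "h y = rogers y + rogers (1 - y) + rogers_neg (y / (1 - y))
    - (ln (1 - y))\<^sup>2 * ln y + (ln (1 - y)) ^ 3 / 3" for y
  have D: "(h has_real_derivative 0) (at y)" if y: "0 < y" "y < 1/2" for y
  proof -
    have w: "0 < y / (1 - y)" "y / (1 - y) < 1" "1 + y / (1 - y) = 1 / (1 - y)"
      using y by (auto simp: field_simps)
    have lw: "ln (y / (1 - y)) = ln y - ln (1 - y)" "ln (1 + y / (1 - y)) = - ln (1 - y)"
      unfolding w(3) using y by (auto simp: ln_div)
    have D1: "((\<lambda>y. rogers (1 - y)) has_real_derivative ln (1 - y) * ln (1 - (1 - y)) / (1 - y) * (- 1)) (at y)"
      using y by (intro DERIV_chain2[OF DERIV_rogers]) (auto intro!: derivative_eq_intros)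
    have D2: "((\<lambda>y. rogers_neg (y / (1 - y))) has_real_derivative
        ln (y / (1 - y)) * ln (1 + y / (1 - y)) / (y / (1 - y)) * (1 / (1 - y)\<^sup>2)) (at y)"
      using y w by (intro DERIV_chain2[OF DERIV_rogers_neg])
        (auto intro!: derivative_eq_intros simp: power2_eq_square field_simps)
    have D3: "((\<lambda>y. (ln (1 - y))\<^sup>2 * ln y) has_real_derivative
        2 * ln (1 - y) * (- 1 / (1 - y)) * ln y + (ln (1 - y))\<^sup>2 / y) (at y)"
      using y by (auto intro!: derivative_eq_intros)
    have D4: "((\<lambda>y. (ln (1 - y)) ^ 3 / 3) has_real_derivative (ln (1 - y))\<^sup>2 * (- 1 / (1 - y))) (at y)"
      using y by (auto intro!: derivative_eq_intros simp: field_simps power2_eq_square)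
    have "(h has_real_derivative
      ln y * ln (1 - y) / y + ln (1 - y) * ln (1 - (1 - y)) / (1 - y) * (- 1)
      + ln (y / (1 - y)) * ln (1 + y / (1 - y)) / (y / (1 - y)) * (1 / (1 - y)\<^sup>2)
      - (2 * ln (1 - y) * (- 1 / (1 - y)) * ln y + (ln (1 - y))\<^sup>2 / y)
      + (ln (1 - y))\<^sup>2 * (- 1 / (1 - y))) (at y)" (is "(h has_real_derivative ?D) _")
      unfolding h_def[abs_def] using y by (intro DERIV_add DERIV_diff DERIV_rogers D1 D2 D3 D4) auto
    moreover have "?D = 0"
      unfolding lw using y
      by (simp add: divide_simps) (simp add: algebra_simps power2_eq_square)
    ultimately show ?thesis by simp
  qed
  have "\<exists>c. \<forall>y\<in>{0<..<1/2}. h y = c"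
  proof (rule has_field_derivative_zero_constant)
    show "convex {0<..<1/2::real}" by simp
    fix y :: real assume "y \<in> {0<..<1/2}"
    then have "0 < y" "y < 1/2" by auto
    from D[OF this] show "(h has_field_derivative 0) (at y within {0<..<1/2})"
      by (rule has_field_derivative_at_within)
  qed
  then obtain c where c: "\<And>y. y \<in> {0<..<1/2} \<Longrightarrow> h y = c" by blast
  have lim: "(h \<longlongrightarrow> 0 + zeta 3 + 0 - 0 + 0) (at_right 0)"
    unfolding h_def
  proof (intro tendsto_add tendsto_diff tendsto_rogers_0 tendsto_rogers_1)
    show "((\<lambda>y::real. rogers_neg (y / (1 - y))) \<longlongrightarrow> 0) (at_right 0)"
      by (rule filterlim_compose[OF tendsto_rogers_neg_0]) real_asymp
    show "((\<lambda>y::real. (ln (1 - y))\<^sup>2 * ln y) \<longlongrightarrow> 0) (at_right 0)" by real_asymp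
    show "((\<lambda>y::real. (ln (1 - y)) ^ 3 / 3) \<longlongrightarrow> 0) (at_right 0)" by real_asymp
  qed
  have "\<forall>\<^sub>F y in at_right 0. h y = c"
    using eventually_at_right_real[of 0 "1/2::real"] by (auto elim!: eventually_mono intro: c)
  then have "(h \<longlongrightarrow> c) (at_right 0)" by (rule tendsto_eventually)
  with lim have "c = zeta 3" using tendsto_unique[OF trivial_limit_at_right_real] by fastforce
  with c[of y] assms show ?thesis by (simp add: h_def algebra_simps)
qed

section \<open>A primitive for the Legendre function \<open>\<chi>\<^sub>2\<close> with a rational
  weight\<close>

definition ln_sq_prim :: "real \<Rightarrow> real" where
  "ln_sq_prim x = 2 * zeta 3 + (ln (1 - x))\<^sup>2 * ln x + 2 * ln (1 - x) * polylog 2 (1 - x)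
     - 2 * polylog 3 (1 - x)"

text \<open>The formula comes from two partial integrations. Its constant \<open>2 * zeta 3\<close>
  cancels \<open>polylog 3 1\<close>, which makes it the primitive that vanishes at 0.\<close>

lemma DERIV_ln_sq_prim:
  assumes "0 < x" "x < 1"
  shows "(ln_sq_prim has_real_derivative (ln (1 - x))\<^sup>2 / x) (at x)"
  unfolding ln_sq_prim_def[abs_def] using assms
  by (auto intro!: derivative_eq_intros)

lemma ln_sq_prim_0: "ln_sq_prim 0 = 0"
  by (simp add: ln_sq_prim_def polylog_3_1)

lemma tendsto_ln_sq_prim_0: "(ln_sq_prim \<longlongrightarrow> 0) (at_right 0)"
proof -
  have lim: "((\<lambda>y::real. 1 - y) \<longlongrightarrow> 1) (at_right 0)" by real_asymp
  have ev: "\<forall>\<^sub>F x in at_right 0. 1 - x \<in> {- 1..1::real}"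
    using eventually_at_right_real[of 0 "1::real"] by (auto elim!: eventually_mono)
  have "(ln_sq_prim \<longlongrightarrow> 2 * zeta 3 + 0 + 0 * polylog 2 1 - 2 * polylog 3 1) (at_right 0)"
    unfolding ln_sq_prim_def
  proof (intro tendsto_add tendsto_diff tendsto_mult tendsto_polylog lim ev tendsto_const)
    show "((\<lambda>y::real. (ln (1 - y))\<^sup>2 * ln y) \<longlongrightarrow> 0) (at_right 0)" by real_asymp
    show "((\<lambda>y::real. 2 * ln (1 - y)) \<longlongrightarrow> 0) (at_right 0)" by real_asymp
  qed auto
  then show ?thesis by (simp add: polylog_3_1)
qed

definition legendre_chi :: "nat \<Rightarrow> real \<Rightarrow> real" where
  "legendre_chi k x = (polylog k x - polylog k (- x)) / 2"

lemma DERIV_legendre_chi_2: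
  assumes "0 < x" "x < 1"
  shows "(legendre_chi 2 has_real_derivative (ln (1 + x) - ln (1 - x)) / (2 * x)) (at x)"
  unfolding legendre_chi_def[abs_def] using assms
  by (auto intro!: derivative_eq_intros simp: field_simps)

lemma DERIV_legendre_chi_3:
  assumes "0 < x" "x < 1"
  shows "(legendre_chi 3 has_real_derivative legendre_chi 2 x / x) (at x)"
  unfolding legendre_chi_def[abs_def] using assms
  by (auto intro!: derivative_eq_intros simp: field_simps)

lemma legendre_chi_0: "0 < k \<Longrightarrow> legendre_chi k 0 = 0"
  by (simp add: legendre_chi_def)

lemma continuous_on_legendre_chi: "2 \<le> k \<Longrightarrow> continuous_on {0..1} (legendre_chi k)"
  unfolding legendre_chi_def[abs_def]
  by (intro continuous_intros continuous_on_compose2[OF continuous_on_polylog]) auto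

text \<open>The weight \<open>(1 + x^2) / (x * (1 - x^2))\<close> splits into \<open>1 / x\<close>,
  which raises the order of \<open>legendre_chi\<close> to 3, and \<open>2 * x / (1 - x^2)\<close>.
  Partial integration of the latter leaves
  \<open>((ln (1 + x))^2 - (ln (1 - x))^2) / (2 * x)\<close>; the bracket integrates the two
  squares, the first through the substitution \<open>x / (1 + x)\<close>.\<close>

definition chi_prim :: "real \<Rightarrow> real" where
  "chi_prim x = legendre_chi 3 x - legendre_chi 2 x * ln (1 - x\<^sup>2)
     + (ln_sq_prim (x / (1 + x)) + (ln (1 + x)) ^ 3 / 3 - ln_sq_prim x) / 2"

lemma DERIV_chi_prim:
  assumes x: "0 < x" "x < 1"
  shows "(chi_prim has_real_derivative legendre_chi 2 x * (1 + x\<^sup>2) / (x * (1 - x\<^sup>2))) (at x)"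
proof -
  have w: "0 < x / (1 + x)" "x / (1 + x) < 1" "1 - x / (1 + x) = 1 / (1 + x)" "x\<^sup>2 < 1"
    using x by (auto simp: field_simps abs_square_less_1)
  have l: "ln (1 - x / (1 + x)) = - ln (1 + x)"
    unfolding w(3) using x by (simp add: ln_div)
  have l2: "ln (1 - x\<^sup>2) = ln (1 - x) + ln (1 + x)"
  proof -
    have "1 - x\<^sup>2 = (1 - x) * (1 + x)" by (simp add: algebra_simps power2_eq_square)
    then show ?thesis using x by (simp add: ln_mult)
  qed
  have D1: "((\<lambda>x. ln_sq_prim (x / (1 + x))) has_real_derivative
      (ln (1 - x / (1 + x)))\<^sup>2 / (x / (1 + x)) * (1 / (1 + x)\<^sup>2)) (at x)"
    using x w by (intro DERIV_chain2[OF DERIV_ln_sq_prim])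
      (auto intro!: derivative_eq_intros simp: power2_eq_square field_simps)
  have D2: "((\<lambda>x. ln (1 - x\<^sup>2)) has_real_derivative - 2 * x / (1 - x\<^sup>2)) (at x)"
    using w by (auto intro!: derivative_eq_intros)
  have D3: "((\<lambda>x. (ln (1 + x)) ^ 3 / 3) has_real_derivative (ln (1 + x))\<^sup>2 * (1 / (1 + x))) (at x)"
    using x by (auto intro!: derivative_eq_intros simp: field_simps power2_eq_square)
  have "(chi_prim has_real_derivative legendre_chi 2 x / x
      - ((ln (1 + x) - ln (1 - x)) / (2 * x) * ln (1 - x\<^sup>2) + (- 2 * x / (1 - x\<^sup>2)) * legendre_chi 2 x)
      + ((ln (1 - x / (1 + x)))\<^sup>2 / (x / (1 + x)) * (1 / (1 + x)\<^sup>2)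
         + (ln (1 + x))\<^sup>2 * (1 / (1 + x)) - (ln (1 - x))\<^sup>2 / x) / 2) (at x)"
    unfolding chi_prim_def[abs_def]
    by (intro DERIV_cdivide[of "\<lambda>x. f x - g x" for f g] DERIV_add DERIV_diff DERIV_mult D1 D2 D3
        DERIV_legendre_chi_2 DERIV_legendre_chi_3 DERIV_ln_sq_prim x)
  moreover have "legendre_chi 2 x / x
      - ((ln (1 + x) - ln (1 - x)) / (2 * x) * ln (1 - x\<^sup>2) + (- 2 * x / (1 - x\<^sup>2)) * legendre_chi 2 x)
      + ((ln (1 - x / (1 + x)))\<^sup>2 / (x / (1 + x)) * (1 / (1 + x)\<^sup>2)
         + (ln (1 + x))\<^sup>2 * (1 / (1 + x)) - (ln (1 - x))\<^sup>2 / x) / 2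
      = legendre_chi 2 x * (1 + x\<^sup>2) / (x * (1 - x\<^sup>2))"
  proof -
    \<comment> \<open>The substituted primitive accounts for the part
      \<open>1 / (x * (1 + x))\<close> of the weight \<open>1 / x\<close>, the cube of the logarithm
      for the missing \<open>1 / (1 + x)\<close>.\<close>
    have 1: "(ln (1 + x))\<^sup>2 / (x / (1 + x)) * (1 / (1 + x)\<^sup>2) + (ln (1 + x))\<^sup>2 * (1 / (1 + x)) = (ln (1 + x))\<^sup>2 / x"
      using x by (simp add: divide_simps) (simp add: algebra_simps power2_eq_square)
    have 2: "legendre_chi 2 x / x + 2 * x / (1 - x\<^sup>2) * legendre_chi 2 x = legendre_chi 2 x * (1 + x\<^sup>2) / (x * (1 - x\<^sup>2))"
      using x w(4) by (simp add: divide_simps) (simp add: algebra_simps power2_eq_square)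
    have 3: "(ln (1 + x) - ln (1 - x)) / (2 * x) * (ln (1 - x) + ln (1 + x)) = ((ln (1 + x))\<^sup>2 / x - (ln (1 - x))\<^sup>2 / x) / 2"
      using x by (simp add: divide_simps) (simp add: algebra_simps power2_eq_square)
    show ?thesis unfolding l l2 power2_minus 3 using 1 2 by (simp add: algebra_simps add_divide_distrib diff_divide_distrib)
  qed
  ultimately show ?thesis by simp
qed

lemma chi_prim_0: "chi_prim 0 = 0"
  by (simp add: chi_prim_def legendre_chi_0 ln_sq_prim_0)

text \<open>The derivative formula covers positive arguments; at 0 the formula for
  \<open>chi_prim\<close> contains \<open>ln 0\<close>, and continuity comes from the one-sided
  limits of its terms.\<close>

lemma continuous_on_chi_prim:
  assumes "0 < b" "b < 1" shows "continuous_on {0..b} chi_prim"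
  unfolding continuous_on_eq_continuous_within
proof
  fix x assume x: "x \<in> {0..b}"
  show "continuous (at x within {0..b}) chi_prim"
  proof (cases "x = 0")
    case False
    then have "isCont chi_prim x"
      using x assms by (intro DERIV_isCont[OF DERIV_chi_prim[of x]]) auto
    then show ?thesis by (rule continuous_at_imp_continuous_at_within)
  next
    case True
    have chi: "((legendre_chi k) \<longlongrightarrow> 0) (at_right 0)" if "2 \<le> k" for k
      using continuous_on_legendre_chi[OF that] that
      by (auto simp: continuous_on_def at_within_Icc_at_right legendre_chi_0 dest!: bspec[of _ _ 0])
    have "(chi_prim \<longlongrightarrow> 0 - 0 * 0 + (0 + 0 - 0) / 2) (at_right 0)"
      unfolding chi_prim_def
    proof (intro tendsto_add tendsto_diff tendsto_mult tendsto_divide chi tendsto_ln_sq_prim_0 tendsto_const)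
      show "((\<lambda>x::real. ln_sq_prim (x / (1 + x))) \<longlongrightarrow> 0) (at_right 0)"
        by (rule filterlim_compose[OF tendsto_ln_sq_prim_0]) real_asymp
      show "((\<lambda>x::real. ln (1 - x\<^sup>2)) \<longlongrightarrow> 0) (at_right 0)" by real_asymp
      show "((\<lambda>x::real. (ln (1 + x)) ^ 3 / 3) \<longlongrightarrow> 0) (at_right 0)" by real_asymp
    qed auto
    then have "(chi_prim \<longlongrightarrow> chi_prim 0) (at_right 0)" by (simp add: chi_prim_0)
    then have "continuous (at_right 0) chi_prim" by (simp add: continuous_within)
    then show ?thesis unfolding True
      using assms by (simp add: continuous_within at_within_Icc_at_right)
  qed
qed

text \<open>Because \<open>p^2 = 1 - p\<close>, every polylogarithm has argument \<open>p\<close>,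
  \<open>- p\<close> or \<open>p^2\<close>, and every logarithm is a multiple of
  \<open>l = ln p\<close>. Duplication removes \<open>- p\<close>, the values at \<open>p\<close>
  cancel, and those at \<open>p^2\<close> occur only in the combination that Landen's relation
  evaluates.\<close>

lemma chi_prim_golden: "chi_prim ((sqrt 5 - 1) / 2) = 7 / 10 * zeta 3"
proof -
  define p :: real where "p = (sqrt 5 - 1) / 2"
  have "p\<^sup>2 = (5 - 2 * sqrt 5 + 1) / 4"
    by (simp add: p_def power2_eq_square algebra_simps)
  then have p2: "p\<^sup>2 = 1 - p" by (simp add: p_def field_simps)
  have "2 < sqrt (5::real)" by (simp add: real_less_rsqrt)
  moreover have "sqrt (5::real) < 3" by (simp add: real_less_lsqrt)
  ultimately have p: "1/2 < p" "p < 1" by (auto simp: p_def)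
  define l where "l = ln p"
  have l1: "ln (1 - p) = 2 * l" using p unfolding p2[symmetric] l_def by (simp add: ln_realpow)
  have "p * (1 + p) = 1" using p2 by (simp add: algebra_simps power2_eq_square)
  then have inv: "1 + p = inverse p" using p by (simp add: field_simps)
  have l2: "ln (1 + p) = - l" unfolding inv l_def using p by (simp add: ln_inverse)
  have q1: "p / (1 + p) = 1 - p" unfolding inv p2[symmetric] by (simp add: power2_eq_square divide_inverse)
  have q2: "(1 - p) / p = p" unfolding p2[symmetric] using p by (simp add: power2_eq_square)
  have dup2: "polylog 2 p + polylog 2 (- p) = polylog 2 (1 - p) / 2"
    using polylog_duplication[of 2 p] p by (simp add: p2)
  have dup3: "polylog 3 p + polylog 3 (- p) = polylog 3 (1 - p) / 4"
    using polylog_duplication[of 3 p] p by (simp add: p2)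
  have "rogers (1 - p) + rogers p + rogers_neg p = zeta 3 + l\<^sup>2 * (2 * l) - l ^ 3 / 3"
    using rogers_landen[of "1 - p"] p by (simp add: q2 l1 flip: l_def)
  moreover have "rogers p + rogers_neg p = (polylog 3 p + polylog 3 (- p)) - l * (polylog 2 p + polylog 2 (- p))"
    by (simp add: rogers_def rogers_neg_def algebra_simps l_def)
  moreover have "rogers (1 - p) = polylog 3 (1 - p) - 2 * l * polylog 2 (1 - p)"
    by (simp add: rogers_def l1)
  \<comment> \<open>By duplication \<open>rogers p + rogers_neg p\<close> is a quarter of
    \<open>rogers (1 - p)\<close>; hence the factor 5/4.\<close>
  ultimately have key: "5 / 4 * (polylog 3 (1 - p) - 2 * l * polylog 2 (1 - p)) = zeta 3 + 5 / 3 * l ^ 3"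
    unfolding dup2 dup3 by (simp add: field_simps power2_eq_square power3_eq_cube)
  have S1: "ln_sq_prim (1 - p) = 2 * zeta 3 + l\<^sup>2 * (2 * l) + 2 * l * polylog 2 p - 2 * polylog 3 p"
    by (simp add: ln_sq_prim_def l1 flip: l_def)
  have S2: "ln_sq_prim p = 2 * zeta 3 + (2 * l)\<^sup>2 * l + 2 * (2 * l) * polylog 2 (1 - p) - 2 * polylog 3 (1 - p)"
    unfolding ln_sq_prim_def l1 l_def[symmetric] ..
  have l3: "ln (1 - p\<^sup>2) = l" unfolding p2 l_def by simp
  have n2: "polylog 2 (- p) = polylog 2 (1 - p) / 2 - polylog 2 p" using dup2 by simp
  have n3: "polylog 3 (- p) = polylog 3 (1 - p) / 4 - polylog 3 p" using dup3 by simp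
  have "chi_prim p = 7 / 8 * (polylog 3 (1 - p) - 2 * l * polylog 2 (1 - p)) - 7 / 6 * l ^ 3"
    unfolding chi_prim_def q1 S1 S2 l2 l3 legendre_chi_def n2 n3
    by (simp add: field_simps power2_eq_square power3_eq_cube flip: l_def)
  \<comment> \<open>\<open>7/8 * 4/5 = 7/10\<close>, and the cubes of \<open>l\<close> cancel
    because \<open>7/10 * 5/3 = 7/6\<close>.\<close>
  also have "\<dots> = 7 / 10 * zeta 3" using key by (simp add: field_simps)
  finally show ?thesis by (simp add: p_def)
qed

section \<open>The inverse tangent integral\<close>

lemma FTC_real_interior:
  fixes f :: "real \<Rightarrow> real"
  assumes "a \<le> b" "continuous_on {a..b} f"
    and "\<And>x. a < x \<Longrightarrow> x < b \<Longrightarrow> (f has_real_derivative f' x) (at x)"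
  shows "(f' has_integral f b - f a) {a..b}"
  using assms by (intro fundamental_theorem_of_calculus_interior)
    (auto simp flip: has_real_derivative_iff_has_vector_derivative)

lemma FTC_real:
  fixes f :: "real \<Rightarrow> real"
  assumes "a \<le> b" and D: "\<And>x. a \<le> x \<Longrightarrow> x \<le> b \<Longrightarrow> (f has_real_derivative f' x) (at x)"
  shows "(f' has_integral f b - f a) {a..b}"
proof (rule FTC_real_interior)
  show "continuous_on {a..b} f"
    using DERIV_isCont[OF D] by (auto intro!: continuous_at_imp_continuous_on)
qed (use assms in auto)

definition arctan_int :: "real \<Rightarrow> real" where
  "arctan_int r = integral {0..r} (\<lambda>s. arctan s / s)"

text \<open>By the division convention \<open>arctan s / s\<close> is 0 at \<open>s = 0\<close>,
  whereas its continuous extension has the value 1. Both have the same integral, and the extension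
  gives access to continuity and to the derivative of \<open>arctan_int\<close>.\<close>

lemma continuous_on_sinc_arctan:
  "continuous_on A (\<lambda>s::real. if s = 0 then 1 else arctan s / s)"
proof (intro continuous_at_imp_continuous_on ballI)
  fix x :: real
  show "isCont (\<lambda>s::real. if s = 0 then 1 else arctan s / s) x"
  proof (cases "x = 0")
    case True
    have "((\<lambda>s::real. arctan s / s) \<longlongrightarrow> 1) (at 0)" by real_asymp
    then have "((\<lambda>s::real. if s = 0 then 1 else arctan s / s) \<longlongrightarrow> 1) (at 0)"
      by (rule Lim_transform_eventually) (auto simp: eventually_at_filter)
    then show ?thesis unfolding True by (simp add: isCont_def)
  next
    case False
    then have "\<forall>\<^sub>F s in nhds x. (if s = 0 then 1 else arctan s / s) = arctan s / s"
      using t1_space_nhds[of x 0] by (auto elim!: eventually_mono)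
    moreover have "isCont (\<lambda>s. arctan s / s) x" using False by (intro continuous_intros)
    ultimately show ?thesis using isCont_cong by fastforce
  qed
qed

lemma has_integral_arctan_int: "((\<lambda>s. arctan s / s) has_integral arctan_int r) {0..r}"
proof -
  have "(\<lambda>s::real. if s = 0 then 1 else arctan s / s) integrable_on {0..r}"
    by (intro integrable_continuous_interval continuous_on_sinc_arctan)
  then have "(\<lambda>s. arctan s / s) integrable_on {0..r}"
    by (rule integrable_spike_finite[of "{0}", rotated 2]) auto
  then show ?thesis by (simp add: arctan_int_def integrable_integral)
qed

lemma arctan_int_alt: "arctan_int r = integral {0..r} (\<lambda>s. if s = 0 then 1 else arctan s / s)"
  unfolding arctan_int_def by (rule integral_spike[of "{0}"]) auto

lemma continuous_on_arctan_int: "continuous_on {0..b} arctan_int"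
  unfolding arctan_int_alt[abs_def]
  by (intro indefinite_integral_continuous_1 integrable_continuous_interval continuous_on_sinc_arctan)

lemma DERIV_arctan_int:
  assumes "0 < s"
  shows "(arctan_int has_real_derivative arctan s / s) (at s)"
proof -
  have "(arctan_int has_real_derivative arctan s / s) (at s within {0..s+1})"
    using integral_has_real_derivative[OF continuous_on_sinc_arctan, of s 0 "s+1"] assms
    by (simp add: arctan_int_alt[abs_def])
  moreover have "at s within {0..s+1} = at s" using assms by (intro at_within_interior) auto
  ultimately show ?thesis by simp
qed

lemma arctan_int_0 [simp]: "arctan_int 0 = 0"
  by (simp add: arctan_int_def)

text \<open>The common frame for means that vanish at \<open>r = 0\<close>: \<open>g s u\<close> is
  the derivative of \<open>G\<close> in the parameter, with a \<open>u\<close>-integral proportional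
  to \<open>arctan s / s\<close>. The exceptional points are \<open>s = 0\<close>, where this
  quotient degenerates, and \<open>u = pi/2\<close>, where \<open>cos u\<close> vanishes.\<close>

lemma swap_arctan_int:
  assumes r: "0 \<le> r"
    and meas: "(\<lambda>(s,u). g s u) \<in> borel_measurable (borel \<Otimes>\<^sub>M borel)"
    and nonneg: "\<And>s u. 0 \<le> s \<Longrightarrow> 0 \<le> u \<Longrightarrow> u \<le> pi/2 \<Longrightarrow> 0 \<le> g s u"
    and G: "\<And>u. 0 \<le> u \<Longrightarrow> u < pi/2 \<Longrightarrow> ((\<lambda>s. g s u) has_integral G u) {0..r}"
    and H: "\<And>s. 0 < s \<Longrightarrow> (g s has_integral c * (arctan s / s)) {0..pi/2}"
  shows "(G has_integral c * arctan_int r) {0..pi/2}"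
proof (rule has_integral_swap_nonneg[OF meas])
  show "((\<lambda>s. c * (arctan s / s)) has_integral c * arctan_int r) {0..r}"
    by (intro has_integral_mult_right has_integral_arctan_int)
  show "finite {0::real}" "finite {pi/2}" by auto
qed (use assms in auto)

text \<open>On the quarter period the cosine is nonnegative, and so is the derivative in
  \<open>r\<close>; symmetry later extends the result to means over the circle with
  \<open>\<bar>cos\<bar>\<close>.\<close>

lemma ln_quadratic_cos_integral:
  assumes "0 \<le> r"
  shows "((\<lambda>u. ln (r\<^sup>2 + 1 + 2 * r * cos u)) has_integral 2 * arctan_int r) {0..pi/2}"
proof (rule swap_arctan_int[OF assms, where g = "\<lambda>s u. 2 * ((s + cos u) / (s\<^sup>2 + 1 + 2 * s * cos u))"])
  show "(\<lambda>(s::real, u::real). 2 * ((s + cos u) / (s\<^sup>2 + 1 + 2 * s * cos u))) \<in> borel_measurable (borel \<Otimes>\<^sub>M borel)"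
    by measurable
  show "0 \<le> 2 * ((s + cos u) / (s\<^sup>2 + 1 + 2 * s * cos u))" if "0 \<le> s" "0 \<le> u" "u \<le> pi/2" for s u :: real
    using that by (auto intro!: divide_nonneg_nonneg add_nonneg_nonneg mult_nonneg_nonneg cos_ge_zero)
  have pos: "0 < s\<^sup>2 + 1 + 2 * s * cos u" if "0 \<le> s" "0 \<le> u" "u \<le> pi/2" for s u :: real
  proof -
    have "0 \<le> 2 * s * cos u" using that by (auto intro!: mult_nonneg_nonneg cos_ge_zero)
    then show ?thesis using zero_le_power2[of s] by linarith
  qed
  show "((\<lambda>s. 2 * ((s + cos u) / (s\<^sup>2 + 1 + 2 * s * cos u))) has_integral ln (r\<^sup>2 + 1 + 2 * r * cos u)) {0..r}"
    if u: "0 \<le> u" "u < pi/2" for u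
  proof -
    have "((\<lambda>s. 2 * ((s + cos u) / (s\<^sup>2 + 1 + 2 * s * cos u))) has_integral
        ln (r\<^sup>2 + 1 + 2 * r * cos u) - ln (0\<^sup>2 + 1 + 2 * 0 * cos u)) {0..r}"
    proof (rule FTC_real[OF assms])
      fix s :: real assume s: "0 \<le> s"
      show "((\<lambda>s. ln (s\<^sup>2 + 1 + 2 * s * cos u)) has_real_derivative 2 * ((s + cos u) / (s\<^sup>2 + 1 + 2 * s * cos u))) (at s)"
        using pos[of s u] s u by (auto intro!: derivative_eq_intros)
    qed
    then show ?thesis by simp
  qed
  show "((\<lambda>u. 2 * ((s + cos u) / (s\<^sup>2 + 1 + 2 * s * cos u))) has_integral 2 * (arctan s / s)) {0..pi/2}"
    if s: "0 < s" for s
  proof (rule has_integral_mult_right)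
    \<comment> \<open>\<open>arctan (sin u / (s + cos u))\<close> is the argument of
      \<open>s + cis u\<close>, with derivative
      \<open>(1 + s * cos u) / (s^2 + 1 + 2 * s * cos u)\<close>; subtracting it from
      \<open>u\<close> and dividing by \<open>s\<close> gives the primitive.\<close>
    have "((\<lambda>u. (s + cos u) / (s\<^sup>2 + 1 + 2 * s * cos u)) has_integral
        (pi/2 - arctan (sin (pi/2) / (s + cos (pi/2)))) / s - (0 - arctan (sin 0 / (s + cos 0))) / s) {0..pi/2}"
    proof (rule FTC_real)
      fix u :: real assume u: "0 \<le> u" "u \<le> pi/2"
      have c: "0 \<le> cos u" using u by (intro cos_ge_zero) auto
      have nz: "s + cos u \<noteq> 0" using c s by auto
      have eq: "(s + cos u)\<^sup>2 + (sin u)\<^sup>2 = s\<^sup>2 + 1 + 2 * s * cos u"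
        by (simp add: power2_sum sin_squared_eq)
      have d: "((\<lambda>u. arctan (sin u / (s + cos u))) has_real_derivative
          (1 / (1 + (sin u / (s + cos u))\<^sup>2)) * ((cos u * (s + cos u) - sin u * (- sin u)) / (s + cos u)\<^sup>2)) (at u)"
      proof -
        have "((\<lambda>u. sin u / (s + cos u)) has_real_derivative
            (cos u * (s + cos u) - sin u * (- sin u)) / (s + cos u)\<^sup>2) (at u)"
          using nz by (auto intro!: derivative_eq_intros simp: power2_eq_square)
        from DERIV_chain2[OF DERIV_arctan this] show ?thesis
          by (simp only: inverse_eq_divide)
      qed
      have "(1 / (1 + (sin u / (s + cos u))\<^sup>2)) * ((cos u * (s + cos u) - sin u * (- sin u)) / (s + cos u)\<^sup>2)
          = (1 + s * cos u) / (s\<^sup>2 + 1 + 2 * s * cos u)"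
      proof -
        have "1 / (1 + (sin u / (s + cos u))\<^sup>2) = (s + cos u)\<^sup>2 / (s\<^sup>2 + 1 + 2 * s * cos u)"
          using nz unfolding eq[symmetric] by (simp add: field_simps power_divide)
        moreover have "cos u * (s + cos u) - sin u * (- sin u) = 1 + s * cos u"
          using sin_cos_squared_add[of u] by (simp add: algebra_simps power2_eq_square)
        ultimately show ?thesis using nz by simp
      qed
      with d have d: "((\<lambda>u. arctan (sin u / (s + cos u))) has_real_derivative
          (1 + s * cos u) / (s\<^sup>2 + 1 + 2 * s * cos u)) (at u)" by simp
      have "((\<lambda>u. (u - arctan (sin u / (s + cos u))) / s) has_real_derivative
          (1 - (1 + s * cos u) / (s\<^sup>2 + 1 + 2 * s * cos u)) / s) (at u)"
        by (intro DERIV_cdivide DERIV_diff DERIV_ident d)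
      moreover have "(1 - (1 + s * cos u) / (s\<^sup>2 + 1 + 2 * s * cos u)) / s = (s + cos u) / (s\<^sup>2 + 1 + 2 * s * cos u)"
        using pos[of s u] s u by (simp add: divide_simps) (simp add: algebra_simps power2_eq_square)
      ultimately show "((\<lambda>u. (u - arctan (sin u / (s + cos u))) / s) has_real_derivative
          (s + cos u) / (s\<^sup>2 + 1 + 2 * s * cos u)) (at u)" by simp
    qed auto
    moreover have "arctan (1 / s) = pi/2 - arctan s"
      using arctan_inverse[of s] s by (simp add: inverse_eq_divide)
    ultimately show "((\<lambda>u. (s + cos u) / (s\<^sup>2 + 1 + 2 * s * cos u)) has_integral arctan s / s) {0..pi/2}"
      by simp
  qed
qed

lemma arsinh_integral:
  assumes "0 \<le> r"
  shows "((\<lambda>u. arsinh (r * cos u)) has_integral arctan_int r) {0..pi/2}"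
proof -
  have "((\<lambda>u. arsinh (r * cos u)) has_integral 1 * arctan_int r) {0..pi/2}"
  proof (rule swap_arctan_int[OF assms, where g = "\<lambda>s u. cos u / sqrt (1 + (s * cos u)\<^sup>2)"])
    show "(\<lambda>(s::real, u::real). cos u / sqrt (1 + (s * cos u)\<^sup>2)) \<in> borel_measurable (borel \<Otimes>\<^sub>M borel)"
      by measurable
    show "0 \<le> cos u / sqrt (1 + (s * cos u)\<^sup>2)" if "0 \<le> s" "0 \<le> u" "u \<le> pi/2" for s u :: real
      using that by (auto intro!: divide_nonneg_nonneg cos_ge_zero)
    show "((\<lambda>s. cos u / sqrt (1 + (s * cos u)\<^sup>2)) has_integral arsinh (r * cos u)) {0..r}" for u
    proof -
      have "((\<lambda>s. cos u / sqrt (1 + (s * cos u)\<^sup>2)) has_integral arsinh (r * cos u) - arsinh (0 * cos u)) {0..r}"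
      proof (rule FTC_real[OF assms])
        fix s
        have "((\<lambda>s. s * cos u) has_real_derivative cos u) (at s)"
          by (auto intro!: derivative_eq_intros)
        from DERIV_chain2[OF arsinh_real_has_field_derivative this]
        show "((\<lambda>s. arsinh (s * cos u)) has_real_derivative cos u / sqrt (1 + (s * cos u)\<^sup>2)) (at s)"
          by (simp add: add.commute)
      qed
      then show ?thesis by simp
    qed
    show "((\<lambda>u. cos u / sqrt (1 + (s * cos u)\<^sup>2)) has_integral 1 * (arctan s / s)) {0..pi/2}"
      if s: "0 < s" for s
    proof -
      \<comment> \<open>The arctangent equals the arcsine of
        \<open>s * sin u / sqrt (1 + s^2)\<close>, since \<open>1 + (s * cos u)^2\<close> and
        \<open>(s * sin u)^2\<close> add up to \<open>1 + s^2\<close>; at \<open>u = pi/2\<close> it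
        is \<open>arctan s\<close>.\<close>
      have "((\<lambda>u. cos u / sqrt (1 + (s * cos u)\<^sup>2)) has_integral
          arctan (s * sin (pi/2) / sqrt (1 + (s * cos (pi/2))\<^sup>2)) / s
          - arctan (s * sin 0 / sqrt (1 + (s * cos 0)\<^sup>2)) / s) {0..pi/2}"
      proof (rule FTC_real)
        fix u :: real
        define w where "w = sqrt (1 + (s * cos u)\<^sup>2)"
        have w: "w > 0" "w\<^sup>2 = 1 + (s * cos u)\<^sup>2"
          by (auto simp: w_def intro!: add_pos_nonneg)
        have w2: "w\<^sup>2 + (s * sin u)\<^sup>2 = 1 + s\<^sup>2"
          unfolding w(2) using sin_cos_squared_add[of u] by algebra
        have dw: "((\<lambda>u. sqrt (1 + (s * cos u)\<^sup>2)) has_real_derivative (- s\<^sup>2 * cos u * sin u / w)) (at u)"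
        proof -
          have "0 < 1 + (s * cos u)\<^sup>2" by (intro add_pos_nonneg) auto
          then show ?thesis
            by (auto intro!: derivative_eq_intros simp: w_def field_simps power2_eq_square)
        qed
        have "((\<lambda>u. s * sin u / sqrt (1 + (s * cos u)\<^sup>2)) has_real_derivative
            (s * cos u * w - s * sin u * (- s\<^sup>2 * cos u * sin u / w)) / (w * w)) (at u)"
          unfolding w_def[symmetric]
          by (rule DERIV_divide[where g = "\<lambda>u. sqrt (1 + (s * cos u)\<^sup>2)" and x = u, folded w_def])
             (use w dw in \<open>auto intro!: derivative_eq_intros simp: w_def\<close>)
        then have "((\<lambda>u. arctan (s * sin u / sqrt (1 + (s * cos u)\<^sup>2))) has_real_derivative
            inverse (1 + (s * sin u / w)\<^sup>2) * ((s * cos u * w - s * sin u * (- s\<^sup>2 * cos u * sin u / w)) / (w * w))) (at u)"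
          unfolding w_def by (rule DERIV_chain2[OF DERIV_arctan])
        moreover have "inverse (1 + (s * sin u / w)\<^sup>2) * ((s * cos u * w - s * sin u * (- s\<^sup>2 * cos u * sin u / w)) / (w * w))
            = s * cos u / w"
        proof -
          have 1: "1 + (s * sin u / w)\<^sup>2 = (1 + s\<^sup>2) / w\<^sup>2"
            using w(1) by (simp add: w2[symmetric] power_divide add_divide_distrib)
          have "s * cos u * w - s * sin u * (- s\<^sup>2 * cos u * sin u / w) = s * cos u * (w\<^sup>2 + (s * sin u)\<^sup>2) / w"
            using w(1) by (simp add: field_simps power2_eq_square)
          also have "\<dots> = s * cos u * (1 + s\<^sup>2) / w" by (simp only: w2)
          finally have 2: "s * cos u * w - s * sin u * (- s\<^sup>2 * cos u * sin u / w) = s * cos u * (1 + s\<^sup>2) / w" .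
          have "1 + s\<^sup>2 > 0" by (intro add_pos_nonneg) auto
          then show ?thesis unfolding 1 2 using w(1) by (simp add: power2_eq_square)
        qed
        ultimately have "((\<lambda>u. arctan (s * sin u / sqrt (1 + (s * cos u)\<^sup>2)) / s) has_real_derivative s * cos u / w / s) (at u)"
          by (intro DERIV_cdivide) simp
        then show "((\<lambda>u. arctan (s * sin u / sqrt (1 + (s * cos u)\<^sup>2)) / s) has_real_derivative cos u / sqrt (1 + (s * cos u)\<^sup>2)) (at u)"
          using s by (simp add: w_def)
      qed auto
      then show ?thesis by simp
    qed
  qed
  then show ?thesis by simp
qed

section \<open>The mean of the inverse tangent integral over the circle\<close>

lemma arctan_int_scaled:
  assumes c: "0 < c"
  shows "((\<lambda>t. arctan (t * c) / t) has_integral arctan_int (r * c)) {0..r}"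
proof -
  have "((\<lambda>t. arctan (c *\<^sub>R t + 0) / (c *\<^sub>R t + 0)) has_integral (arctan_int (r * c) /\<^sub>R c ^ DIM(real)))
      (cbox ((0 - 0) /\<^sub>R c) ((r * c - 0) /\<^sub>R c))"
    using has_integral_affinity'[of "\<lambda>s. arctan s / s" "arctan_int (r * c)" 0 "r * c" c 0]
      has_integral_arctan_int[of "r * c"] c by simp
  then have "((\<lambda>t. arctan (c * t) / (c * t)) has_integral (arctan_int (r * c) / c)) {0..r}"
    using c by (simp add: field_simps)
  from has_integral_mult_right[OF this, of c] show ?thesis
    using c by (simp add: mult.commute)
qed

text \<open>\<open>half_tan s = tanh (arsinh s / 2)\<close>, the substitution that rationalises
  \<open>sqrt (1 + s\<^sup>2)\<close>.\<close>

definition half_tan :: "real \<Rightarrow> real" where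
  "half_tan s = s / (1 + sqrt (1 + s\<^sup>2))"

lemma DERIV_half_tan:
  "(half_tan has_real_derivative 1 / (sqrt (1 + s\<^sup>2) * (1 + sqrt (1 + s\<^sup>2)))) (at s)"
proof -
  define w where "w = sqrt (1 + s\<^sup>2)"
  have "0 < 1 + s\<^sup>2" by (intro add_pos_nonneg) auto
  then have w: "w > 0" "w\<^sup>2 = 1 + s\<^sup>2" by (auto simp: w_def)
  have "((\<lambda>s. sqrt (1 + s\<^sup>2)) has_real_derivative s / w) (at s)"
    using \<open>0 < 1 + s\<^sup>2\<close> by (auto intro!: derivative_eq_intros simp: w_def field_simps)
  then have "((\<lambda>s. 1 + sqrt (1 + s\<^sup>2)) has_real_derivative s / w) (at s)"
    using DERIV_add[OF DERIV_const] by fastforce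
  moreover have "1 + sqrt (1 + s\<^sup>2) \<noteq> 0" using w(1) unfolding w_def by linarith
  ultimately have "((\<lambda>s. s / (1 + sqrt (1 + s\<^sup>2))) has_real_derivative
      (1 * (1 + sqrt (1 + s\<^sup>2)) - s * (s / w)) / ((1 + sqrt (1 + s\<^sup>2)) * (1 + sqrt (1 + s\<^sup>2)))) (at s)"
    by (rule DERIV_divide[OF DERIV_ident])
  then
  have "(half_tan has_real_derivative (1 * (1 + w) - s * (s / w)) / ((1 + w) * (1 + w))) (at s)"
    by (simp add: half_tan_def[abs_def] w_def)
  moreover have "(1 * (1 + w) - s * (s / w)) / ((1 + w) * (1 + w)) = 1 / (w * (1 + w))"
  proof -
    have "1 * (1 + w) - s * (s / w) = (w + w\<^sup>2 - s\<^sup>2) / w"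
      using w(1) by (simp add: field_simps power2_eq_square)
    also have "\<dots> = (1 + w) / w" using w(2) by simp
    finally show ?thesis using w(1) by simp
  qed
  ultimately show ?thesis by (simp add: w_def)
qed

lemma half_tan_bounds:
  assumes "0 < s"
  shows "0 < half_tan s" "half_tan s < 1"
proof -
  have "s \<le> sqrt (1 + s\<^sup>2)" by (rule real_le_rsqrt) simp
  then have "s < 1 + sqrt (1 + s\<^sup>2)" "0 < 1 + sqrt (1 + s\<^sup>2)" using assms by auto
  then show "0 < half_tan s" "half_tan s < 1" using assms by (auto simp: half_tan_def)
qed

lemma half_tan_0 [simp]: "half_tan 0 = 0"
  by (simp add: half_tan_def)

lemma continuous_on_half_tan: "continuous_on A half_tan"
  using DERIV_isCont[OF DERIV_half_tan] by (auto intro!: continuous_at_imp_continuous_on)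

text \<open>The golden ratio enters here: 2 is the largest value of
  \<open>\<bar>1 + x\<bar>\<close>, and \<open>sqrt (1 + 2^2) = sqrt 5\<close>.\<close>

lemma half_tan_2: "half_tan 2 = (sqrt 5 - 1) / 2"
proof -
  have "1 + sqrt 5 \<noteq> (0::real)" using real_sqrt_ge_zero[of 5] by linarith
  then have "2 / (1 + sqrt 5) = (sqrt 5 - 1) / 2"
    by (subst frac_eq_eq) (auto simp: algebra_simps)
  then show ?thesis by (simp add: half_tan_def)
qed

lemma half_tan_mono:
  assumes "0 \<le> s" "s \<le> t"
  shows "half_tan s \<le> half_tan t"
proof -
  have "\<exists>y. DERIV half_tan x :> y \<and> 0 \<le> y" for x
    using DERIV_half_tan[of x] by (auto intro!: exI)
  then show ?thesis using DERIV_nonneg_imp_nondecreasing[OF assms(2), of half_tan] by blast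
qed

text \<open>Both sides are \<open>arsinh s\<close>, the left one in the form
  \<open>2 * artanh (half_tan s)\<close>.\<close>

lemma ln_half_tan:
  assumes "0 < s"
  shows "ln (1 + half_tan s) - ln (1 - half_tan s) = ln (sqrt (1 + s\<^sup>2) + s)"
proof -
  define w where "w = sqrt (1 + s\<^sup>2)"
  have w: "w > 0" "w\<^sup>2 = 1 + s\<^sup>2" using assms by (auto simp: w_def add_pos_nonneg)
  have y: "half_tan s = s / (1 + w)" by (simp add: half_tan_def w_def)
  have *: "(w + s) * (1 - half_tan s) = 1 + half_tan s"
  proof -
    have "(w + s) * (1 + w - s) = 1 + w + s" using w(2) by (simp add: algebra_simps power2_eq_square)
    then show ?thesis unfolding y using w(1) by (simp add: field_simps)
  qed
  have "ln (1 + half_tan s) = ln (w + s) + ln (1 - half_tan s)"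
    unfolding *[symmetric] using assms half_tan_bounds[OF assms] w by (subst ln_mult) auto
  then show ?thesis by (simp add: w_def)
qed

text \<open>With \<open>y = half_tan s\<close> one has
  \<open>dy / y = ds / (s * sqrt (1 + s^2))\<close>, and the logarithm becomes
  \<open>ln ((1 + y) / (1 - y))\<close>; the integrand is the differential of
  \<open>2 * legendre_chi 2 y\<close>.\<close>

lemma legendre_chi_half_tan_integral:
  assumes "0 < t"
  shows "((\<lambda>s. ln (sqrt (1 + s\<^sup>2) + s) / (s * sqrt (1 + s\<^sup>2))) has_integral 2 * legendre_chi 2 (half_tan t)) {0..t}"
proof -
  have "((\<lambda>s. ln (sqrt (1 + s\<^sup>2) + s) / (s * sqrt (1 + s\<^sup>2))) has_integral
      2 * legendre_chi 2 (half_tan t) - 2 * legendre_chi 2 (half_tan 0)) {0..t}"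
  proof (rule FTC_real_interior)
    have "half_tan ` {0..t} \<subseteq> {0..1}"
      using half_tan_bounds by (force simp: order_le_less)
    then show "continuous_on {0..t} (\<lambda>s. 2 * legendre_chi 2 (half_tan s))"
      by (intro continuous_intros continuous_on_compose2[OF continuous_on_legendre_chi continuous_on_half_tan]) auto
    fix s assume s: "0 < s" "s < t"
    define w where "w = sqrt (1 + s\<^sup>2)"
    have w: "w > 0" using s by (simp add: w_def add_pos_nonneg)
    have y: "half_tan s = s / (1 + w)" by (simp add: half_tan_def w_def)
    have "((\<lambda>s. 2 * legendre_chi 2 (half_tan s)) has_real_derivative
      2 * ((ln (1 + half_tan s) - ln (1 - half_tan s)) / (2 * half_tan s) * (1 / (w * (1 + w))))) (at s)"
      unfolding w_def
      by (intro DERIV_cmult DERIV_chain2[OF DERIV_legendre_chi_2 DERIV_half_tan] half_tan_bounds s)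
    also have "2 * ((ln (1 + half_tan s) - ln (1 - half_tan s)) / (2 * half_tan s) * (1 / (w * (1 + w))))
        = ln (w + s) / (s * w)"
      unfolding ln_half_tan[OF s(1)] w_def[symmetric] unfolding y using w s by (simp add: divide_simps)
    finally show "((\<lambda>s. 2 * legendre_chi 2 (half_tan s)) has_real_derivative ln (sqrt (1 + s\<^sup>2) + s) / (s * sqrt (1 + s\<^sup>2))) (at s)"
      by (simp add: w_def)
  qed (use assms in auto)
  then show ?thesis by (simp add: legendre_chi_0)
qed

lemma cos_rational_integral:
  assumes s: "0 < s"
  shows "((\<lambda>u. cos u / (1 + (s * cos u)\<^sup>2)) has_integral ln (sqrt (1 + s\<^sup>2) + s) / (s * sqrt (1 + s\<^sup>2))) {0..pi/2}"
proof -
  define w where "w = sqrt (1 + s\<^sup>2)"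
  have w: "w > 0" "w\<^sup>2 = 1 + s\<^sup>2" using s by (auto simp: w_def add_pos_nonneg)
  have sw: "s < w" unfolding w_def by (rule real_less_rsqrt) simp
  \<comment> \<open>Partial fractions in \<open>v = s * sin u\<close>: the denominator is
    \<open>w^2 - v^2\<close>.\<close>
  define F where "F u = (ln (w + s * sin u) - ln (w - s * sin u)) / (2 * s * w)" for u
  have "((\<lambda>u. cos u / (1 + (s * cos u)\<^sup>2)) has_integral F (pi/2) - F 0) {0..pi/2}"
  proof (rule FTC_real)
    fix u :: real
    have "\<bar>s * sin u\<bar> \<le> s" using s by (simp add: abs_mult mult_left_le)
    then have pos: "0 < w + s * sin u" "0 < w - s * sin u" using sw by auto
    have prod: "(w + s * sin u) * (w - s * sin u) = 1 + (s * cos u)\<^sup>2"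
      using w(2) sin_cos_squared_add[of u] by algebra
    have "(F has_real_derivative (s * cos u / (w + s * sin u) - (- (s * cos u)) / (w - s * sin u)) / (2 * s * w)) (at u)"
      unfolding F_def[abs_def]
      by (intro DERIV_cdivide DERIV_diff) (use pos in \<open>auto intro!: derivative_eq_intros\<close>)
    moreover have "(s * cos u / (w + s * sin u) - (- (s * cos u)) / (w - s * sin u)) / (2 * s * w)
        = cos u / ((w + s * sin u) * (w - s * sin u))"
      using pos s w by (simp add: divide_simps) (simp add: algebra_simps)
    ultimately show "(F has_real_derivative cos u / (1 + (s * cos u)\<^sup>2)) (at u)"
      by (simp only: prod)
  qed auto
  moreover have "F (pi/2) - F 0 = ln (w + s) / (s * w)"
  proof -
    have "(w + s) * (w - s) = 1" using w(2) by (simp add: algebra_simps power2_eq_square)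
    then have "ln (w + s) + ln (w - s) = 0" using s w sw by (metis add_pos_pos diff_gt_0_iff_gt ln_mult_pos ln_one)
    then have "ln (w - s) = - ln (w + s)" by simp
    then have "F (pi/2) = 2 * ln (w + s) / (2 * s * w)" by (simp add: F_def)
    then show ?thesis by (simp add: F_def)
  qed
  ultimately show ?thesis by (simp add: w_def)
qed

lemma arctan_cos_integral:
  assumes t: "0 < t"
  shows "((\<lambda>u. arctan (t * cos u)) has_integral 2 * legendre_chi 2 (half_tan t)) {0..pi/2}"
proof (rule has_integral_swap_nonneg[where g = "\<lambda>s u. cos u / (1 + (s * cos u)\<^sup>2)"])
  show "(\<lambda>(s::real, u::real). cos u / (1 + (s * cos u)\<^sup>2)) \<in> borel_measurable (borel \<Otimes>\<^sub>M borel)"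
    by measurable
  show "0 \<le> cos u / (1 + (s * cos u)\<^sup>2)" if "u \<in> {0..pi/2}" for s u :: real
    using that by (auto intro!: divide_nonneg_nonneg cos_ge_zero)
  show "((\<lambda>s. cos u / (1 + (s * cos u)\<^sup>2)) has_integral arctan (t * cos u)) {0..t}" for u
  proof -
    have "((\<lambda>s. cos u / (1 + (s * cos u)\<^sup>2)) has_integral arctan (t * cos u) - arctan (0 * cos u)) {0..t}"
      using t by (intro FTC_real) (auto intro!: derivative_eq_intros simp: field_simps)
    then show ?thesis by simp
  qed
  show "((\<lambda>u. cos u / (1 + (s * cos u)\<^sup>2)) has_integral ln (sqrt (1 + s\<^sup>2) + s) / (s * sqrt (1 + s\<^sup>2))) {0..pi/2}"
    if "s \<in> {0..t} - {0}" for s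
    using that by (intro cos_rational_integral) auto
qed (use legendre_chi_half_tan_integral[OF t] in auto)

text \<open>Scaling writes \<open>arctan_int (2 * cos u)\<close> as an integral over the fixed
  interval \<open>[0, 2]\<close>, which permits the exchange with \<open>u\<close>. In the variable
  \<open>y = half_tan t\<close> one has \<open>t = 2 * y / (1 - y^2)\<close> and
  \<open>dt / t = (1 + y^2) / (y * (1 - y^2)) dy\<close>, exactly the weight for which
  \<open>chi_prim\<close> was built.\<close>

theorem arctan_int_mean:
  "((\<lambda>u. arctan_int (2 * cos u)) has_integral 7 / 5 * zeta 3) {0..pi/2}"
proof (rule has_integral_swap_nonneg[where g = "\<lambda>t u. arctan (t * cos u) / t" and S = "{0..2}" and M = "{0}" and N = "{pi/2}"])
  show "(\<lambda>(t::real, u::real). arctan (t * cos u) / t) \<in> borel_measurable (borel \<Otimes>\<^sub>M borel)"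
    by measurable
  show "0 \<le> arctan (t * cos u) / t" if "t \<in> {0..2}" "u \<in> {0..pi/2}" for t u
    using that by (auto intro!: divide_nonneg_nonneg mult_nonneg_nonneg cos_ge_zero)
  show "((\<lambda>t. arctan (t * cos u) / t) has_integral arctan_int (2 * cos u)) {0..2}" if "u \<in> {0..pi/2} - {pi/2}" for u
    using that by (intro arctan_int_scaled cos_gt_zero_pi) auto
  show "((\<lambda>u. arctan (t * cos u) / t) has_integral 2 * legendre_chi 2 (half_tan t) / t) {0..pi/2}"
    if "t \<in> {0..2} - {0}" for t
    using that by (intro has_integral_divide arctan_cos_integral) auto
  have "((\<lambda>t. 2 * legendre_chi 2 (half_tan t) / t) has_integral 2 * chi_prim (half_tan 2) - 2 * chi_prim (half_tan 0)) {0..2}"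
  proof (rule FTC_real_interior)
    have "half_tan ` {0..2} \<subseteq> {0..half_tan 2}"
      using half_tan_mono by (force simp: half_tan_def)
    then show "continuous_on {0..2} (\<lambda>t. 2 * chi_prim (half_tan t))"
      using half_tan_bounds[of 2]
      by (intro continuous_intros continuous_on_compose2[OF continuous_on_chi_prim continuous_on_half_tan]) auto
    fix s :: real assume s: "0 < s" "s < 2"
    define w where "w = sqrt (1 + s\<^sup>2)"
    have w: "w > 0" "w\<^sup>2 = 1 + s\<^sup>2" using s by (auto simp: w_def add_pos_nonneg)
    define y where "y = half_tan s"
    have y: "y = s / (1 + w)" by (simp add: half_tan_def w_def y_def)
    have yb: "0 < y" "y < 1" using half_tan_bounds[OF s(1)] by (auto simp: y_def)
    have y2: "y\<^sup>2 < 1" using yb by (simp add: abs_square_less_1)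
    have "((\<lambda>s. 2 * chi_prim (half_tan s)) has_real_derivative
      2 * (legendre_chi 2 y * (1 + y\<^sup>2) / (y * (1 - y\<^sup>2)) * (1 / (w * (1 + w))))) (at s)"
      unfolding w_def y_def
      by (intro DERIV_cmult DERIV_chain2[OF DERIV_chi_prim DERIV_half_tan] half_tan_bounds s)
    also have "2 * (legendre_chi 2 y * (1 + y\<^sup>2) / (y * (1 - y\<^sup>2)) * (1 / (w * (1 + w)))) = 2 * legendre_chi 2 y / s"
    proof -
      have ys: "y * (1 + w) = s" using w by (simp add: y)
      have "(1 + y\<^sup>2) * (1 + w)\<^sup>2 = (w * (1 - y\<^sup>2)) * (1 + w)\<^sup>2"
      proof -
        have "(1 + y\<^sup>2) * (1 + w)\<^sup>2 = (1 + w)\<^sup>2 + s\<^sup>2" using ys by (simp add: algebra_simps flip: power_mult_distrib)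
        also have "\<dots> = w * ((1 + w)\<^sup>2 - s\<^sup>2)" using w(2) by algebra
        also have "\<dots> = (w * (1 - y\<^sup>2)) * (1 + w)\<^sup>2" unfolding ys[symmetric] by algebra
        finally show ?thesis .
      qed
      then have "1 + y\<^sup>2 = w * (1 - y\<^sup>2)" using w(1) by simp
      then have "legendre_chi 2 y * (1 + y\<^sup>2) / (y * (1 - y\<^sup>2)) * (1 / (w * (1 + w))) = legendre_chi 2 y / (y * (1 + w))"
        using w(1) y2 by simp
      then show ?thesis by (simp add: ys)
    qed
    finally show "((\<lambda>t. 2 * chi_prim (half_tan t)) has_real_derivative 2 * legendre_chi 2 (half_tan s) / s) (at s)"
      by (simp add: y_def)
  qed auto
  then show "((\<lambda>t. 2 * legendre_chi 2 (half_tan t) / t) has_integral 7 / 5 * zeta 3) {0..2}"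
    by (simp add: half_tan_2 chi_prim_golden chi_prim_0)
qed auto

section \<open>Means over the circle from integrals over a quarter period\<close>

lemma has_integral_abs_cos:
  fixes g :: "real \<Rightarrow> real"
  assumes I: "((\<lambda>u. g (cos u)) has_integral I) {0..pi/2}"
  shows "((\<lambda>t. g \<bar>cos (pi * t)\<bar>) has_integral 2 / pi * I) {0..1}"
proof -
  have 1: "((\<lambda>u. g \<bar>cos u\<bar>) has_integral I) {0..pi/2}"
    by (rule has_integral_eq[OF _ I]) (auto simp: cos_ge_zero)
  have "((\<lambda>u. g \<bar>cos (pi - u)\<bar>) has_integral I) {pi/2..pi}"
    by (rule has_integral_reflect_interval[OF 1]) auto
  then have 2: "((\<lambda>u. g \<bar>cos u\<bar>) has_integral I) {pi/2..pi}" by simp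
  have "((\<lambda>u. g \<bar>cos u\<bar>) has_integral I + I) {0..pi}"
    by (rule has_integral_combine[OF _ _ 1 2]) auto
  from has_integral_affinity'[of "\<lambda>u. g \<bar>cos u\<bar>" "I + I" 0 pi pi 0] this
  show ?thesis by (simp add: field_simps)
qed

lemma has_integral_abs_cos_double:
  fixes g :: "real \<Rightarrow> real"
  assumes I: "((\<lambda>u. g (cos u)) has_integral I) {0..pi/2}"
  shows "((\<lambda>t. g \<bar>cos (2 * pi * t)\<bar>) has_integral 2 / pi * I) {0..1}"
proof -
  have "((\<lambda>t. g \<bar>cos (pi * (2 * t))\<bar>) has_integral 2 / pi * I) {0..1}"
    by (rule has_integral_periodic_double[where f = "\<lambda>t. g \<bar>cos (pi * t)\<bar>"])
       (use has_integral_abs_cos[OF I] in \<open>auto simp: ring_distribs\<close>)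
  then show ?thesis by (simp add: mult_ac)
qed

text \<open>By Jensen's formula the mean of \<open>ln \<bar>1 + x\<bar>\<close> over the circle is
  0, and by reflection the two halves contribute equally.\<close>

lemma ln_two_cos_integral: "((\<lambda>u. ln (2 * cos u)) has_integral 0) {0..pi/2}"
proof -
  have J: "((\<lambda>t. ln (2 * \<bar>cos (pi * t)\<bar>)) has_integral 0) {0..1}"
    using jensen_linear[of 1 1] by (simp add: cmod_one_plus_unit_circ)
  have "(\<lambda>t. ln (2 * \<bar>cos (pi * t)\<bar>)) integrable_on {0..1/2}"
    by (rule integrable_on_subinterval[OF has_integral_integrable[OF J]]) auto
  then obtain I where I: "((\<lambda>t. ln (2 * \<bar>cos (pi * t)\<bar>)) has_integral I) {0..1/2}"
    unfolding integrable_on_def by blast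
  have "((\<lambda>t. ln (2 * \<bar>cos (pi * (1 - t))\<bar>)) has_integral I) {1/2..1}"
    by (rule has_integral_reflect_interval[OF I]) auto
  then have 2: "((\<lambda>t. ln (2 * \<bar>cos (pi * t)\<bar>)) has_integral I) {1/2..1}"
    by (simp add: right_diff_distrib)
  have "((\<lambda>t. ln (2 * \<bar>cos (pi * t)\<bar>)) has_integral I + I) {0..1}"
    by (rule has_integral_combine[OF _ _ I 2]) auto
  with J have "I + I = 0" using has_integral_unique by blast
  with I have "((\<lambda>t. ln (2 * \<bar>cos (pi * t)\<bar>)) has_integral 0) {0..1/2}" by simp
  from has_integral_affinity'[of "\<lambda>t. ln (2 * \<bar>cos (pi * t)\<bar>)" 0 0 "1/2" "1/pi" 0] this
  have "((\<lambda>u. ln (2 * \<bar>cos u\<bar>)) has_integral 0) {0..pi/2}" by simp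
  then show ?thesis
    by (rule has_integral_eq[rotated]) (auto simp: cos_ge_zero)
qed

section \<open>The square root in the fifth polynomial\<close>

lemma arctan_half_angle:
  assumes "0 < s"
  shows "arctan ((s\<^sup>2 - 1) / (2 * s)) = 2 * arctan s - pi/2"
proof (rule arctan_unique)
  have a: "0 < arctan s" "arctan s < pi/2" using assms arctan_ubound[of s] by auto
  then show "- (pi/2) < 2 * arctan s - pi/2" "2 * arctan s - pi/2 < pi/2" by auto
  have p: "1 + s\<^sup>2 > 0" by (intro add_pos_nonneg) auto
  have "sin (2 * arctan s - pi/2) = (s\<^sup>2 - 1) / (1 + s\<^sup>2)"
  proof -
    have "sin (2 * arctan s - pi/2) = - ((1 - s\<^sup>2) / (1 + s\<^sup>2))"
      using p by (simp add: sin_diff cos_double sin_arctan cos_arctan power_divide flip: diff_divide_distrib)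
    also have "\<dots> = (s\<^sup>2 - 1) / (1 + s\<^sup>2)" by (simp add: minus_divide_left del: minus_divide_left[symmetric])
    finally show ?thesis .
  qed
  moreover have "cos (2 * arctan s - pi/2) = 2 * s / (1 + s\<^sup>2)"
    using p by (simp add: cos_diff sin_double sin_arctan cos_arctan)
  ultimately show "tan (2 * arctan s - pi/2) = (s\<^sup>2 - 1) / (2 * s)"
    using p assms by (simp add: tan_def)
qed

text \<open>As a polynomial in \<open>1 + y\<close>, the fifth polynomial has leading coefficient of modulus
  \<open>4 (ellip r c)\<^sup>2\<close> for \<open>r = \<bar>1 + x\<bar>\<close> and \<open>c = \<bar>1 + z\<bar> / 2\<close>.\<close>

definition ellip :: "real \<Rightarrow> real \<Rightarrow> real" where
  "ellip r c = sqrt (((r\<^sup>2 - 1) * c)\<^sup>2 + 4 * r\<^sup>2)"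

lemma ellip_pos: "0 < ellip r c" if "r \<noteq> 0 \<or> c \<noteq> 0"
proof (cases "r = 0")
  case False
  then show ?thesis by (auto simp: ellip_def intro!: add_nonneg_pos)
qed (use that in \<open>simp add: ellip_def\<close>)

lemma ellip_sq: "(ellip r c)\<^sup>2 = ((r\<^sup>2 - 1) * c)\<^sup>2 + 4 * r\<^sup>2"
  by (simp add: ellip_def)

lemma abs_le_ellip: "\<bar>(r\<^sup>2 - 1) * c\<bar> \<le> ellip r c"
  unfolding ellip_def by (rule real_le_rsqrt) simp

lemma DERIV_ellip:
  assumes "s \<noteq> 0 \<or> c \<noteq> 0"
  shows "((\<lambda>s. ellip s c) has_real_derivative (2 * s * ((s\<^sup>2 - 1) * c\<^sup>2) + 4 * s) / ellip s c) (at s)"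
proof -
  have "0 < ((s\<^sup>2 - 1) * c)\<^sup>2 + 4 * s\<^sup>2" using ellip_pos[OF assms] by (simp add: ellip_def)
  then show ?thesis unfolding ellip_def
    by (auto intro!: derivative_eq_intros simp: field_simps power2_eq_square)
qed

lemma ln_ellip_deriv:
  assumes s: "0 < s" and c: "0 < c"
  shows "((\<lambda>s. ln (ellip s c + (s\<^sup>2 + 1) * c)) has_real_derivative (1 + (s\<^sup>2 - 1) * c / ellip s c) / s) (at s)"
proof -
  define D where "D = ellip s c"
  have D: "0 < D" "D\<^sup>2 = ((s\<^sup>2 - 1) * c)\<^sup>2 + 4 * s\<^sup>2"
    using ellip_pos[of s c] s by (auto simp: D_def ellip_sq)
  have pos: "0 < D + (s\<^sup>2 + 1) * c" using D c by (intro add_pos_nonneg) auto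
  have d1: "((\<lambda>s. ellip s c + (s\<^sup>2 + 1) * c) has_real_derivative (2 * s * ((s\<^sup>2 - 1) * c\<^sup>2) + 4 * s) / D + 2 * s * c) (at s)"
    unfolding D_def using s by (intro DERIV_add DERIV_ellip) (auto intro!: derivative_eq_intros)
  have "((\<lambda>s. ln (ellip s c + (s\<^sup>2 + 1) * c)) has_real_derivative
      1 / (D + (s\<^sup>2 + 1) * c) * ((2 * s * ((s\<^sup>2 - 1) * c\<^sup>2) + 4 * s) / D + 2 * s * c)) (at s)"
    using pos unfolding D_def by (intro DERIV_chain2[OF DERIV_ln_divide d1[unfolded D_def]])
  moreover have "1 / (D + (s\<^sup>2 + 1) * c) * ((2 * s * ((s\<^sup>2 - 1) * c\<^sup>2) + 4 * s) / D + 2 * s * c)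
      = (1 + (s\<^sup>2 - 1) * c / D) / s"
  proof -
    \<comment> \<open>This identity, a consequence of the relation for \<open>D\<^sup>2\<close>,
      cancels the argument of the logarithm against the numerator of its derivative.\<close>
    have "(D + (s\<^sup>2 - 1) * c) * (D + (s\<^sup>2 + 1) * c) = s * (2 * s * ((s\<^sup>2 - 1) * c\<^sup>2) + 4 * s + 2 * s * c * D)"
      using D(2) by algebra
    moreover have "(2 * s * ((s\<^sup>2 - 1) * c\<^sup>2) + 4 * s) / D + 2 * s * c = (2 * s * ((s\<^sup>2 - 1) * c\<^sup>2) + 4 * s + 2 * s * c * D) / D"
      using D(1) by (simp add: add_divide_distrib)
    moreover have "1 + (s\<^sup>2 - 1) * c / D = (D + (s\<^sup>2 - 1) * c) / D"
      using D(1) by (simp add: add_divide_distrib)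
    ultimately show ?thesis using D(1) pos s by (simp add: frac_eq_eq mult_ac)
  qed
  ultimately show ?thesis by (simp add: D_def)
qed

lemma ellip_inner_integral:
  assumes s: "0 < s"
  shows "((\<lambda>u. (1 + (s\<^sup>2 - 1) * cos u / ellip s (cos u)) / s) has_integral 2 * (arctan s / s)) {0..pi/2}"
proof -
  \<comment> \<open>With \<open>D = ellip s (cos u)\<close> the relation
    \<open>D^2 + ((s^2 - 1) * sin u)^2 = (s^2 + 1)^2\<close> makes the arctangent the arcsine of
    \<open>(s^2 - 1) * sin u / (s^2 + 1)\<close>. At \<open>u = pi/2\<close> one has
    \<open>D = 2 * s\<close>, and the arctangent becomes \<open>2 * arctan s - pi/2\<close>.\<close>
  define F where "F u = (u + arctan ((s\<^sup>2 - 1) * sin u / ellip s (cos u))) / s" for u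
  have "((\<lambda>u. (1 + (s\<^sup>2 - 1) * cos u / ellip s (cos u)) / s) has_integral F (pi/2) - F 0) {0..pi/2}"
  proof (rule FTC_real)
    fix u :: real
    define C where "C = s\<^sup>2 - 1"
    define D where "D = ellip s (cos u)"
    have D: "0 < D" "D\<^sup>2 = (C * cos u)\<^sup>2 + 4 * s\<^sup>2"
      using ellip_pos[of s "cos u"] s by (auto simp: D_def ellip_sq C_def)
    have sc: "(sin u)\<^sup>2 = 1 - (cos u)\<^sup>2" by (simp add: sin_squared_eq)
    have B: "D\<^sup>2 + (C * sin u)\<^sup>2 = (s\<^sup>2 + 1)\<^sup>2" unfolding D(2) power_mult_distrib sc by (simp add: C_def) algebra
    have dD: "((\<lambda>u. ellip s (cos u)) has_real_derivative - (C\<^sup>2 * cos u * sin u) / D) (at u)"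
    proof -
      have "0 < ((s\<^sup>2 - 1) * cos u)\<^sup>2 + 4 * s\<^sup>2" using s by (intro add_nonneg_pos) auto
      then show ?thesis unfolding ellip_def D_def C_def
        by (auto intro!: derivative_eq_intros simp: field_simps power2_eq_square)
    qed
    have dq: "((\<lambda>u. C * sin u / ellip s (cos u)) has_real_derivative
        (C * cos u * D - C * sin u * (- (C\<^sup>2 * cos u * sin u) / D)) / (D * D)) (at u)"
      unfolding D_def using D(1)
      by (intro DERIV_divide dD[unfolded D_def]) (auto intro!: derivative_eq_intros simp: D_def)
    have "(F has_real_derivative
        (1 + inverse (1 + (C * sin u / D)\<^sup>2) * ((C * cos u * D - C * sin u * (- (C\<^sup>2 * cos u * sin u) / D)) / (D * D))) / s) (at u)"
      unfolding F_def[abs_def] D_def C_def[symmetric]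
      by (intro DERIV_cdivide DERIV_add DERIV_ident DERIV_chain2[OF DERIV_arctan dq[unfolded D_def]])
    moreover have "inverse (1 + (C * sin u / D)\<^sup>2) * ((C * cos u * D - C * sin u * (- (C\<^sup>2 * cos u * sin u) / D)) / (D * D)) = C * cos u / D"
    proof -
      have 1: "1 + (C * sin u / D)\<^sup>2 = (s\<^sup>2 + 1)\<^sup>2 / D\<^sup>2"
        using D(1) by (simp add: B[symmetric] power_divide add_divide_distrib)
      have "C * cos u * D - C * sin u * (- (C\<^sup>2 * cos u * sin u) / D) = C * cos u * (D\<^sup>2 + (C * sin u)\<^sup>2) / D"
        using D(1) by (simp add: field_simps power2_eq_square)
      then have 2: "C * cos u * D - C * sin u * (- (C\<^sup>2 * cos u * sin u) / D) = C * cos u * (s\<^sup>2 + 1)\<^sup>2 / D"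
        by (simp only: B)
      have "s\<^sup>2 + 1 > 0" by (intro add_nonneg_pos) auto
      then show ?thesis unfolding 1 2 using D(1) by (simp add: power2_eq_square)
    qed
    ultimately show "(F has_real_derivative (1 + (s\<^sup>2 - 1) * cos u / ellip s (cos u)) / s) (at u)"
      by (simp only: D_def C_def)
  qed auto
  moreover have "F (pi/2) - F 0 = 2 * (arctan s / s)"
  proof -
    have "ellip s 0 = 2 * s" using s by (simp add: ellip_def real_sqrt_mult)
    then show ?thesis using arctan_half_angle[OF s] by (simp add: F_def)
  qed
  ultimately show ?thesis by simp
qed

text \<open>At \<open>r = 0\<close> the integrand is \<open>ln (2 * cos u)\<close> and not 0. It is
  subtracted for the exchange and restored afterwards, having integral 0.\<close>

lemma ln_ellip_integral:
  assumes r: "0 \<le> r"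
  shows "((\<lambda>u. ln (ellip r (cos u) + (r\<^sup>2 + 1) * cos u)) has_integral 2 * arctan_int r) {0..pi/2}"
proof -
  have "((\<lambda>u. ln (ellip r (cos u) + (r\<^sup>2 + 1) * cos u) - ln (2 * cos u)) has_integral 2 * arctan_int r) {0..pi/2}"
  proof (rule swap_arctan_int[OF r, where g = "\<lambda>s u. (1 + (s\<^sup>2 - 1) * cos u / ellip s (cos u)) / s"])
    show "(\<lambda>(s::real, u::real). (1 + (s\<^sup>2 - 1) * cos u / ellip s (cos u)) / s) \<in> borel_measurable (borel \<Otimes>\<^sub>M borel)"
      unfolding ellip_def by measurable
    show "0 \<le> (1 + (s\<^sup>2 - 1) * cos u / ellip s (cos u)) / s" if "0 \<le> s" for s u
    proof (cases "s = 0")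
      case False
      then have "0 < ellip s (cos u)" using ellip_pos by auto
      moreover have "- ellip s (cos u) \<le> (s\<^sup>2 - 1) * cos u" using abs_le_ellip[of s "cos u"] by linarith
      ultimately have "-1 \<le> (s\<^sup>2 - 1) * cos u / ellip s (cos u)" by (simp add: pos_le_divide_eq)
      then show ?thesis using that by auto
    qed simp
    show "((\<lambda>s. (1 + (s\<^sup>2 - 1) * cos u / ellip s (cos u)) / s) has_integral
        ln (ellip r (cos u) + (r\<^sup>2 + 1) * cos u) - ln (2 * cos u)) {0..r}" if u: "0 \<le> u" "u < pi/2" for u
    proof -
      have c: "0 < cos u" using u by (intro cos_gt_zero_pi) auto
      have "((\<lambda>s. (1 + (s\<^sup>2 - 1) * cos u / ellip s (cos u)) / s) has_integral
          ln (ellip r (cos u) + (r\<^sup>2 + 1) * cos u) - ln (ellip 0 (cos u) + (0\<^sup>2 + 1) * cos u)) {0..r}"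
      proof (rule FTC_real_interior[OF r])
        have "0 < ellip s (cos u) + (s\<^sup>2 + 1) * cos u" for s
          using ellip_pos[of s "cos u"] c by (intro add_pos_nonneg) auto
        then have nz: "ellip s (cos u) + (s\<^sup>2 + 1) * cos u \<noteq> 0" for s by (metis less_irrefl)
        have "continuous_on {0..r} (\<lambda>s. ellip s (cos u))"
          unfolding ellip_def by (intro continuous_intros)
        then show "continuous_on {0..r} (\<lambda>s. ln (ellip s (cos u) + (s\<^sup>2 + 1) * cos u))"
          using nz by (intro continuous_intros) auto
      qed (use ln_ellip_deriv c in auto)
      then show ?thesis using c by (simp add: ellip_def)
    qed
    show "((\<lambda>u. (1 + (s\<^sup>2 - 1) * cos u / ellip s (cos u)) / s) has_integral 2 * (arctan s / s)) {0..pi/2}" if "0 < s" for s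
      using ellip_inner_integral[OF that] .
  qed
  from has_integral_add[OF this ln_two_cos_integral] show ?thesis by simp
qed

text \<open>The root is the modulus of a linear polynomial \<open>a + b * unit_circ t\<close>: this
  requires \<open>a - b = 2 * r\<close> and \<open>4 * a * b = (r^2 - 1)^2\<close>, hence
  \<open>a + b = r^2 + 1\<close>. Jensen's formula gives \<open>ln a\<close> with
  \<open>a = (1 + r)^2 / 2\<close>.\<close>

lemma ln_ellip_mean:
  assumes r: "0 \<le> r"
  shows "((\<lambda>t. ln (ellip r \<bar>cos (pi * t)\<bar>)) has_integral 2 * ln (1 + r) - ln 2) {0..1}"
proof -
  define B where "B = r\<^sup>2 + 1"
  have B: "0 < B" unfolding B_def by (intro add_nonneg_pos) auto
  then have pos: "(B + 2 * r) / 2 > 0" using r by simp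
  have le: "\<bar>(B - 2 * r) / 2\<bar> \<le> (B + 2 * r) / 2" using r B by (simp add: abs_le_iff)
  have eq: "cmod (of_real ((B + 2 * r) / 2) + of_real ((B - 2 * r) / 2) * unit_circ t) = ellip r \<bar>cos (pi * t)\<bar>" for t
  proof -
    have c1: "(cos (2 * pi * t))\<^sup>2 + (sin (2 * pi * t))\<^sup>2 = 1" by simp
    have c2: "cos (2 * pi * t) = 2 * (cos (pi * t))\<^sup>2 - 1"
      using cos_double_cos[of "pi * t"] by (simp add: mult.assoc)
    have "(cmod (of_real ((B + 2 * r) / 2) + of_real ((B - 2 * r) / 2) * unit_circ t))\<^sup>2 =
        ((B + 2 * r) / 2 + (B - 2 * r) / 2 * cos (2 * pi * t))\<^sup>2 + ((B - 2 * r) / 2 * sin (2 * pi * t))\<^sup>2"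
      by (simp add: cmod_power2 unit_circ_def)
    also have "\<dots> = ((B + 2 * r) / 2)\<^sup>2 + 2 * ((B + 2 * r) / 2 * ((B - 2 * r) / 2)) * cos (2 * pi * t) + ((B - 2 * r) / 2)\<^sup>2 * ((cos (2 * pi * t))\<^sup>2 + (sin (2 * pi * t))\<^sup>2)"
    proof -
      have "(p + q * c)\<^sup>2 + (q * d)\<^sup>2 = p\<^sup>2 + 2 * (p * q) * c + q\<^sup>2 * (c\<^sup>2 + d\<^sup>2)" for p q c d :: real
        by algebra
      then show ?thesis .
    qed
    also have "\<dots> = ((r\<^sup>2 - 1) * cos (pi * t))\<^sup>2 + 4 * r\<^sup>2"
      unfolding c1 unfolding c2 B_def by (simp add: field_simps power2_eq_square)
    also have "\<dots> = (ellip r \<bar>cos (pi * t)\<bar>)\<^sup>2" by (simp add: ellip_sq power_mult_distrib)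
    finally show ?thesis
      by (rule power2_eq_imp_eq) (auto simp: ellip_def)
  qed
  have "((\<lambda>t. ln (ellip r \<bar>cos (pi * t)\<bar>)) has_integral
      ln (max (cmod (of_real ((B + 2 * r) / 2))) (cmod (of_real ((B - 2 * r) / 2))))) {0..1}"
    unfolding eq[symmetric] using pos by (intro jensen_linear) auto
  also have "max (cmod (of_real ((B + 2 * r) / 2))) (cmod (of_real ((B - 2 * r) / 2))) = (1 + r)\<^sup>2 / 2"
    unfolding norm_of_real using pos le by (simp add: max_def B_def power2_eq_square algebra_simps)
  also have "ln ((1 + r)\<^sup>2 / 2) = 2 * ln (1 + r) - ln 2"
    using r by (simp add: ln_div ln_realpow)
  finally show ?thesis .
qed

section \<open>Catalan's constant\<close>

text \<open>The power series of the primitive converges absolutely at 1, so continuity up to the end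
  point replaces an interchange of sum and integral.\<close>

lemma arctan_int_1: "arctan_int 1 = catalan_const"
proof -
  define a :: "nat \<Rightarrow> real" where "a n = (if odd n then (-1) ^ (n div 2) / (real n)\<^sup>2 else 0)" for n
  have sm: "strict_mono (\<lambda>n::nat. 2 * n + 1)" by (simp add: strict_mono_def)
  have zero: "a n = 0" if "n \<notin> range (\<lambda>n. 2 * n + 1)" for n
  proof -
    have "even n" by (metis that oddE rangeI)
    then show ?thesis by (simp add: a_def)
  qed
  have a_odd: "a (2 * n + 1) = (-1) ^ n / (real (2 * n + 1))\<^sup>2" for n by (simp add: a_def)
  have sum: "summable (\<lambda>n. \<bar>a n\<bar>)"
    by (rule summable_comparison_test'[OF summable_inverse_powers[of 2], of 0]) (auto simp: a_def)
  define F where "F x = suminf (\<lambda>n. a n * x ^ n)" for x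
  have "((\<lambda>s. arctan s / s) has_integral F 1 - F 0) {0..1}"
  proof (rule FTC_real_interior)
    show "continuous_on {0..1} F"
      unfolding F_def[abs_def]
      by (rule continuous_on_subset[OF continuous_on_power_series_unit[OF sum]]) auto
    fix x :: real assume x: "0 < x" "x < 1"
    show "(F has_real_derivative arctan x / x) (at x)"
      unfolding F_def[abs_def]
    proof (rule DERIV_power_series_unit[OF sum])
      have "(\<lambda>n. (-1) ^ n * (1 / real (n * 2 + 1) * x ^ (n * 2 + 1))) sums arctan x"
        using summable_arctan_series[of x] arctan_series[of x] x by (simp add: summable_sums)
      also have "(\<lambda>n. (-1) ^ n * (1 / real (n * 2 + 1) * x ^ (n * 2 + 1))) =
          (\<lambda>n. real (2 * n + 1) * a (2 * n + 1) * x ^ (2 * n + 1))"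
        unfolding a_odd by (intro ext) (simp add: power2_eq_square mult.commute)
      also have "\<dots> sums arctan x \<longleftrightarrow> (\<lambda>n. real n * a n * x ^ n) sums arctan x"
        by (rule sums_mono_reindex[OF sm]) (auto simp: zero)
      finally show "(\<lambda>n. real n * a n * x ^ n) sums arctan x" .
    qed (use x in auto)
  qed auto
  then have "arctan_int 1 = F 1 - F 0" using has_integral_arctan_int has_integral_unique by blast
  moreover have "F 0 = 0" using powser_zero[of a] by (simp add: F_def a_def)
  moreover have "F 1 = catalan_const"
  proof -
    have "a sums F 1" using summable_sums[OF summable_rabs_cancel[OF sum]] by (simp add: F_def)
    then have "(\<lambda>n. a (2 * n + 1)) sums F 1" by (subst sums_mono_reindex[OF sm]) (auto simp: zero)
    then show ?thesis unfolding a_odd catalan_const_def by (simp add: sums_iff)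
  qed
  ultimately show ?thesis by simp
qed

text \<open>Partial integration: differentiating \<open>arctan_int (tan v)\<close> returns
  \<open>v / tan v\<close> times the derivative of \<open>tan v\<close>. The terms
  \<open>v * ln (tan v)\<close> vanish at both ends.\<close>

lemma ln_tan_integral: "((\<lambda>v. ln (tan v)) has_integral - catalan_const) {0..pi/4}"
proof -
  have "((\<lambda>v. ln (tan v)) has_integral (pi/4 * ln (tan (pi/4)) - arctan_int (tan (pi/4))) - (0 * ln (tan 0) - arctan_int (tan 0))) {0..pi/4}"
  proof (rule FTC_real_interior)
    have bd: "- (pi/2) < v" "v < pi/2" if "v \<in> {0..pi/4}" for v
      using that pi_gt_zero unfolding atLeastAtMost_iff by linarith+
    have cos_nz: "cos v \<noteq> 0" if "v \<in> {0..pi/4}" for v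
      using cos_gt_zero_pi[OF bd[OF that]] by simp
    have "continuous_on {0..pi/4} tan" using cos_nz by (intro continuous_intros) auto
    moreover have "tan ` {0..pi/4} \<subseteq> {0..1}"
    proof safe
      fix v :: real assume "v \<in> {0..pi/4}"
      then have "tan 0 \<le> tan v" "tan v \<le> tan (pi/4)"
        using tan_mono_le[of 0 v] tan_mono_le[of v "pi/4"] bd[of v] by auto
      then show "tan v \<in> {0..1}" by (simp add: tan_45)
    qed
    ultimately have c2: "continuous_on {0..pi/4} (\<lambda>v. arctan_int (tan v))"
      by (intro continuous_on_compose2[OF continuous_on_arctan_int])
    have c1: "continuous_on {0..pi/4} (\<lambda>v. v * ln (tan v))"
      unfolding continuous_on_eq_continuous_within
    proof
      fix x :: real assume x: "x \<in> {0..pi/4}"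
      show "continuous (at x within {0..pi/4}) (\<lambda>v. v * ln (tan v))"
      proof (cases "x = 0")
        case True
        have "((\<lambda>v::real. v * ln (tan v)) \<longlongrightarrow> 0) (at_right 0)" by real_asymp
        then show ?thesis unfolding True by (simp add: continuous_within at_within_Icc_at_right)
      next
        case False
        then have "tan x > 0" using x bd[OF x] by (intro tan_gt_zero) auto
        then show ?thesis using cos_nz[OF x] by (intro continuous_intros) auto
      qed
    qed
    show "continuous_on {0..pi/4} (\<lambda>v. v * ln (tan v) - arctan_int (tan v))"
      by (intro continuous_on_diff c1 c2)
    fix v :: real assume v: "0 < v" "v < pi/4"
    then have t: "tan v > 0" and nz: "cos v \<noteq> 0" and at: "arctan (tan v) = v"
      using cos_nz[of v] bd[of v] by (auto intro!: tan_gt_zero arctan_tan)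
    have dt: "(tan has_real_derivative inverse ((cos v)\<^sup>2)) (at v)" by (rule DERIV_tan[OF nz])
    have "((\<lambda>v. v * ln (tan v)) has_real_derivative 1 * ln (tan v) + (1 / tan v * inverse ((cos v)\<^sup>2)) * v) (at v)"
      by (intro DERIV_mult DERIV_ident DERIV_chain2[OF DERIV_ln_divide[OF t] dt])
    moreover have "((\<lambda>v. arctan_int (tan v)) has_real_derivative v / tan v * inverse ((cos v)\<^sup>2)) (at v)"
      using DERIV_chain2[OF DERIV_arctan_int[OF t] dt] by (simp add: at)
    ultimately have "((\<lambda>v. v * ln (tan v) - arctan_int (tan v)) has_real_derivative
        (1 * ln (tan v) + (1 / tan v * inverse ((cos v)\<^sup>2)) * v) - v / tan v * inverse ((cos v)\<^sup>2)) (at v)"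
      by (rule DERIV_diff)
    then show "((\<lambda>v. v * ln (tan v) - arctan_int (tan v)) has_real_derivative ln (tan v)) (at v)" by simp
  qed auto
  then show ?thesis by (simp add: tan_45 arctan_int_1)
qed

lemma ln_two_sin_integral: "((\<lambda>v. ln (2 * sin v)) has_integral 0) {0..pi/2}"
proof -
  have "((\<lambda>v. ln (2 * cos (pi/2 - v))) has_integral 0) {0..pi/2}"
    by (rule has_integral_reflect_interval[OF ln_two_cos_integral]) auto
  then show ?thesis by (simp add: cos_diff)
qed

text \<open>\<open>2 * sin (2 * v) * tan v = (2 * sin v)\<^sup>2\<close>, and the factor with the
  doubled angle contributes 0; half of the integral of \<open>ln (tan v)\<close> remains.\<close>

lemma ln_two_sin_quarter: "((\<lambda>v. ln (2 * sin v)) has_integral - catalan_const / 2) {0..pi/4}"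
proof -
  have 1: "((\<lambda>v. ln (2 * sin (2 * v))) has_integral 0) {0..pi/4}"
    using has_integral_affinity'[of "\<lambda>v. ln (2 * sin v)" 0 0 "pi/2" 2 0] ln_two_sin_integral by simp
  have "((\<lambda>v. (ln (2 * sin (2 * v)) + ln (tan v)) / 2) has_integral (0 + - catalan_const) / 2) {0..pi/4}"
    by (intro has_integral_divide has_integral_add 1 ln_tan_integral)
  then have "((\<lambda>v. (ln (2 * sin (2 * v)) + ln (tan v)) / 2) has_integral - catalan_const / 2) {0..pi/4}" by simp
  then show ?thesis
  proof (rule has_integral_spike_finite[where S = "{0}", rotated 2])
    fix v :: real assume v: "v \<in> {0..pi/4} - {0}"
    then have "0 < v" "v < pi/2" "v < pi" using pi_gt_zero unfolding atLeastAtMost_iff Diff_iff by auto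
    then have s: "sin v > 0" "cos v > 0" by (auto intro!: sin_gt_zero cos_gt_zero_pi)
    then have "ln (2 * sin (2 * v)) + ln (tan v) = ln (2 * sin (2 * v) * tan v)"
      by (subst ln_mult) (auto simp: tan_def sin_double)
    also have "2 * sin (2 * v) * tan v = (2 * sin v)\<^sup>2"
      using s by (simp add: tan_def sin_double power2_eq_square)
    finally have "ln (2 * sin (2 * v)) + ln (tan v) = ln ((2 * sin v)\<^sup>2)" .
    also have "\<dots> = 2 * ln (2 * sin v)" using ln_realpow[of "2 * sin v" 2] s by simp
    finally show "ln (2 * sin v) = (ln (2 * sin (2 * v)) + ln (tan v)) / 2" by simp
  qed auto
qed

text \<open>The sine quotient calls for the integrals of \<open>ln (2 * sin v)\<close> up to
  \<open>3*pi/4\<close> and up to \<open>pi/4\<close>. As the integral up to \<open>pi/2\<close> is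
  0, its second half is \<open>catalan_const / 2\<close>, and reflection repeats this value beyond
  \<open>pi/2\<close>. Rescaling by 2/3 and by 2 produces \<open>1/3 + 1 = 4/3\<close>.\<close>

lemma ln_one_plus_two_cos_integral:
  "((\<lambda>u. ln (1 + 2 * cos u)) has_integral 4 / 3 * catalan_const) {0..pi/2}"
proof -
  let ?L = "\<lambda>v. ln (2 * sin v)"
  have "?L integrable_on {pi/4..pi/2}"
    by (rule integrable_on_subinterval[OF has_integral_integrable[OF ln_two_sin_integral]]) auto
  then obtain J where J: "(?L has_integral J) {pi/4..pi/2}"
    unfolding integrable_on_def by blast
  have "(?L has_integral - catalan_const / 2 + J) {0..pi/2}"
    by (rule has_integral_combine[OF _ _ ln_two_sin_quarter J]) auto
  then have J_eq: "J = catalan_const / 2"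
    using has_integral_unique[OF ln_two_sin_integral] by fastforce
  have "((\<lambda>v. ln (2 * sin (pi - v))) has_integral J) {pi/2..3*pi/4}"
    by (rule has_integral_reflect_interval[OF J]) auto
  then have J2: "(?L has_integral J) {pi/2..3*pi/4}" by simp
  have "(?L has_integral 0 + J) {0..3*pi/4}"
    by (rule has_integral_combine[OF _ _ ln_two_sin_integral J2]) auto
  then have "(?L has_integral catalan_const / 2) {0..3*pi/4}" by (simp add: J_eq)
  from has_integral_affinity'[of ?L "catalan_const / 2" 0 "3*pi/4" "3/2" 0] this
  have 1: "((\<lambda>u. ln (2 * sin (3/2 * u))) has_integral catalan_const / 3) {0..pi/2}"
    by simp
  from has_integral_affinity'[of ?L "- catalan_const / 2" 0 "pi/4" "1/2" 0] ln_two_sin_quarter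
  have 2: "((\<lambda>u. ln (2 * sin (1/2 * u))) has_integral - catalan_const) {0..pi/2}"
    by simp
  have "((\<lambda>u. ln (2 * sin (3/2 * u)) - ln (2 * sin (1/2 * u))) has_integral catalan_const / 3 - - catalan_const) {0..pi/2}"
    by (intro has_integral_diff 1 2)
  then have "((\<lambda>u. ln (1 + 2 * cos u)) has_integral catalan_const / 3 - - catalan_const) {0..pi/2}"
  proof (rule has_integral_spike_finite[where S = "{0}", rotated 2])
    fix u :: real assume u: "u \<in> {0..pi/2} - {0}"
    define v where "v = u / 2"
    have s: "sin v > 0" using u by (auto simp: v_def intro!: sin_gt_zero)
    have c: "1 + 2 * cos u > 0" using u cos_ge_zero[of u] by auto
    have "sin (3/2 * u) = sin (2 * v + v)" by (simp add: v_def)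
    also have "\<dots> = sin v * (1 + 2 * cos (2 * v))"
      unfolding sin_add sin_double cos_double_cos
      by (simp add: algebra_simps power2_eq_square)
    finally have "2 * sin (3/2 * u) = 2 * sin v * (1 + 2 * cos u)" by (simp add: v_def)
    then show "ln (1 + 2 * cos u) = ln (2 * sin (3/2 * u)) - ln (2 * sin (1/2 * u))"
      using s c by (simp add: ln_mult v_def)
  qed auto
  then show ?thesis by simp
qed

section \<open>Mahler measures as iterated integrals\<close>

definition monom_eval :: "(nat \<Rightarrow>\<^sub>0 int) \<Rightarrow> (nat \<Rightarrow> complex) \<Rightarrow> complex" where
  "monom_eval m w = (\<Prod>i\<in>Poly_Mapping.keys m. w i powi Poly_Mapping.lookup m i)"

lemma monom_eval_superset:
  assumes "finite S" "Poly_Mapping.keys m \<subseteq> S"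
  shows "monom_eval m w = (\<Prod>i\<in>S. w i powi Poly_Mapping.lookup m i)"
  unfolding monom_eval_def using assms
  by (intro prod.mono_neutral_left) (auto simp: in_keys_iff)

lemma monom_eval_add:
  assumes "\<And>i. w i \<noteq> 0"
  shows "monom_eval (a + b) w = monom_eval a w * monom_eval b w"
proof -
  let ?S = "Poly_Mapping.keys a \<union> Poly_Mapping.keys b"
  have "monom_eval (a + b) w = (\<Prod>i\<in>?S. w i powi Poly_Mapping.lookup (a + b) i)"
    by (rule monom_eval_superset) (use Poly_Mapping.keys_add[of a b] in auto)
  also have "\<dots> = (\<Prod>i\<in>?S. w i powi Poly_Mapping.lookup a i) * (\<Prod>i\<in>?S. w i powi Poly_Mapping.lookup b i)"
    using assms by (simp add: lookup_add power_int_add prod.distrib)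
  also have "\<dots> = monom_eval a w * monom_eval b w"
    by (simp add: monom_eval_superset[of ?S])
  finally show ?thesis .
qed

lemma laurent_eval_superset:
  assumes "finite S" "Poly_Mapping.keys P \<subseteq> S"
  shows "laurent_eval P w = (\<Sum>m\<in>S. Poly_Mapping.lookup P m * monom_eval m w)"
  unfolding laurent_eval_def monom_eval_def[symmetric] using assms
  by (intro sum.mono_neutral_left) (auto simp: in_keys_iff)

lemma laurent_eval_add: "laurent_eval (P + Q) w = laurent_eval P w + laurent_eval Q w"
proof -
  let ?S = "Poly_Mapping.keys P \<union> Poly_Mapping.keys Q"
  have "laurent_eval (P + Q) w = (\<Sum>m\<in>?S. Poly_Mapping.lookup (P + Q) m * monom_eval m w)"
    by (rule laurent_eval_superset) (use Poly_Mapping.keys_add[of P Q] in auto)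
  also have "\<dots> = laurent_eval P w + laurent_eval Q w"
    by (simp add: laurent_eval_superset[of ?S] lookup_add ring_distribs sum.distrib)
  finally show ?thesis .
qed

lemma laurent_eval_single: "laurent_eval (Poly_Mapping.single m c) w = c * monom_eval m w"
  by (subst laurent_eval_superset[of "{m}"]) auto

lemma laurent_eval_0: "laurent_eval 0 w = 0"
  by (simp add: laurent_eval_def)

lemma laurent_eval_sum: "laurent_eval (sum f A) w = (\<Sum>a\<in>A. laurent_eval (f a) w)"
  by (induction A rule: infinite_finite_induct) (auto simp: laurent_eval_0 laurent_eval_add)

lemma laurent_eq_sum_monomials:
  fixes P :: laurent
  shows "P = (\<Sum>m\<in>Poly_Mapping.keys P. Poly_Mapping.single m (Poly_Mapping.lookup P m))"
proof (rule poly_mapping_eqI)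
  fix k
  show "Poly_Mapping.lookup P k =
      Poly_Mapping.lookup (\<Sum>m\<in>Poly_Mapping.keys P. Poly_Mapping.single m (Poly_Mapping.lookup P m)) k"
    by (simp add: lookup_sum lookup_single when_def sum.delta in_keys_iff)
qed

lemma laurent_eval_mult:
  assumes "\<And>i. w i \<noteq> 0"
  shows "laurent_eval (P * Q) w = laurent_eval P w * laurent_eval Q w"
proof -
  let ?c = Poly_Mapping.lookup
  have "P * Q = (\<Sum>m\<in>Poly_Mapping.keys P. \<Sum>n\<in>Poly_Mapping.keys Q.
      Poly_Mapping.single (m + n) (?c P m * ?c Q n))"
    by (subst laurent_eq_sum_monomials[of P], subst laurent_eq_sum_monomials[of Q])
       (simp add: sum_product mult_single)
  then have "laurent_eval (P * Q) w = (\<Sum>m\<in>Poly_Mapping.keys P. \<Sum>n\<in>Poly_Mapping.keys Q.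
      (?c P m * monom_eval m w) * (?c Q n * monom_eval n w))"
    by (simp add: laurent_eval_sum laurent_eval_single monom_eval_add[OF assms] mult_ac)
  also have "\<dots> = laurent_eval P w * laurent_eval Q w"
    by (simp add: laurent_eval_superset[OF finite_keys order_refl] sum_product)
  finally show ?thesis .
qed

lemma laurent_eval_diff: "laurent_eval (P - Q) w = laurent_eval P w - laurent_eval Q w"
  using laurent_eval_add[of "P - Q" Q w] by simp

lemma laurent_eval_1: "laurent_eval 1 w = 1"
  by (subst single_one[symmetric], subst laurent_eval_single) (simp add: monom_eval_def)

lemma laurent_eval_numeral: "laurent_eval (numeral n) w = numeral n"
  by (subst single_numeral[symmetric], subst laurent_eval_single) (simp add: monom_eval_def)

lemma laurent_eval_power:
  assumes "\<And>i. w i \<noteq> 0"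
  shows "laurent_eval (P ^ n) w = laurent_eval P w ^ n"
  by (induction n) (auto simp: laurent_eval_1 laurent_eval_mult[OF assms])

lemma laurent_eval_monom: "laurent_eval (laurent_monom i k) w = w i powi k"
  by (cases "k = 0") (auto simp: laurent_monom_def laurent_eval_single monom_eval_def laurent_eval_1)

lemma cmod_laurent_eval_le:
  assumes "\<And>i. cmod (w i) = 1"
  shows "cmod (laurent_eval P w) \<le> (\<Sum>m\<in>Poly_Mapping.keys P. cmod (Poly_Mapping.lookup P m))"
proof -
  have "cmod (monom_eval m w) = 1" for m
    by (simp add: monom_eval_def norm_power_int assms flip: prod_norm)
  then show ?thesis
    by (simp add: laurent_eval_superset[OF finite_keys order_refl] norm_mult sum_norm_le)
qed

text \<open>The rules with a nonvanishing side condition, specialised to points of the torus so that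
  they rewrite unconditionally.\<close>

lemma laurent_eval_unit_circ:
  fixes t :: "nat \<Rightarrow> real"
  defines "w \<equiv> \<lambda>n. unit_circ (t n)"
  shows "laurent_eval (P * Q) w = laurent_eval P w * laurent_eval Q w"
    "laurent_eval (P ^ n) w = laurent_eval P w ^ n"
  by (simp_all add: w_def laurent_eval_mult laurent_eval_power)

lemmas laurent_eval_simps = laurent_eval_add laurent_eval_diff laurent_eval_unit_circ laurent_eval_1
  laurent_eval_numeral laurent_eval_monom

section \<open>From the integral over the cube to iterated integrals\<close>

lemma nn_integral_has_integral_AE:
  fixes f :: "real \<Rightarrow> real"
  assumes "AE x in lborel. x \<in> S \<longrightarrow> 0 \<le> f x" and I: "(f has_integral I) S"
  shows "(\<integral>\<^sup>+x. ennreal (f x) * indicator S x \<partial>lborel) = ennreal I" "0 \<le> I"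
proof -
  have "((\<lambda>x. max 0 (f x)) has_integral I) S \<longleftrightarrow> (f has_integral I) S"
  proof (rule has_integral_AE)
    show "AE x in lborel. x \<in> S \<longrightarrow> max 0 (f x) = f x"
      using assms(1) by eventually_elim auto
  qed
  then have I': "((\<lambda>x. max 0 (f x)) has_integral I) S" using I by simp
  then show "0 \<le> I" by (rule has_integral_nonneg) auto
  have "(\<integral>\<^sup>+x. ennreal (f x) * indicator S x \<partial>lborel) = (\<integral>\<^sup>+x. ennreal (max 0 (f x)) * indicator S x \<partial>lborel)"
    by (intro nn_integral_cong) (auto simp: max_def ennreal_neg)
  also have "\<dots> = ennreal I" by (intro nn_integral_has_integral_lebesgue' I') auto
  finally show "(\<integral>\<^sup>+x. ennreal (f x) * indicator S x \<partial>lborel) = ennreal I" .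
qed

text \<open>On the torus \<open>\<bar>P\<bar>\<close> is at most the sum \<open>K\<close> of the
  moduli of its coefficients, so \<open>K - ln \<bar>P\<bar>\<close> is nonnegative and Tonelli
  applies although the logarithm is unbounded below near zeros. The indices \<open>i\<close>,
  \<open>j\<close>, \<open>k\<close> allow any variable to be innermost. The inner evaluations are
  required almost everywhere only, because for special values of the other variables the polynomial
  may vanish identically.\<close>

theorem mahler_measure_iterated:
  assumes ijk: "{i, j, k} = {..<3::nat}" "i \<noteq> j" "i \<noteq> k" "j \<noteq> k"
    and F: "\<And>\<theta>. ln (cmod (laurent_eval P (\<lambda>n. unit_circ (\<theta> n)))) = F (\<theta> i) (\<theta> j) (\<theta> k)"
    and meas: "(\<lambda>(x, y, z). F x y z) \<in> borel_measurable (borel \<Otimes>\<^sub>M borel \<Otimes>\<^sub>M borel)"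
    and inner: "AE x in lborel. AE y in lborel. x \<in> {0..1} \<longrightarrow> y \<in> {0..1} \<longrightarrow> (F x y has_integral J1 x y) {0..1}"
    and middle: "AE x in lborel. x \<in> {0..1} \<longrightarrow> (J1 x has_integral J2 x) {0..1}"
    and outer: "(J2 has_integral J) {0..1}"
  shows "mahler_measure 3 P = J"
proof -
  interpret product_sigma_finite "\<lambda>_::nat. lborel :: real measure"
    by (intro product_sigma_finite.intro lborel.sigma_finite_measure_axioms)
  define K where "K = (\<Sum>m\<in>Poly_Mapping.keys P. cmod (Poly_Mapping.lookup P m))"
  have K0: "0 \<le> K" by (simp add: K_def sum_nonneg)
  have FK: "F x y z \<le> K" for x y z
  proof -
    define \<theta> where "\<theta> = ((\<lambda>_. 0)(i := x, j := y, k := z))"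
    have \<theta>: "\<theta> i = x" "\<theta> j = y" "\<theta> k = z" using ijk by (auto simp: \<theta>_def)
    let ?m = "cmod (laurent_eval P (\<lambda>n. unit_circ (\<theta> n)))"
    have "?m \<le> K" unfolding K_def by (rule cmod_laurent_eval_le) simp
    moreover have "ln ?m \<le> ?m" if "?m > 0" using ln_le_minus_one[OF that] by simp
    \<comment> \<open>A zero of the polynomial is a separate case: there \<open>ln 0 = 0\<close>,
      which is at most \<open>K\<close> because \<open>K\<close> is nonnegative.\<close>
    ultimately have "ln ?m \<le> K" using K0 by (cases "?m = 0") auto
    then show ?thesis using F[of \<theta>] \<theta> by simp
  qed
  define M where "M = PiM {..<3::nat} (\<lambda>_. lborel :: real measure)"
  define E where "E = ({..<3::nat} \<rightarrow>\<^sub>E {0..1::real})"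
  define I where "I = (indicator {0..1} :: real \<Rightarrow> ennreal)"
  define f where "f \<theta> = ennreal (K - F (\<theta> i) (\<theta> j) (\<theta> k)) * I (\<theta> k) * I (\<theta> j) * I (\<theta> i)" for \<theta> :: "nat \<Rightarrow> real"
  have [measurable]: "(\<lambda>(x, y, z). F x y z) \<in> borel_measurable (borel \<Otimes>\<^sub>M borel \<Otimes>\<^sub>M borel)" by (rule meas)
  have F3 [measurable (raw)]: "(\<lambda>w. F (a w) (b w) (c w)) \<in> borel_measurable N"
    if [measurable]: "a \<in> borel_measurable N" "b \<in> borel_measurable N" "c \<in> borel_measurable N" for a b c :: "'z \<Rightarrow> real" and N
  proof -
    have "(\<lambda>w. (\<lambda>(x, y, z). F x y z) (a w, b w, c w)) \<in> borel_measurable N" by measurable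
    then show ?thesis by simp
  qed
  have [measurable]: "I \<in> borel_measurable borel" unfolding I_def by measurable
  have set3: "{..<3::nat} = insert k {j, i}" using ijk by auto
  have "(\<integral>\<^sup>+\<theta>. f \<theta> \<partial>M) = (\<integral>\<^sup>+\<theta>. \<integral>\<^sup>+z. f (\<theta>(k := z)) \<partial>lborel \<partial>PiM {j, i} (\<lambda>_. lborel))"
    unfolding M_def set3 f_def using ijk by (intro product_nn_integral_insert) auto
  also have "\<dots> = (\<integral>\<^sup>+\<theta>. (\<integral>\<^sup>+z. ennreal (K - F (\<theta> i) (\<theta> j) z) * I z * I (\<theta> j) * I (\<theta> i) \<partial>lborel) \<partial>PiM {j, i} (\<lambda>_. lborel))"
    using ijk by (simp add: f_def)
  also have "\<dots> = (\<integral>\<^sup>+\<theta>. \<integral>\<^sup>+y. (\<integral>\<^sup>+z. ennreal (K - F (\<theta> i) y z) * I z * I y * I (\<theta> i) \<partial>lborel) \<partial>lborel \<partial>PiM {i} (\<lambda>_. lborel))"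
    using ijk by (subst product_nn_integral_insert) auto
  also have "\<dots> = (\<integral>\<^sup>+x. \<integral>\<^sup>+y. \<integral>\<^sup>+z. ennreal (K - F x y z) * I z * I y * I x \<partial>lborel \<partial>lborel \<partial>lborel)"
    by (rule product_nn_integral_singleton[where f = "\<lambda>x. \<integral>\<^sup>+y. \<integral>\<^sup>+z. ennreal (K - F x y z) * I z * I y * I x \<partial>lborel \<partial>lborel"]) measurable
  finally have f_iter: "(\<integral>\<^sup>+\<theta>. f \<theta> \<partial>M) =
    (\<integral>\<^sup>+x. \<integral>\<^sup>+y. \<integral>\<^sup>+z. ennreal (K - F x y z) * I z * I y * I x \<partial>lborel \<partial>lborel \<partial>lborel)" .
  have diff: "((\<lambda>z. K - g z) has_integral K - c) {0..1}" if "(g has_integral c) {0..1}" for g :: "real \<Rightarrow> real" and c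
    using has_integral_diff[OF has_integral_const_real[of K 0 1] that] by simp
  have AE_J2: "AE x in lborel. (x \<in> {0..1} \<longrightarrow> 0 \<le> K - J2 x) \<and>
      (\<integral>\<^sup>+y. \<integral>\<^sup>+z. ennreal (K - F x y z) * I z * I y * I x \<partial>lborel \<partial>lborel) = ennreal (K - J2 x) * indicator {0..1} x"
    using inner middle
  proof eventually_elim
    case (elim x)
    show ?case
    proof (cases "x \<in> {0..1}")
      case True
      have in1: "(\<integral>\<^sup>+z. ennreal (K - F x y z) * I z \<partial>lborel) = ennreal (K - J1 x y)" "0 \<le> K - J1 x y"
        if "(F x y has_integral J1 x y) {0..1}" for y
        using nn_integral_has_integral_AE[OF _ diff[OF that]] FK by (auto simp: I_def)
      have nonneg: "AE y in lborel. y \<in> {0..1} \<longrightarrow> 0 \<le> K - J1 x y"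
        using elim(1) by eventually_elim (use True in1(2) in auto)
      have "(\<integral>\<^sup>+y. \<integral>\<^sup>+z. ennreal (K - F x y z) * I z * I y * I x \<partial>lborel \<partial>lborel)
          = (\<integral>\<^sup>+y. ennreal (K - J1 x y) * indicator {0..1} y \<partial>lborel)"
      proof (rule nn_integral_cong_AE)
        show "AE y in lborel. (\<integral>\<^sup>+z. ennreal (K - F x y z) * I z * I y * I x \<partial>lborel) = ennreal (K - J1 x y) * indicator {0..1} y"
          using elim(1)
        proof eventually_elim
          case (elim y)
          then show ?case using True in1(1)[of y]
            by (cases "y \<in> {0..1}") (auto simp: I_def)
        qed
      qed
      also have "\<dots> = ennreal (K - J2 x)"
        using elim(2) True by (intro nn_integral_has_integral_AE(1)[OF nonneg] diff) auto
      finally show ?thesis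
        using True nn_integral_has_integral_AE(2)[OF nonneg diff] elim(2) by simp
    qed (auto simp: I_def)
  qed
  have nonneg: "AE x in lborel. x \<in> {0..1} \<longrightarrow> 0 \<le> K - J2 x"
    using AE_J2 by eventually_elim auto
  have "(\<integral>\<^sup>+\<theta>. f \<theta> \<partial>M) = (\<integral>\<^sup>+x. ennreal (K - J2 x) * indicator {0..1} x \<partial>lborel)"
    unfolding f_iter by (rule nn_integral_cong_AE) (use AE_J2 in \<open>eventually_elim, auto\<close>)
  also have "\<dots> = ennreal (K - J)"
    by (rule nn_integral_has_integral_AE(1)[OF nonneg diff[OF outer]])
  finally have fJ: "(\<integral>\<^sup>+\<theta>. f \<theta> \<partial>M) = ennreal (K - J)" .
  have KJ: "0 \<le> K - J" by (rule nn_integral_has_integral_AE(2)[OF nonneg diff[OF outer]])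
  have E: "E \<in> sets M" unfolding E_def M_def by (intro sets_PiM_I_finite) auto
  have "emeasure M E = 1"
    unfolding E_def M_def by (subst emeasure_PiM) auto
  then have int_E: "has_bochner_integral M (\<lambda>\<theta>. indicator E \<theta> *\<^sub>R K) K"
    using has_bochner_integral_scaleR_left[OF has_bochner_integral_real_indicator[OF E], of K]
    by (simp add: measure_def)
  define h where "h \<theta> = indicator E \<theta> *\<^sub>R (K - F (\<theta> i) (\<theta> j) (\<theta> k))" for \<theta> :: "nat \<Rightarrow> real"
  have ik: "i \<in> {..<3}" "j \<in> {..<3}" "k \<in> {..<3}" using ijk(1) by auto
  have h_meas: "h \<in> borel_measurable M"
  proof -
    have [measurable]: "(\<lambda>\<theta>. \<theta> i) \<in> borel_measurable M" "(\<lambda>\<theta>. \<theta> j) \<in> borel_measurable M" "(\<lambda>\<theta>. \<theta> k) \<in> borel_measurable M"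
      using ik[THEN measurable_component_singleton, of "\<lambda>_. lborel :: real measure"] by (simp_all add: M_def)
    show ?thesis unfolding h_def using E by measurable
  qed
  have "has_bochner_integral M h (K - J)"
  proof (rule has_bochner_integral_nn_integral[OF h_meas _ KJ])
    show "AE \<theta> in M. 0 \<le> h \<theta>" using FK by (simp add: h_def)
    have "(\<integral>\<^sup>+\<theta>. ennreal (h \<theta>) \<partial>M) = (\<integral>\<^sup>+\<theta>. f \<theta> \<partial>M)"
    proof (rule nn_integral_cong)
      fix \<theta> assume "\<theta> \<in> space M"
      then have "\<theta> \<in> E \<longleftrightarrow> (\<forall>n\<in>{i,j,k}. \<theta> n \<in> {0..1})"
        unfolding ijk(1) by (auto simp: M_def E_def space_PiM PiE_iff)
      then show "ennreal (h \<theta>) = f \<theta>"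
        by (auto simp: h_def f_def I_def indicator_def)
    qed
    then show "(\<integral>\<^sup>+\<theta>. ennreal (h \<theta>) \<partial>M) = ennreal (K - J)" by (simp add: fJ)
  qed
  from has_bochner_integral_diff[OF int_E this]
  have "has_bochner_integral M (\<lambda>\<theta>. indicator E \<theta> *\<^sub>R F (\<theta> i) (\<theta> j) (\<theta> k)) J"
    by (simp add: h_def algebra_simps)
  then have "integral\<^sup>L M (\<lambda>\<theta>. indicator E \<theta> *\<^sub>R F (\<theta> i) (\<theta> j) (\<theta> k)) = J"
    by (rule has_bochner_integral_integral_eq)
  moreover have "exp (2 * complex_of_real pi * \<i> * complex_of_real t) = unit_circ t" for t
    by (simp add: unit_circ_def cis_conv_exp mult_ac)
  ultimately show ?thesis
    by (simp add: mahler_measure_def set_lebesgue_integral_def F M_def E_def)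
qed

section \<open>The five identities\<close>

abbreviation modulus_at :: "real \<Rightarrow> real" where
  "modulus_at t \<equiv> 2 * \<bar>cos (pi * t)\<bar>"

section \<open>Averages over the second variable\<close>

lemma cmod_add_unit_circ_phase:
  "\<exists>\<phi>. \<forall>t. (cmod (w + unit_circ t))\<^sup>2 = (cmod w)\<^sup>2 + 1 + 2 * cmod w * cos (2 * pi * (t + \<phi>))
    \<and> (cmod (w - unit_circ t))\<^sup>2 = (cmod w)\<^sup>2 + 1 - 2 * cmod w * cos (2 * pi * (t + \<phi>))"
proof -
  obtain \<psi> where w: "w = of_real (cmod w) * unit_circ \<psi>" using unit_circ_polar by blast
  define r where "r = cmod w"
  \<comment> \<open>\<open>s\<close> is the sign. Rotating \<open>w\<close> to the positive axis
    gives both signs the same phase, so that the larger of the two moduli can be described by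
    \<open>\<bar>cos\<bar>\<close>.\<close>
  have *: "(cmod (w + of_real s * unit_circ t))\<^sup>2 = r\<^sup>2 + 1 + s * (2 * r * cos (2 * pi * (t + - \<psi>)))"
    if s: "s\<^sup>2 = 1" for s t
  proof -
    have "w + of_real s * unit_circ t = unit_circ \<psi> * (of_real r + of_real s * unit_circ (t + - \<psi>))"
      using w unit_circ_add[of "t + - \<psi>" \<psi>] by (simp add: r_def algebra_simps)
    then have "(cmod (w + of_real s * unit_circ t))\<^sup>2 = (cmod (of_real r + of_real s * unit_circ (t + - \<psi>)))\<^sup>2"
      by (simp add: norm_mult)
    also have "\<dots> = (r + s * cos (2 * pi * (t + - \<psi>)))\<^sup>2 + (s * sin (2 * pi * (t + - \<psi>)))\<^sup>2"
      by (simp add: cmod_power2 unit_circ_def)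
    also have "\<dots> = r\<^sup>2 + 1 + s * (2 * r * cos (2 * pi * (t + - \<psi>)))"
    proof -
      have "(r + s * c)\<^sup>2 + (s * d)\<^sup>2 = r\<^sup>2 + 1 + s * (2 * r * c)" if "c\<^sup>2 + d\<^sup>2 = 1" for c d :: real
        using that s by algebra
      then show ?thesis by (metis sin_cos_squared_add2 power2_eq_square sin_cos_squared_add)
    qed
    finally show ?thesis .
  qed
  show ?thesis using *[of 1] *[of "-1"] unfolding r_def by (intro exI[of _ "- \<psi>"]) simp
qed

lemma has_integral_shifted_cos:
  assumes "((\<lambda>t. g (cos (2 * pi * t))) has_integral I) {0..1}"
  shows "((\<lambda>t. g (cos (2 * pi * (t + \<phi>))) :: real) has_integral I) {0..1}"
  by (rule has_integral_periodic_shift[where f = "\<lambda>t. g (cos (2 * pi * t))"])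
     (use assms in \<open>auto simp: ring_distribs\<close>)

lemma ln_quadratic_abs_cos_mean:
  assumes "0 \<le> r"
  shows "((\<lambda>t. ln (r\<^sup>2 + 1 + 2 * r * \<bar>cos (2 * pi * (t + \<phi>))\<bar>)) has_integral 4 / pi * arctan_int r) {0..1}"
  using has_integral_abs_cos_double[OF ln_quadratic_cos_integral[OF assms]]
  by (intro has_integral_shifted_cos[where g = "\<lambda>c. ln (r\<^sup>2 + 1 + 2 * r * \<bar>c\<bar>)"]) simp

text \<open>A half turn reverses the cosine, so of the positive parts at \<open>t\<close> and
  \<open>t + 1/2\<close> one is 0 and the other is \<open>\<bar>cos\<bar>\<close>. Twice the mean is
  thus the mean with \<open>\<bar>cos\<bar>\<close> plus \<open>ln (r\<^sup>2 + 1)\<close>.\<close>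

lemma ln_quadratic_max_cos_mean:
  assumes r: "0 \<le> r"
  shows "((\<lambda>t. ln (r\<^sup>2 + 1 + 2 * r * max 0 (cos (2 * pi * (t + \<phi>))))) has_integral
    2 / pi * arctan_int r + ln (r\<^sup>2 + 1) / 2) {0..1}"
proof (rule has_integral_shifted_cos[where g = "\<lambda>c. ln (r\<^sup>2 + 1 + 2 * r * max 0 c)"])
  define p where "p = (\<lambda>t. ln (r\<^sup>2 + 1 + 2 * r * max 0 (cos (2 * pi * t))))"
  have pos: "0 < r\<^sup>2 + 1 + 2 * r * max 0 c" for c
    using r by (intro add_pos_nonneg add_nonneg_pos mult_nonneg_nonneg) auto
  have "p integrable_on {0..1}"
    unfolding p_def by (intro integrable_continuous_interval continuous_intros) (metis less_irrefl pos)
  then obtain I where I: "(p has_integral I) {0..1}" unfolding integrable_on_def by blast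
  have "((\<lambda>t. p (t + 1/2)) has_integral I) {0..1}"
    by (rule has_integral_periodic_shift[OF _ I]) (simp add: p_def ring_distribs)
  from has_integral_add[OF I this]
  have 1: "((\<lambda>t. p t + p (t + 1/2)) has_integral I + I) {0..1}" .
  have "p t + p (t + 1/2) = ln (r\<^sup>2 + 1 + 2 * r * \<bar>cos (2 * pi * (t + 0))\<bar>) + ln (r\<^sup>2 + 1)" for t
  proof -
    have "cos (2 * pi * (t + 1/2)) = - cos (2 * pi * t)" by (simp add: ring_distribs)
    then show ?thesis by (auto simp: p_def max_def abs_if)
  qed
  with 1 have 1: "((\<lambda>t. ln (r\<^sup>2 + 1 + 2 * r * \<bar>cos (2 * pi * (t + 0))\<bar>) + ln (r\<^sup>2 + 1)) has_integral I + I) {0..1}"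
    by simp
  have 2: "((\<lambda>t. ln (r\<^sup>2 + 1 + 2 * r * \<bar>cos (2 * pi * (t + 0))\<bar>) + ln (r\<^sup>2 + 1)) has_integral 4 / pi * arctan_int r + ln (r\<^sup>2 + 1)) {0..1}"
    using has_integral_add[OF ln_quadratic_abs_cos_mean[OF r, of 0] has_integral_const_real[of "ln (r\<^sup>2 + 1)" 0 1]] by simp
  have "I = 2 / pi * arctan_int r + ln (r\<^sup>2 + 1) / 2"
    using has_integral_unique[OF 1 2] by simp
  with I show "((\<lambda>t. ln (r\<^sup>2 + 1 + 2 * r * max 0 (cos (2 * pi * t)))) has_integral 2 / pi * arctan_int r + ln (r\<^sup>2 + 1) / 2) {0..1}"
    by (simp add: p_def)
qed

lemma arctan_int_modulus_mean:
  "((\<lambda>t. arctan_int (modulus_at t)) has_integral 14 / (5 * pi) * zeta 3) {0..1}"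
  using has_integral_abs_cos[OF arctan_int_mean] by (simp add: mult_ac)

lemma modulus_at_eq: "cmod (1 + unit_circ t) = modulus_at t"
  by (rule cmod_one_plus_unit_circ)

lemma unit_circ_inverse: "inverse (unit_circ t) = cnj (unit_circ t)"
  by (rule inverse_unique) (simp add: complex_norm_square[symmetric])

lemma one_plus_unit_circ_sq: "(1 + unit_circ t)\<^sup>2 = unit_circ t * of_real ((modulus_at t)\<^sup>2)"
proof -
  have u: "unit_circ t * cnj (unit_circ t) = 1" by (simp add: complex_norm_square[symmetric])
  have "of_real ((modulus_at t)\<^sup>2) = (1 + unit_circ t) * cnj (1 + unit_circ t)"
    unfolding modulus_at_eq[symmetric] complex_norm_square ..
  then have "unit_circ t * of_real ((modulus_at t)\<^sup>2) = (1 + unit_circ t) * (unit_circ t + unit_circ t * cnj (unit_circ t))"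
    by (simp add: algebra_simps)
  then show ?thesis by (simp add: u power2_eq_square add.commute)
qed

lemma one_minus_unit_circ_sq: "(1 - unit_circ t)\<^sup>2 = unit_circ t * of_real ((modulus_at t)\<^sup>2 - 4)"
proof -
  have "(1 - unit_circ t)\<^sup>2 = (1 + unit_circ t)\<^sup>2 - 4 * unit_circ t"
    by (simp add: power2_eq_square algebra_simps)
  then show ?thesis unfolding one_plus_unit_circ_sq by (simp add: algebra_simps)
qed

lemma continuous_max_modulus:
  fixes w :: "'a::topological_space \<Rightarrow> complex"
  assumes "continuous_on A w"
  shows "continuous_on A (\<lambda>p. ln (max (cmod (1 + w p)) (cmod (1 - w p))))"
proof -
  have "0 < max (cmod (1 + v)) (cmod (1 - v))" for v :: complex
  proof -
    have "(1 + v) + (1 - v) \<noteq> 0" by simp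
    then have "1 + v \<noteq> 0 \<or> 1 - v \<noteq> 0" by (metis add_0)
    then show ?thesis by (auto simp: less_max_iff_disj)
  qed
  then have "max (cmod (1 + v)) (cmod (1 - v)) \<noteq> 0" for v :: complex by (metis less_irrefl)
  then show ?thesis using assms by (intro continuous_intros) auto
qed

lemma ln_max_plus_minus:
  "\<exists>\<phi>. \<forall>t. ln (max ((cmod (w + unit_circ t))\<^sup>2) ((cmod (w - unit_circ t))\<^sup>2)) =
     ln ((cmod w)\<^sup>2 + 1 + 2 * cmod w * \<bar>cos (2 * pi * (t + \<phi>))\<bar>)"
proof -
  obtain \<phi> where \<phi>: "\<And>t. (cmod (w + unit_circ t))\<^sup>2 = (cmod w)\<^sup>2 + 1 + 2 * cmod w * cos (2 * pi * (t + \<phi>))"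
    "\<And>t. (cmod (w - unit_circ t))\<^sup>2 = (cmod w)\<^sup>2 + 1 - 2 * cmod w * cos (2 * pi * (t + \<phi>))"
    using cmod_add_unit_circ_phase by blast
  have "max (a + b * c) (a - b * c) = a + b * \<bar>c\<bar>" if "0 \<le> b" for a b c :: real
    using that by (auto simp: max_def abs_if mult_le_0_iff zero_le_mult_iff)
  then show ?thesis unfolding \<phi> by (intro exI[of _ \<phi>]) simp
qed

text \<open>In \<open>x\<close> the coefficients are \<open>1 + w\<close> and \<open>1 - w\<close>
  with \<open>w = y + z\<close>. Rotating \<open>y\<close> by \<open>z\<close> turns
  \<open>w\<close> into \<open>z * (1 + y)\<close>, and the average over \<open>z\<close> then
  depends on \<open>\<bar>1 + y\<bar>\<close> alone. The exchange of the two outer integrals uses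
  continuity: \<open>1 + w\<close> and \<open>1 - w\<close> never vanish together.\<close>

lemma mahler_measure_bilinear: "mahler_measure 3 ((1 + X) + (1 - X) * (Y + Z)) = 28 / (5 * pi ^ 2) * zeta 3"
proof -
  define L where "L w = ln (max (cmod (1 + w)) (cmod (1 - w)))" for w :: complex
  define F where "F z y x = ln (cmod ((1 + (unit_circ y + unit_circ z)) + (1 - (unit_circ y + unit_circ z)) * unit_circ x))" for z y x
  define J1 where "J1 z y = L (unit_circ y + unit_circ z)" for z y
  define G where "G z y = L (unit_circ z * (1 + unit_circ y))" for z y
  have G_cont: "continuous_on A (\<lambda>p. G (f p) (g p))" if "continuous_on A f" "continuous_on A g" for A :: "'a::topological_space set" and f g
    unfolding G_def L_def using that by (intro continuous_max_modulus continuous_intros)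
  have inner: "(F z y has_integral J1 z y) {0..1}" for z y
  proof -
    let ?w = "unit_circ y + unit_circ z"
    have "(1 + ?w) + (1 - ?w) \<noteq> 0" by simp
    then have "1 + ?w \<noteq> 0 \<or> 1 - ?w \<noteq> 0" by (metis add_0)
    then show ?thesis unfolding F_def J1_def L_def by (rule jensen_linear)
  qed
  have middle: "(J1 z has_integral integral {0..1} (G z)) {0..1}" for z
  proof -
    have "(G z has_integral integral {0..1} (G z)) {0..1}"
      by (intro integrable_integral integrable_continuous_interval G_cont continuous_intros)
    then have "((\<lambda>y. G z (y + - z)) has_integral integral {0..1} (G z)) {0..1}"
      by (rule has_integral_periodic_shift[rotated]) (simp add: G_def)
    moreover have "G z (y + - z) = J1 z y" for y
      using unit_circ_add[of z "y + - z"] by (simp add: G_def J1_def ring_distribs add.commute)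
    ultimately show ?thesis by simp
  qed
  have Gz: "((\<lambda>z. G z y) has_integral 2 / pi * arctan_int (modulus_at y)) {0..1}" for y
  proof -
    define w where "w = cnj (1 + unit_circ y)"
    obtain \<phi> where \<phi>: "\<And>t. ln (max ((cmod (w + unit_circ t))\<^sup>2) ((cmod (w - unit_circ t))\<^sup>2)) =
       ln ((cmod w)\<^sup>2 + 1 + 2 * cmod w * \<bar>cos (2 * pi * (t + \<phi>))\<bar>)"
      using ln_max_plus_minus by blast
    have w: "cmod w = modulus_at y" unfolding w_def complex_mod_cnj modulus_at_eq ..
    \<comment> \<open>Multiplying the conjugate of
      \<open>1 + unit_circ z * (1 + unit_circ y)\<close> by \<open>unit_circ z\<close> moves the
      phase to the summand of modulus 1; the division by 2 undoes the squares of the moduli.\<close>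
    have eqG: "G z y = ln ((cmod w)\<^sup>2 + 1 + 2 * cmod w * \<bar>cos (2 * pi * (z + \<phi>))\<bar>) / 2" for z
    proof -
      have u: "unit_circ z * cnj (unit_circ z) = 1" by (simp add: complex_norm_square[symmetric])
      have "w + unit_circ z = unit_circ z * cnj (1 + unit_circ z * (1 + unit_circ y))"
        "w - unit_circ z = - (unit_circ z * cnj (1 - unit_circ z * (1 + unit_circ y)))"
      proof -
        have "unit_circ z * cnj (1 + unit_circ z * (1 + unit_circ y)) = unit_circ z + (unit_circ z * cnj (unit_circ z)) * w"
          "unit_circ z * cnj (1 - unit_circ z * (1 + unit_circ y)) = unit_circ z - (unit_circ z * cnj (unit_circ z)) * w"
          by (simp_all add: w_def algebra_simps)
        then show "w + unit_circ z = unit_circ z * cnj (1 + unit_circ z * (1 + unit_circ y))"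
          "w - unit_circ z = - (unit_circ z * cnj (1 - unit_circ z * (1 + unit_circ y)))"
          unfolding u by simp_all
      qed
      then have m: "cmod (w + unit_circ z) = cmod (1 + unit_circ z * (1 + unit_circ y))"
        "cmod (w - unit_circ z) = cmod (1 - unit_circ z * (1 + unit_circ y))"
        by (simp_all add: norm_mult del: complex_cnj_add complex_cnj_diff complex_cnj_mult)
      define a where "a = cmod (w + unit_circ z)"
      define b where "b = cmod (w - unit_circ z)"
      have "(w + unit_circ z) - (w - unit_circ z) \<noteq> 0" by simp
      then have "w + unit_circ z \<noteq> 0 \<or> w - unit_circ z \<noteq> 0" by (metis diff_self)
      then have "0 < max a b" by (auto simp: a_def b_def less_max_iff_disj)
      moreover have "max (a\<^sup>2) (b\<^sup>2) = (max a b)\<^sup>2"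
        by (auto simp: max_def a_def b_def power_mono dest: power2_le_imp_le)
      ultimately have "ln (max (a\<^sup>2) (b\<^sup>2)) = 2 * ln (max a b)" by (simp add: ln_realpow)
      then show ?thesis using \<phi>[of z] by (simp add: G_def L_def a_def b_def m)
    qed
    have "((\<lambda>z. ln ((cmod w)\<^sup>2 + 1 + 2 * cmod w * \<bar>cos (2 * pi * (z + \<phi>))\<bar>) / 2) has_integral 4 / pi * arctan_int (cmod w) / 2) {0..1}"
      by (intro has_integral_divide ln_quadratic_abs_cos_mean) simp
    then show ?thesis unfolding eqG[symmetric] by (simp add: w)
  qed
  have outer: "((\<lambda>z. integral {0..1} (G z)) has_integral 28 / (5 * pi ^ 2) * zeta 3) {0..1}"
  proof -
    have "continuous_on {0..1} (\<lambda>z. integral (cbox 0 1) (G z))"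
      by (rule integral_continuous_on_param) (simp add: case_prod_unfold, intro G_cont continuous_intros)
    then have "((\<lambda>z. integral {0..1} (G z)) has_integral integral {0..1} (\<lambda>z. integral {0..1} (G z))) {0..1}"
      by (intro integrable_integral integrable_continuous_interval) simp
    also have "integral {0..1} (\<lambda>z. integral {0..1} (G z)) = integral {0..1} (\<lambda>y. integral {0..1} (\<lambda>z. G z y))"
      using integral_swap_continuous[of "0::real" "0::real" "1::real" "1::real" G]
      by (simp add: case_prod_unfold G_cont continuous_intros)
    also have "\<dots> = integral {0..1} (\<lambda>y. 2 / pi * arctan_int (modulus_at y))"
      unfolding Gz[THEN integral_unique] ..
    also have "\<dots> = 2 / pi * (14 / (5 * pi) * zeta 3)"
      by (intro integral_unique has_integral_mult_right arctan_int_modulus_mean)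
    finally show ?thesis by (simp add: power2_eq_square mult_ac)
  qed
  show ?thesis
  proof (rule mahler_measure_iterated[where i = 2 and j = 1 and k = 0 and F = F and ?J1.0 = J1])
    show "ln (cmod (laurent_eval ((1 + X) + (1 - X) * (Y + Z)) (\<lambda>n. unit_circ (\<theta> n)))) = F (\<theta> 2) (\<theta> 1) (\<theta> 0)" for \<theta>
    proof -
      have "laurent_eval ((1 + X) + (1 - X) * (Y + Z)) (\<lambda>n. unit_circ (\<theta> n)) =
        (1 + (unit_circ (\<theta> 1) + unit_circ (\<theta> 2))) + (1 - (unit_circ (\<theta> 1) + unit_circ (\<theta> 2))) * unit_circ (\<theta> 0)"
        by (simp add: laurent_eval_simps algebra_simps)
      then show ?thesis by (simp add: F_def)
    qed
    show "(\<lambda>(z, y, x). F z y x) \<in> borel_measurable (borel \<Otimes>\<^sub>M borel \<Otimes>\<^sub>M borel)"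
      unfolding F_def by measurable
  qed (use inner middle outer in auto)
qed

text \<open>With \<open>r = \<bar>1 + x\<bar>\<close> the coefficients in \<open>z\<close> have
  moduli \<open>r^2 + 1\<close> and \<open>r^2 + 1 + 2 * r * cos\<close> of a shifted angle, so
  their maximum contains the positive part of the cosine.\<close>

lemma mahler_measure_golden:
  "mahler_measure 3 (X + (1 + X) ^ 2 + (1 + X + Y) ^ 2 * Z) =
     28 / (5 * pi ^ 2) * zeta 3 + ln ((1 + sqrt 5) / 2)"
proof -
  define B where "B x = (modulus_at x)\<^sup>2 + 1" for x
  define c where "c x = unit_circ x + (1 + unit_circ x)\<^sup>2" for x
  define d where "d x y = (1 + unit_circ x + unit_circ y)\<^sup>2" for x y
  define F where "F x y z = ln (cmod (c x + d x y * unit_circ z))" for x y z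
  define J1 where "J1 x y = ln (max (cmod (c x)) (cmod (d x y)))" for x y
  define J2 where "J2 x = 2 / pi * arctan_int (modulus_at x) + ln (B x) / 2" for x
  have B: "B x \<ge> 1" for x by (simp add: B_def)
  have c: "cmod (c x) = B x" for x
  proof -
    have "c x = unit_circ x * of_real (B x)"
      by (simp add: c_def one_plus_unit_circ_sq B_def algebra_simps)
    then show ?thesis using B[of x] by (simp add: norm_mult)
  qed
  have inner: "(F x y has_integral J1 x y) {0..1}" for x y
  proof -
    have "c x \<noteq> 0" using c[of x] B[of x] by auto
    then show ?thesis unfolding F_def J1_def by (intro jensen_linear) auto
  qed
  have middle: "(J1 x has_integral J2 x) {0..1}" for x
  proof -
    obtain \<phi> where \<phi>: "\<And>t. (cmod (1 + unit_circ x + unit_circ t))\<^sup>2 =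
        (cmod (1 + unit_circ x))\<^sup>2 + 1 + 2 * cmod (1 + unit_circ x) * cos (2 * pi * (t + \<phi>))"
      using cmod_add_unit_circ_phase by blast
    have "J1 x y = ln ((modulus_at x)\<^sup>2 + 1 + 2 * modulus_at x * max 0 (cos (2 * pi * (y + \<phi>))))" for y
    proof -
      have "max B' (B' + r * k) = B' + r * max 0 k" if "0 \<le> r" for B' r k :: real
        using that by (auto simp: max_def mult_le_0_iff zero_le_mult_iff)
      from this[of "2 * modulus_at x" "(modulus_at x)\<^sup>2 + 1"]
      have "max (B x) ((modulus_at x)\<^sup>2 + 1 + 2 * modulus_at x * cos (2 * pi * (y + \<phi>)))
          = (modulus_at x)\<^sup>2 + 1 + 2 * modulus_at x * max 0 (cos (2 * pi * (y + \<phi>)))"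
        unfolding B_def by simp
      moreover have "cmod (d x y) = (modulus_at x)\<^sup>2 + 1 + 2 * modulus_at x * cos (2 * pi * (y + \<phi>))"
        unfolding d_def norm_power \<phi> modulus_at_eq ..
      ultimately show ?thesis unfolding J1_def c by (simp only:)
    qed
    then have "J1 x = (\<lambda>y. ln ((modulus_at x)\<^sup>2 + 1 + 2 * modulus_at x * max 0 (cos (2 * pi * (y + \<phi>)))))"
      by (rule ext)
    then show ?thesis unfolding J2_def B_def by (simp only:) (rule ln_quadratic_max_cos_mean, simp)
  qed
  have outer: "(J2 has_integral 28 / (5 * pi ^ 2) * zeta 3 + ln ((1 + sqrt 5) / 2)) {0..1}"
  proof -
    \<comment> \<open>The roots of \<open>1 + 3 * x + x^2\<close> are \<open>- p^2\<close> and
      \<open>- 1 / p^2\<close> for the golden ratio \<open>p\<close>. Only the first lies outside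
      the unit circle, so the mean of \<open>ln (B t)\<close> is \<open>2 * ln p\<close>.\<close>
    define p :: real where "p = (1 + sqrt 5) / 2"
    have "1 < sqrt (5::real)" by simp
    then have p: "1 < p" by (simp add: p_def)
    have p2: "p\<^sup>2 = p + 1" by (simp add: p_def power2_eq_square field_simps)
    then have sum: "p\<^sup>2 + (1 / p)\<^sup>2 = 3" and "p * (p - 1) = 1"
    proof -
      show 1: "p * (p - 1) = 1" using p2 by (simp add: algebra_simps power2_eq_square)
      then have "1 / p = p - 1" using p by (simp add: field_simps)
      then show "p\<^sup>2 + (1 / p)\<^sup>2 = 3" using p2 by (simp add: power2_diff)
    qed
    have "((\<lambda>t. ln (cmod ((of_real (p\<^sup>2) + 1 * unit_circ t) * (of_real ((1 / p)\<^sup>2) + 1 * unit_circ t)))) has_integral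
      ln (max (cmod (of_real (p\<^sup>2))) (cmod 1)) + ln (max (cmod (of_real ((1 / p)\<^sup>2))) (cmod 1))) {0..1}"
      by (rule jensen_two_factors) auto
    moreover have "cmod ((of_real (p\<^sup>2) + 1 * unit_circ t) * (of_real ((1 / p)\<^sup>2) + 1 * unit_circ t)) = B t" for t
    proof -
      have "(of_real (p\<^sup>2) + 1 * unit_circ t) * (of_real ((1 / p)\<^sup>2) + 1 * unit_circ t) =
          of_real (p\<^sup>2 * (1 / p)\<^sup>2) + of_real (p\<^sup>2 + (1 / p)\<^sup>2) * unit_circ t + (unit_circ t)\<^sup>2"
        by (simp add: algebra_simps power2_eq_square)
      also have "p\<^sup>2 * (1 / p)\<^sup>2 = 1" using p by (simp flip: power_mult_distrib)
      also have "of_real 1 + of_real (p\<^sup>2 + (1 / p)\<^sup>2) * unit_circ t + (unit_circ t)\<^sup>2 = c t"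
        unfolding sum c_def by (simp add: algebra_simps power2_eq_square)
      finally show ?thesis by (simp only: c)
    qed
    moreover have "max (cmod (of_real (p\<^sup>2))) (cmod 1) = p\<^sup>2"
      using p one_le_power[of p 2] unfolding norm_of_real by (subst max_absorb1) auto
    moreover have "max (cmod (of_real ((1 / p)\<^sup>2))) (cmod 1) = 1"
      using p by (simp add: max_def power_le_one norm_divide norm_power)
    ultimately have "((\<lambda>t. ln (B t)) has_integral 2 * ln p) {0..1}"
      using p by (simp add: ln_realpow)
    from has_integral_add[OF has_integral_mult_right[OF arctan_int_modulus_mean, of "2 / pi"] has_integral_divide[OF this, of 2]]
    have "(J2 has_integral 2 / pi * (14 / (5 * pi) * zeta 3) + 2 * ln p / 2) {0..1}"
      by (simp only: J2_def[abs_def])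
    then show ?thesis by (simp add: p_def power2_eq_square mult_ac)
  qed
  show ?thesis
  proof (rule mahler_measure_iterated[where i = 0 and j = 1 and k = 2 and F = F and ?J1.0 = J1])
    show "ln (cmod (laurent_eval (X + (1 + X) ^ 2 + (1 + X + Y) ^ 2 * Z) (\<lambda>n. unit_circ (\<theta> n)))) = F (\<theta> 0) (\<theta> 1) (\<theta> 2)" for \<theta>
      by (simp add: laurent_eval_simps F_def c_def d_def)
    show "(\<lambda>(x, y, z). F x y z) \<in> borel_measurable (borel \<Otimes>\<^sub>M borel \<Otimes>\<^sub>M borel)"
      unfolding F_def c_def d_def by measurable
  qed (use inner middle outer in auto)
qed

lemma borel_measurable_cnj [measurable]: "cnj \<in> borel_measurable borel"
  by (intro borel_measurable_continuous_onI continuous_intros)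

text \<open>On the circle inversion is conjugation, so the coefficients in \<open>y\<close> are
  \<open>\<bar>1 + x + z\<bar>^2\<close> and \<open>\<bar>1 + x - z\<bar>^2\<close>; the squares
  account for twice the value of the bilinear case.\<close>

lemma mahler_measure_reciprocal:
  "mahler_measure 3 ((1 + X + Z) * (1 + X_inv + Z_inv) + Y * (1 + X - Z) * (1 + X_inv - Z_inv)) =
     56 / (5 * pi ^ 2) * zeta 3"
proof -
  define c where "c x z = 1 + unit_circ x + unit_circ z" for x z
  define d where "d x z = 1 + unit_circ x - unit_circ z" for x z
  define F where "F x z y = ln (cmod (c x z * cnj (c x z) + d x z * cnj (d x z) * unit_circ y))" for x z y
  define J1 where "J1 x z = ln (max ((cmod (c x z))\<^sup>2) ((cmod (d x z))\<^sup>2))" for x z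
  define J2 where "J2 x = 4 / pi * arctan_int (modulus_at x)" for x
  have inner: "(F x z has_integral J1 x z) {0..1}" for x z
  proof -
    have "c x z - d x z \<noteq> 0" by (simp add: c_def d_def)
    then have "c x z \<noteq> 0 \<or> d x z \<noteq> 0" by (metis diff_self)
    then have "c x z * cnj (c x z) \<noteq> 0 \<or> d x z * cnj (d x z) \<noteq> 0" by simp
    from jensen_linear[OF this] show ?thesis
      by (simp add: F_def[abs_def] J1_def norm_mult power2_eq_square)
  qed
  have middle: "(J1 x has_integral J2 x) {0..1}" for x
  proof -
    obtain \<phi> where \<phi>: "\<And>t. J1 x t = ln ((cmod (1 + unit_circ x))\<^sup>2 + 1 + 2 * cmod (1 + unit_circ x) * \<bar>cos (2 * pi * (t + \<phi>))\<bar>)"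
      using ln_max_plus_minus[of "1 + unit_circ x"] unfolding J1_def c_def d_def by blast
    have "J1 x = (\<lambda>t. ln ((modulus_at x)\<^sup>2 + 1 + 2 * modulus_at x * \<bar>cos (2 * pi * (t + \<phi>))\<bar>))"
      by (rule ext) (simp only: \<phi> modulus_at_eq)
    then show ?thesis unfolding J2_def by (simp only:) (rule ln_quadratic_abs_cos_mean, simp)
  qed
  have outer: "(J2 has_integral 56 / (5 * pi ^ 2) * zeta 3) {0..1}"
    using has_integral_mult_right[OF arctan_int_modulus_mean, of "4 / pi"]
    by (simp add: J2_def[abs_def] power2_eq_square mult_ac)
  show ?thesis
  proof (rule mahler_measure_iterated[where i = 0 and j = 2 and k = 1 and F = F and ?J1.0 = J1])
    show "ln (cmod (laurent_eval ((1 + X + Z) * (1 + X_inv + Z_inv) + Y * (1 + X - Z) * (1 + X_inv - Z_inv)) (\<lambda>n. unit_circ (\<theta> n)))) = F (\<theta> 0) (\<theta> 2) (\<theta> 1)" for \<theta>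
      by (simp add: laurent_eval_simps F_def c_def d_def unit_circ_inverse mult_ac)
    show "(\<lambda>(x, z, y). F x z y) \<in> borel_measurable (borel \<Otimes>\<^sub>M borel \<Otimes>\<^sub>M borel)"
      unfolding F_def c_def d_def by measurable
  qed (use inner middle outer in auto)
qed

lemma unit_circ_plus_cnj: "unit_circ t + cnj (unit_circ t) = of_real (2 * cos (2 * pi * t))"
  by (simp add: unit_circ_def complex_eq_iff)

text \<open>Multiplied by \<open>z\<close> this is \<open>z^2 + k * z - 1\<close> with
  \<open>k\<close> real. For \<open>sinh a = k / 2\<close> it factors as
  \<open>(z + exp a) * (z - exp (- a))\<close>, and Jensen's formula gives
  \<open>\<bar>a\<bar>\<close>.\<close>

lemma mahler_measure_antisymmetric:
  "mahler_measure 3 ((Z - Z_inv) + (X + X_inv) * (Y + Y_inv)) = 28 / (5 * pi ^ 2) * zeta 3"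
proof -
  define k where "k x y = 4 * cos (2 * pi * x) * cos (2 * pi * y)" for x y
  define a where "a x y = arsinh (k x y / 2)" for x y
  define F where "F x y z = ln (cmod ((of_real (exp (a x y)) + 1 * unit_circ z) * (of_real (- exp (- a x y)) + 1 * unit_circ z)))" for x y z
  define J1 where "J1 x y = arsinh (2 * \<bar>cos (2 * pi * x)\<bar> * \<bar>cos (2 * pi * y)\<bar>)" for x y
  define J2 where "J2 x = 2 / pi * arctan_int (2 * \<bar>cos (2 * pi * x)\<bar>)" for x
  have inner: "(F x y has_integral J1 x y) {0..1}" for x y
  proof -
    have "ln (max (cmod (of_real (exp (a x y)))) (cmod 1)) + ln (max (cmod (of_real (- exp (- a x y)))) (cmod 1)) = \<bar>a x y\<bar>"
      by (cases "0 \<le> a x y") (auto simp: max_def)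
    also have "\<bar>a x y\<bar> = J1 x y"
    proof -
      have "\<bar>arsinh u\<bar> = arsinh \<bar>u\<bar>" for u :: real
        using arsinh_real_neg_iff[of u] arsinh_real_pos_iff[of u] by (cases "u = 0") (auto simp: abs_if)
      then show ?thesis by (simp add: a_def J1_def k_def abs_mult mult.assoc)
    qed
    finally have eq: "ln (max (cmod (of_real (exp (a x y)))) (cmod 1)) + ln (max (cmod (of_real (- exp (- a x y)))) (cmod 1)) = J1 x y" .
    show ?thesis unfolding F_def eq[symmetric] by (rule jensen_two_factors) auto
  qed
  have middle: "(J1 x has_integral J2 x) {0..1}" for x
    unfolding J1_def J2_def by (rule has_integral_abs_cos_double[OF arsinh_integral]) simp
  have outer: "(J2 has_integral 28 / (5 * pi ^ 2) * zeta 3) {0..1}"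
    using has_integral_mult_right[OF has_integral_abs_cos_double[OF arctan_int_mean], of "2 / pi"]
    by (simp add: J2_def[abs_def] power2_eq_square mult_ac)
  show ?thesis
  proof (rule mahler_measure_iterated[where i = 0 and j = 1 and k = 2 and F = F and ?J1.0 = J1])
    show "ln (cmod (laurent_eval ((Z - Z_inv) + (X + X_inv) * (Y + Y_inv)) (\<lambda>n. unit_circ (\<theta> n)))) = F (\<theta> 0) (\<theta> 1) (\<theta> 2)" for \<theta>
    proof -
      define x y z where "x = unit_circ (\<theta> 0)" and "y = unit_circ (\<theta> 1)" and "z = unit_circ (\<theta> 2)"
      let ?k = "k (\<theta> 0) (\<theta> 1)" and ?a = "a (\<theta> 0) (\<theta> 1)"
      have xy: "(x + cnj x) * (y + cnj y) = of_real ?k"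
        by (simp add: x_def y_def unit_circ_plus_cnj k_def)
      have k: "exp ?a - exp (- ?a) = ?k"
        using sinh_arsinh_real[of "?k / 2"] by (simp add: a_def sinh_def)
      have z: "z * cnj z = 1" by (simp add: z_def complex_norm_square[symmetric])
      have "z * ((z - cnj z) + (x + cnj x) * (y + cnj y)) = z * z - z * cnj z + z * of_real ?k"
        unfolding xy by (simp add: algebra_simps)
      also have "\<dots> = (of_real (exp ?a) + 1 * z) * (of_real (- exp (- ?a)) + 1 * z)"
      proof -
        have "(of_real (exp ?a) + 1 * z) * (of_real (- exp (- ?a)) + 1 * z) =
            z * z + z * of_real (exp ?a - exp (- ?a)) - of_real (exp ?a * exp (- ?a))"
          by (simp add: algebra_simps)
        then show ?thesis unfolding k z exp_minus_inverse by simp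
      qed
      finally have "cmod ((z - cnj z) + (x + cnj x) * (y + cnj y)) = cmod ((of_real (exp ?a) + 1 * z) * (of_real (- exp (- ?a)) + 1 * z))"
        by (metis norm_mult mult_1 unit_circ_simps(1) z_def)
      then show ?thesis
        by (simp add: laurent_eval_simps F_def unit_circ_inverse x_def y_def z_def)
    qed
    show "(\<lambda>(x, y, z). F x y z) \<in> borel_measurable (borel \<Otimes>\<^sub>M borel \<Otimes>\<^sub>M borel)"
      unfolding F_def a_def k_def arsinh_real_def by measurable
  qed (use inner middle outer in auto)
qed

text \<open>Up to a monomial of modulus 1 this is a difference of squares
  \<open>4 * d^2 * (1 + y)^2 - 4 * e^2\<close>, which splits into linear factors in
  \<open>y\<close>. As \<open>0 \<le> e \<le> d\<close>, Jensen's formula gives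
  \<open>ln (4 * d) + ln (d + e)\<close>.\<close>

lemma mahler_measure_catalan:
  "mahler_measure 3
     ((4 * Z * (1 + Y) ^ 2 - (1 + Z) ^ 2) * (1 + 3 * X + X ^ 2) ^ 2 +
      (1 - Z) ^ 2 * (1 + Y) ^ 2 * (1 + X + X ^ 2) ^ 2) =
   56 / (5 * pi ^ 2) * zeta 3 + 16 / (3 * pi) * catalan_const + ln 2"
proof -
  define B where "B x = (modulus_at x)\<^sup>2 + 1" for x
  define D where "D x z = ellip (modulus_at x) \<bar>cos (pi * z)\<bar>" for x z
  define E where "E x z = B x * \<bar>cos (pi * z)\<bar>" for x z
  define F where "F x z y = ln (cmod ((of_real (4 * (D x z - E x z)) + of_real (4 * D x z) * unit_circ y) *
    (of_real (D x z + E x z) + of_real (D x z) * unit_circ y)))" for x z y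
  define J1 where "J1 x z = ln 4 + ln (D x z) + ln (D x z + E x z)" for x z
  define J2 where "J2 x = ln 4 + (2 * ln (1 + modulus_at x) - ln 2) + 2 / pi * (2 * arctan_int (modulus_at x))" for x
  have D0: "0 \<le> D x z" and E0: "0 \<le> E x z" for x z by (auto simp: D_def E_def B_def ellip_def)
  \<comment> \<open>With \<open>r = \<bar>1 + x\<bar>\<close> and
    \<open>c = \<bar>1 + z\<bar> / 2\<close> the difference of the squares is
    \<open>4 * r^2 * (1 - c^2)\<close>.\<close>
  have DE: "E x z \<le> D x z" for x z
  proof -
    have "(cos (pi * z))\<^sup>2 \<le> 1" by (simp add: abs_square_le_1)
    then have "4 * (modulus_at x)\<^sup>2 * (cos (pi * z))\<^sup>2 \<le> 4 * (modulus_at x)\<^sup>2 * 1" by (intro mult_left_mono) auto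
    moreover have "(E x z)\<^sup>2 = (((modulus_at x)\<^sup>2 - 1) * \<bar>cos (pi * z)\<bar>)\<^sup>2 + 4 * (modulus_at x)\<^sup>2 * (cos (pi * z))\<^sup>2"
    proof -
      have "((m + 1) * v)\<^sup>2 = ((m - 1) * v)\<^sup>2 + 4 * m * v\<^sup>2" for m v :: real by algebra
      from this[of "(modulus_at x)\<^sup>2" "\<bar>cos (pi * z)\<bar>"] show ?thesis by (simp add: E_def B_def)
    qed
    ultimately have "(E x z)\<^sup>2 \<le> (D x z)\<^sup>2" by (simp add: D_def ellip_sq)
    then show ?thesis using D0 by (rule power2_le_imp_le)
  qed
  have modulus_pos: "0 < modulus_at x" if "x \<in> {0..1} - {1/2}" for x
    using unit_circ_eq_neg1_iff[of x] that modulus_at_eq[of x] by (metis Diff_iff insertCI zero_less_norm_iff)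
  have inner: "(F x z has_integral J1 x z) {0..1}" if x: "x \<in> {0..1} - {1/2}" for x z
  proof -
    have D: "0 < D x z" using modulus_pos[OF x] by (auto simp: D_def intro!: ellip_pos)
    have "max (cmod (of_real (4 * (D x z - E x z)))) (cmod (of_real (4 * D x z))) = 4 * D x z"
      "max (cmod (of_real (D x z + E x z))) (cmod (of_real (D x z))) = D x z + E x z"
      unfolding norm_of_real using D DE[of x z] E0[of x z] by (simp_all add: max_def abs_if)
    then have eq: "ln (max (cmod (of_real (4 * (D x z - E x z)))) (cmod (of_real (4 * D x z)))) +
       ln (max (cmod (of_real (D x z + E x z))) (cmod (of_real (D x z)))) = J1 x z"
      using D by (simp add: J1_def ln_mult)
    show ?thesis unfolding F_def eq[symmetric]
      using D by (intro jensen_two_factors) (simp_all del: of_real_mult)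
  qed
  have middle: "(J1 x has_integral J2 x) {0..1}" for x
    unfolding J1_def J2_def D_def E_def B_def
    using has_integral_const_real[of "ln 4" 0 1]
    by (intro has_integral_add ln_ellip_mean has_integral_abs_cos[OF ln_ellip_integral]) simp_all
  have outer: "(J2 has_integral 56 / (5 * pi ^ 2) * zeta 3 + 16 / (3 * pi) * catalan_const + ln 2) {0..1}"
  proof -
    have "((\<lambda>x. ln (1 + modulus_at x)) has_integral 2 / pi * (4 / 3 * catalan_const)) {0..1}"
      by (rule has_integral_abs_cos[OF ln_one_plus_two_cos_integral])
    then have "(J2 has_integral ln 4 + (2 * (2 / pi * (4 / 3 * catalan_const)) - ln 2) + 2 / pi * (2 * (14 / (5 * pi) * zeta 3))) {0..1}"
      unfolding J2_def using has_integral_const_real[of "ln 4" 0 1] has_integral_const_real[of "ln 2" 0 1]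
      by (intro has_integral_add has_integral_diff has_integral_mult_right arctan_int_modulus_mean) simp_all
    moreover have "ln 4 = 2 * ln (2::real)" using ln_realpow[of 2 2] by simp
    ultimately show ?thesis by (simp add: power2_eq_square add_ac mult_ac)
  qed
  show ?thesis
  proof (rule mahler_measure_iterated[where i = 0 and j = 2 and k = 1 and F = F and ?J1.0 = J1])
    show "ln (cmod (laurent_eval
       ((4 * Z * (1 + Y) ^ 2 - (1 + Z) ^ 2) * (1 + 3 * X + X ^ 2) ^ 2 +
        (1 - Z) ^ 2 * (1 + Y) ^ 2 * (1 + X + X ^ 2) ^ 2) (\<lambda>n. unit_circ (\<theta> n)))) = F (\<theta> 0) (\<theta> 2) (\<theta> 1)" for \<theta>
    proof -
      define x y z where "x = unit_circ (\<theta> 0)" and "y = unit_circ (\<theta> 1)" and "z = unit_circ (\<theta> 2)"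
      define d e m n :: complex where "d = of_real (D (\<theta> 0) (\<theta> 2))"
        and "e = of_real (E (\<theta> 0) (\<theta> 2))" and "m = of_real ((modulus_at (\<theta> 0))\<^sup>2)" and "n = of_real ((modulus_at (\<theta> 2))\<^sup>2)"
      have x: "(1 + x)\<^sup>2 = x * m" unfolding x_def m_def by (rule one_plus_unit_circ_sq)
      have z1: "(1 + z)\<^sup>2 = z * n" unfolding z_def n_def by (rule one_plus_unit_circ_sq)
      have z2: "(1 - z)\<^sup>2 = z * (n - 4)" unfolding z_def n_def by (simp add: one_minus_unit_circ_sq)
      have x1: "1 + 3 * x + x\<^sup>2 = x * (m + 1)" using x by algebra
      have x2: "1 + x + x\<^sup>2 = x * (m - 1)" using x by algebra
      have d: "4 * d\<^sup>2 = (m - 1)\<^sup>2 * n + 16 * m"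
      proof -
        have "4 * (D (\<theta> 0) (\<theta> 2))\<^sup>2 = ((modulus_at (\<theta> 0))\<^sup>2 - 1)\<^sup>2 * (modulus_at (\<theta> 2))\<^sup>2 + 16 * (modulus_at (\<theta> 0))\<^sup>2"
          by (simp add: D_def ellip_sq power_mult_distrib)
        then have "complex_of_real (4 * (D (\<theta> 0) (\<theta> 2))\<^sup>2) = of_real (((modulus_at (\<theta> 0))\<^sup>2 - 1)\<^sup>2 * (modulus_at (\<theta> 2))\<^sup>2 + 16 * (modulus_at (\<theta> 0))\<^sup>2)"
          by (simp only:)
        then show ?thesis by (simp only: d_def m_def n_def of_real_power of_real_diff of_real_add of_real_mult of_real_numeral of_real_1)
      qed
      have e: "4 * e\<^sup>2 = (m + 1)\<^sup>2 * n"
      proof -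
        have "4 * (E (\<theta> 0) (\<theta> 2))\<^sup>2 = ((modulus_at (\<theta> 0))\<^sup>2 + 1)\<^sup>2 * (modulus_at (\<theta> 2))\<^sup>2"
          by (simp add: E_def B_def power_mult_distrib)
        then have "complex_of_real (4 * (E (\<theta> 0) (\<theta> 2))\<^sup>2) = of_real (((modulus_at (\<theta> 0))\<^sup>2 + 1)\<^sup>2 * (modulus_at (\<theta> 2))\<^sup>2)"
          by (simp only:)
        then show ?thesis by (simp only: e_def m_def n_def of_real_power of_real_add of_real_mult of_real_numeral of_real_1)
      qed
      have "(4 * z * (1 + y)\<^sup>2 - (1 + z)\<^sup>2) * (1 + 3 * x + x\<^sup>2)\<^sup>2 + (1 - z)\<^sup>2 * (1 + y)\<^sup>2 * (1 + x + x\<^sup>2)\<^sup>2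
          = x\<^sup>2 * z * ((1 + y)\<^sup>2 * (4 * (m + 1)\<^sup>2 + (n - 4) * (m - 1)\<^sup>2) - n * (m + 1)\<^sup>2)"
        unfolding z1 z2 x1 x2 by algebra
      also have "4 * (m + 1)\<^sup>2 + (n - 4) * (m - 1)\<^sup>2 = 4 * d\<^sup>2"
        unfolding d by (simp add: power2_eq_square algebra_simps)
      also have "n * (m + 1)\<^sup>2 = 4 * e\<^sup>2" unfolding e by (rule mult.commute)
      also have "(1 + y)\<^sup>2 * (4 * d\<^sup>2) - 4 * e\<^sup>2 = (4 * (d - e) + 4 * d * y) * ((d + e) + d * y)"
        by algebra
      finally have "cmod ((4 * z * (1 + y)\<^sup>2 - (1 + z)\<^sup>2) * (1 + 3 * x + x\<^sup>2)\<^sup>2 + (1 - z)\<^sup>2 * (1 + y)\<^sup>2 * (1 + x + x\<^sup>2)\<^sup>2)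
          = cmod ((4 * (d - e) + 4 * d * y) * ((d + e) + d * y))"
        by (simp add: norm_mult norm_power x_def z_def)
      then show ?thesis
        by (simp add: laurent_eval_simps F_def x_def y_def z_def d_def e_def)
    qed
    show "(\<lambda>(x, z, y). F x z y) \<in> borel_measurable (borel \<Otimes>\<^sub>M borel \<Otimes>\<^sub>M borel)"
      unfolding F_def D_def E_def B_def ellip_def by measurable
    \<comment> \<open>At the angle 1/2 the modulus of \<open>1 + x\<close> is 0, and for
      \<open>z\<close> at the same angle the polynomial in \<open>y\<close> is identically
      zero.\<close>
    have "AE x in lborel. x \<noteq> (1/2 :: real)" by (rule AE_lborel_singleton)
    then show "AE x in lborel. AE z in lborel. x \<in> {0..1} \<longrightarrow> z \<in> {0..1} \<longrightarrow> (F x z has_integral J1 x z) {0..1}"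
      by eventually_elim (use inner in auto)
  qed (use middle outer in auto)
qed

theorem corollary3p3:
  "mahler_measure 3 ((1 + X) + (1 - X) * (Y + Z)) = 28 / (5 * pi ^ 2) * zeta 3
   \<and> mahler_measure 3 (X + (1 + X) ^ 2 + (1 + X + Y) ^ 2 * Z) =
           28 / (5 * pi ^ 2) * zeta 3 + ln ((1 + sqrt 5) / 2)
   \<and> mahler_measure 3
           ((1 + X + Z) * (1 + X_inv + Z_inv) + Y * (1 + X - Z) * (1 + X_inv - Z_inv)) =
           56 / (5 * pi ^ 2) * zeta 3
   \<and> mahler_measure 3 ((Z - Z_inv) + (X + X_inv) * (Y + Y_inv)) = 28 / (5 * pi ^ 2) * zeta 3
   \<and> mahler_measure 3
           ((4 * Z * (1 + Y) ^ 2 - (1 + Z) ^ 2) * (1 + 3 * X + X ^ 2) ^ 2 +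
            (1 - Z) ^ 2 * (1 + Y) ^ 2 * (1 + X + X ^ 2) ^ 2) =
           56 / (5 * pi ^ 2) * zeta 3 + 16 / (3 * pi) * catalan_const + ln 2"
  by (intro conjI mahler_measure_bilinear mahler_measure_golden mahler_measure_reciprocal
      mahler_measure_antisymmetric mahler_measure_catalan)

end
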